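(* Let $\alpha\ge1$, let $L$ be an $\mathsf{NP}$-hard language and let $\Pi$ be a nice parameterized optimization problem. If $L$ $\alpha$-gap cross composes into $\Pi$ and $\Pi$ has a polynomial sized $\alpha$-approximate compression, then $\mathsf{NP}\subseteq\mathsf{coNP/poly}$.
   Context: A parameterized optimization problem is a computable function $\Pi:\Sigma^*\times\mathbb{N}\times\Sigma^*\to\mathbb{R}\cup\{\pm\infty\}$ (minimization or maximization); solutions to an instance $(I,k)$ are strings $s$ with $|s|\le|I|+k$, with value $\Pi(I,k,s)$, and $OPT_\Pi(I,k)$ is the min (resp. max) value. $\Pi$ is nice if the function $\Pi$ is computable in polynomial time. An equivalence relation $R$ on $\Sigma^*$ is a polynomial equivalence relation if equivalence of $x,y$ is decidable in time polynomial in $|x|+|y|$ and every finite $S\subseteq\Sigma^*$ has at most $(\max_{x\in S}|x|)^{O(1)}$ equivalence classes. $L\subseteq\Sigma^*$ $\alpha$-gap cross composes into a maximization problem $\Pi$ if there are a polynomial equivalence relation $R$ and an algorithm that, given $x_1,\dots,x_t$ in the same $R$-class, computes in time polynomial in $\sum_i|x_i|$ an instance $(y,k)$ of $\Pi$ and $r\in\mathbb{R}$ such that: (i) $OPT(y,k)\ge r$ iff $x_i\in L$ for some $i$; (ii) $OPT(y,k)<r/\alpha$ iff $x_i\notin L$ for all $i$; (iii) $k$ is bounded by a polynomial in $\log t+\max_i|x_i|$. For a minimization problem, (i),(ii) are replaced by: $OPT(y,k)\le r$ iff some $x_i\in L$; $OPT(y,k)>r\alpha$ iff all $x_i\notin L$.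 An $\alpha$-approximate polynomial parameter transformation from $\Pi$ to a parameterized optimization problem $\Pi'$ is a pair of polynomial time algorithms: a reduction algorithm mapping an instance $(I,k)$ of $\Pi$ to an instance $(I',k')$ of $\Pi'$, and a solution lifting algorithm that, given $(I,k),(I',k')$ and a solution $s'$ of $(I',k')$, outputs a solution $s$ of $(I,k)$ with $\frac{\Pi(I,k,s)}{OPT_\Pi(I,k)}\le\alpha\frac{\Pi'(I',k',s')}{OPT_{\Pi'}(I',k')}$ if $\Pi$ is a minimization problem and $\frac{\Pi(I,k,s)}{OPT_\Pi(I,k)}\cdot\alpha\ge\frac{\Pi'(I',k',s')}{OPT_{\Pi'}(I',k')}$ if $\Pi$ is a maximization problem. An $\alpha$-approximate compression of $\Pi$ is such a transformation into some parameterized optimization problem $\Pi'$ for which $\sup\{|I'|+k'\}$ over outputs on parameter-$k$ inputs is bounded by a computable $g(k)$; it is polynomial sized if $g$ is a polynomial.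
   Formalization: The ratio Π(I,k,s)/OPT is taken as 1 for an optimal solution and, when OPT ≤ 0, as the worst value (±∞) for any other solution, since the bare quotient is undefined at 0/0 and makes the guarantee void for negative optima; values and r are output as exact fractions or ±∞. *)

theory Defs
  imports
    Complex_Main
    "HOL-Library.Extended_Real"
    "HOL-Computational_Algebra.Polynomial"
begin

section \<open>Computation\<close>

text \<open>
  Strings are over the binary alphabet.  The machine model is the multi-stack machine with
  structured control: a program works on finitely many registers, each holding a string, and in one
  time step it pushes or pops one bit of one register or tests the top of one register.  A
  tape is a pair of stacks, so with respect to running time this is a multi-tape Turing
  machine up to a constant factor.
\<close>

type_synonym str = "bool list"

datatype prog =
    Skip
  | Push nat bool
  | Pop nat
  | Seq prog prog
  | Branch nat prog prog prog
  | While nat prog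

text \<open>
  \<open>exec p \<sigma> t \<tau>\<close>: started in the store \<open>\<sigma>\<close>, the program \<open>p\<close> halts after
  \<open>t\<close> steps in the store \<open>\<tau>\<close>.  The three branches of \<^const>\<open>Branch\<close> are for an empty register,
  top bit \<^const>\<open>False\<close> and top bit \<^const>\<open>True\<close>; \<^const>\<open>While\<close> loops until its register is empty.
\<close>

inductive exec :: "prog \<Rightarrow> (nat \<Rightarrow> str) \<Rightarrow> nat \<Rightarrow> (nat \<Rightarrow> str) \<Rightarrow> bool" where
  exec_Skip: "exec Skip \<sigma> 1 \<sigma>"
| exec_Push: "exec (Push r b) \<sigma> 1 (\<sigma>(r := b # \<sigma> r))"
| exec_Pop: "exec (Pop r) \<sigma> 1 (\<sigma>(r := tl (\<sigma> r)))"
| exec_Seq: "exec p \<sigma> t \<sigma>' \<Longrightarrow> exec q \<sigma>' u \<sigma>'' \<Longrightarrow> exec (Seq p q) \<sigma> (t + u) \<sigma>''"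
| exec_Branch_empty: "\<sigma> r = [] \<Longrightarrow> exec p \<sigma> t \<tau> \<Longrightarrow> exec (Branch r p p0 p1) \<sigma> (Suc t) \<tau>"
| exec_Branch_False: "\<sigma> r = False # w \<Longrightarrow> exec p0 \<sigma> t \<tau> \<Longrightarrow> exec (Branch r p p0 p1) \<sigma> (Suc t) \<tau>"
| exec_Branch_True: "\<sigma> r = True # w \<Longrightarrow> exec p1 \<sigma> t \<tau> \<Longrightarrow> exec (Branch r p p0 p1) \<sigma> (Suc t) \<tau>"
| exec_While_empty: "\<sigma> r = [] \<Longrightarrow> exec (While r p) \<sigma> 1 \<sigma>"
| exec_While_step: "\<sigma> r \<noteq> [] \<Longrightarrow> exec p \<sigma> t \<sigma>' \<Longrightarrow> exec (While r p) \<sigma>' u \<tau>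
    \<Longrightarrow> exec (While r p) \<sigma> (Suc (t + u)) \<tau>"

text \<open>
  Inputs and outputs are lists of strings, held in the registers \<open>0, 1, \<dots>\<close>; all other registers
  are initially empty and their final contents are irrelevant.
\<close>

definition init_store :: "str list \<Rightarrow> nat \<Rightarrow> str" where
  "init_store xs = (\<lambda>i. if i < length xs then xs ! i else [])"

definition yields :: "prog \<Rightarrow> str list \<Rightarrow> nat \<Rightarrow> str list \<Rightarrow> bool" where
  "yields p xs t ys \<longleftrightarrow>
     (\<exists>\<tau>. exec p (init_store xs) t \<tau> \<and> (\<forall>i < length ys. \<tau> i = ys ! i))"

text \<open>
  \<open>f\<close> is computable (in polynomial time) on the inputs in \<open>A\<close>, where inputs and outputs are
  presented to the machine through the encodings \<open>ein\<close> and \<open>eout\<close>.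
\<close>

definition computable_on ::
  "'a set \<Rightarrow> ('a \<Rightarrow> str list) \<Rightarrow> ('b \<Rightarrow> str list) \<Rightarrow> ('a \<Rightarrow> 'b) \<Rightarrow> bool" where
  "computable_on A ein eout f \<longleftrightarrow> (\<exists>p. \<forall>a\<in>A. \<exists>t. yields p (ein a) t (eout (f a)))"

definition polytime_on ::
  "'a set \<Rightarrow> ('a \<Rightarrow> str list) \<Rightarrow> ('b \<Rightarrow> str list) \<Rightarrow> ('a \<Rightarrow> 'b) \<Rightarrow> bool" where
  "polytime_on A ein eout f \<longleftrightarrow>
     (\<exists>p. \<exists>q :: nat poly. \<forall>a\<in>A. \<exists>t. yields p (ein a) t (eout (f a)) \<and>
        t \<le> poly q (sum_list (map length (ein a))))"

definition unary :: "nat \<Rightarrow> str" where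
  "unary k = replicate k True"

definition str_code :: "str \<Rightarrow> str list" where
  "str_code x = [x]"

definition str_pair_code :: "str \<times> str \<Rightarrow> str list" where
  "str_pair_code = (\<lambda>(x, y). [x, y])"

definition nat_code :: "nat \<Rightarrow> str list" where
  "nat_code k = [unary k]"

definition bool_code :: "bool \<Rightarrow> str list" where
  "bool_code b = [[b]]"

text \<open>A self-delimiting code for a list of strings: each bit \<open>b\<close> becomes \<open>1b\<close>, each end is \<open>0\<close>.\<close>

definition enc_list :: "str list \<Rightarrow> str" where
  "enc_list xs = concat (map (\<lambda>x. concat (map (\<lambda>b. [True, b]) x) @ [False]) xs)"

definition str_list_code :: "str list \<Rightarrow> str list" where
  "str_list_code xs = [enc_list xs]"

text \<open>
  Numerical outputs are exact: a triple (sign, numerator, denominator) with numerator and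
  denominator in binary, least significant bit first.  A denominator of value \<open>0\<close> encodes an infinite
  value.  Representations are not required to be reduced.
\<close>

type_synonym numeral_code = "str \<times> str \<times> str"

definition binary :: "str \<Rightarrow> nat" where
  "binary bs = horner_sum of_bool 2 bs"

definition num_value :: "numeral_code \<Rightarrow> ereal" where
  "num_value = (\<lambda>(sg, a, b).
     (if sg = [] then 1 else - 1) *
     (if binary b = 0 then \<infinity> else ereal (real (binary a) / real (binary b))))"

definition num_code :: "numeral_code \<Rightarrow> str list" where
  "num_code = (\<lambda>(sg, a, b). [sg, a, b])"

section \<open>Complexity classes\<close>

definition NP :: "str set set" where
  "NP = {A. \<exists>V. \<exists>q :: nat poly.
     polytime_on UNIV str_pair_code bool_code (\<lambda>z. z \<in> V) \<and>
     (\<forall>x. x \<in> A \<longleftrightarrow> (\<exists>w. length w \<le> poly q (length x) \<and> (x, w) \<in> V))}"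

definition coNP :: "str set set" where
  "coNP = {A. - A \<in> NP}"

definition per_poly :: "str set set \<Rightarrow> str set set" where
  "per_poly C = {A. \<exists>B\<in>C. \<exists>adv :: nat \<Rightarrow> str. \<exists>q :: nat poly.
     (\<forall>n. length (adv n) \<le> poly q n) \<and>
     (\<forall>x. x \<in> A \<longleftrightarrow> enc_list [x, adv (length x)] \<in> B)}"

definition karp_reducible :: "str set \<Rightarrow> str set \<Rightarrow> bool" where
  "karp_reducible A B \<longleftrightarrow>
     (\<exists>f. polytime_on UNIV str_code str_code f \<and> (\<forall>x. x \<in> A \<longleftrightarrow> f x \<in> B))"

definition NP_hard :: "str set \<Rightarrow> bool" where
  "NP_hard L \<longleftrightarrow> (\<forall>A\<in>NP. karp_reducible A L)"

section \<open>Parameterized optimization problems\<close>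

datatype sense = Minimize | Maximize

datatype opt_problem =
  Opt_Problem (sense: sense) (objective: "str \<Rightarrow> nat \<Rightarrow> str \<Rightarrow> ereal")

type_synonym instance_pair = "str \<times> nat"

text \<open>The parameter is given in unary, in accordance with the instance size \<open>|I| + k\<close>.\<close>

definition inst_code :: "instance_pair \<Rightarrow> str list" where
  "inst_code = (\<lambda>(I, k). [I, unary k])"

definition inst_sol_code :: "instance_pair \<times> str \<Rightarrow> str list" where
  "inst_sol_code = (\<lambda>(x, s). inst_code x @ [s])"

definition param_opt_problem :: "opt_problem \<Rightarrow> bool" where
  "param_opt_problem P \<longleftrightarrow>
     (\<exists>f. computable_on UNIV inst_sol_code num_code f \<and>
          (\<forall>I k s. num_value (f ((I, k), s)) = objective P I k s))"

definition nice :: "opt_problem \<Rightarrow> bool" where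
  "nice P \<longleftrightarrow>
     (\<exists>f. polytime_on UNIV inst_sol_code num_code f \<and>
          (\<forall>I k s. num_value (f ((I, k), s)) = objective P I k s))"

definition solutions :: "str \<Rightarrow> nat \<Rightarrow> str set" where
  "solutions I k = {s. length s \<le> length I + k}"

definition OPT :: "opt_problem \<Rightarrow> str \<Rightarrow> nat \<Rightarrow> ereal" where
  "OPT P I k = (case sense P of
     Minimize \<Rightarrow> Min (objective P I k ` solutions I k)
   | Maximize \<Rightarrow> Max (objective P I k ` solutions I k))"

section \<open>Gap cross composition\<close>

text \<open>
  \<^term>\<open>S // R\<close> consists of the classes \<^term>\<open>R `` {x}\<close> with \<^term>\<open>x \<in> S\<close>.  The bound on the number
  of classes is read as polynomial in the maximum length, so that it makes sense for lengths
  \<open>0\<close> and \<open>1\<close>.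
\<close>

definition poly_equiv_rel :: "(str \<times> str) set \<Rightarrow> bool" where
  "poly_equiv_rel R \<longleftrightarrow> equiv UNIV R \<and>
     polytime_on UNIV str_pair_code bool_code (\<lambda>z. z \<in> R) \<and>
     (\<exists>q :: nat poly. \<forall>S. finite S \<and> S \<noteq> {} \<longrightarrow>
        card (S // R) \<le> poly q (Max (length ` S)))"

definition composed_code :: "instance_pair \<times> numeral_code \<Rightarrow> str list" where
  "composed_code = (\<lambda>(x, c). inst_code x @ num_code c)"

text \<open>
  The running time is measured in the length of \<^term>\<open>enc_list xs\<close>, which is the total length
  (doubled) plus the number of strings; this differs from the total length only by accounting for empty
  strings.  The threshold \<open>r\<close> is a finite number, output in the format of \<^const>\<open>num_value\<close>.
\<close>

definition gap_cross_composes :: "real \<Rightarrow> str set \<Rightarrow> opt_problem \<Rightarrow> bool" where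
  "gap_cross_composes \<alpha> L P \<longleftrightarrow>
     (\<exists>R f. \<exists>q :: real poly.
        poly_equiv_rel R \<and>
        polytime_on {xs. xs \<noteq> [] \<and> set xs \<times> set xs \<subseteq> R} str_list_code composed_code f \<and>
        (\<forall>xs. xs \<noteq> [] \<and> set xs \<times> set xs \<subseteq> R \<longrightarrow>
           (\<exists>y k c r. f xs = ((y, k), c) \<and> num_value c = ereal r \<and>
              (case sense P of
                 Maximize \<Rightarrow>
                   (OPT P y k \<ge> ereal r \<longleftrightarrow> (\<exists>x\<in>set xs. x \<in> L)) \<and>
                   (OPT P y k < ereal (r / \<alpha>) \<longleftrightarrow> (\<forall>x\<in>set xs. x \<notin> L))
               | Minimize \<Rightarrow>
                   (OPT P y k \<le> ereal r \<longleftrightarrow> (\<exists>x\<in>set xs. x \<in> L)) \<and>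
                   (OPT P y k > ereal (r * \<alpha>) \<longleftrightarrow> (\<forall>x\<in>set xs. x \<notin> L))) \<and>
              real k \<le> poly q (log 2 (real (length xs)) + real (Max (length ` set xs))))))"

section \<open>Approximate compression\<close>

text \<open>
  The quotient \<open>v / opt\<close> of the value of a solution and the optimum, with the conventions that make it an
  approximation ratio when it is not already one: an optimal solution has ratio \<open>1\<close> (also for
  \<open>0/0\<close> and \<open>\<infinity>/\<infinity>\<close>), and for an optimum that is not positive every other solution has the worst
  ratio, \<open>\<infinity>\<close> in minimization and \<open>-\<infinity>\<close> in maximization problems (for \<open>opt = 0\<close> this is just the value
  of \<open>v / 0\<close>).  For a negative optimum the bare quotient would reverse the order, making worse
  solutions look better, and the guarantee below would be void.
\<close>

definition approx_ratio :: "ereal \<Rightarrow> ereal \<Rightarrow> ereal" where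
  "approx_ratio v opt =
     (if v = opt then 1 else if opt > 0 then v / opt else if v > opt then \<infinity> else - \<infinity>)"

definition sol_ratio :: "opt_problem \<Rightarrow> instance_pair \<Rightarrow> str \<Rightarrow> ereal" where
  "sol_ratio P = (\<lambda>(I, k) s. approx_ratio (objective P I k s) (OPT P I k))"

definition lift_code :: "instance_pair \<times> instance_pair \<times> str \<Rightarrow> str list" where
  "lift_code = (\<lambda>(x, x', s'). inst_code x @ inst_code x' @ [s'])"

text \<open>\<open>red\<close> is the reduction algorithm and \<open>lift\<close> the solution lifting algorithm.\<close>

definition approx_ppt ::
  "real \<Rightarrow> opt_problem \<Rightarrow> opt_problem \<Rightarrow> (instance_pair \<Rightarrow> instance_pair) \<Rightarrow>
   (instance_pair \<times> instance_pair \<times> str \<Rightarrow> str) \<Rightarrow> bool" where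
  "approx_ppt \<alpha> P P' red lift \<longleftrightarrow>
     polytime_on UNIV inst_code inst_code red \<and>
     polytime_on {(x, x', s'). x' = red x \<and> s' \<in> case_prod solutions x'} lift_code str_code lift \<and>
     (\<forall>x s'. s' \<in> case_prod solutions (red x) \<longrightarrow>
        lift (x, red x, s') \<in> case_prod solutions x \<and>
        (case sense P of
           Minimize \<Rightarrow> sol_ratio P x (lift (x, red x, s')) \<le> ereal \<alpha> * sol_ratio P' (red x) s'
         | Maximize \<Rightarrow> sol_ratio P x (lift (x, red x, s')) * ereal \<alpha> \<ge> sol_ratio P' (red x) s'))"

definition approx_compression :: "real \<Rightarrow> opt_problem \<Rightarrow> (nat \<Rightarrow> nat) \<Rightarrow> bool" where
  "approx_compression \<alpha> P g \<longleftrightarrow>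
     computable_on UNIV nat_code nat_code g \<and>
     (\<exists>P' red lift. param_opt_problem P' \<and> approx_ppt \<alpha> P P' red lift \<and>
        (\<forall>I k I' k'. red (I, k) = (I', k') \<longrightarrow> length I' + k' \<le> g k))"

definition poly_sized_approx_compression :: "real \<Rightarrow> opt_problem \<Rightarrow> bool" where
  "poly_sized_approx_compression \<alpha> P \<longleftrightarrow> (\<exists>q :: nat poly. approx_compression \<alpha> P (poly q))"

end

theory Submission
  imports Defs
begin

text \<open>
  A language \<open>A\<close> in NP is reduced to \<open>L\<close>. For each length \<open>n\<close> and each \<open>R\<close>-class, a tuple of \<open>t\<close> strings outside
  \<open>A\<close> is composed into one instance of \<open>\<Pi>\<close> and then compressed to an instance \<open>z\<close> of size less than \<open>t / 2\<close>.
  There are at most \<open>2 ^ t\<close> such \<open>z\<close>, so some \<open>z\<close> is the image of tuples that contain at least half of the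
  strings; iterating, \<open>O(n)\<close> instances \<open>z\<close> per class cover all strings (the argument of Fortnow and Santhanam).
  These \<open>z\<close>, each with an optimal solution, are the advice. A witness for \<open>x \<notin> A\<close> is a tuple through \<open>x\<close> that is
  compressed to an advice instance: the optimal solution of \<open>z\<close> is lifted back and, since its ratio is at most
  \<open>\<alpha>\<close>, its value is on the correct side of the gap exactly if no member of the tuple is in \<open>A\<close>.
\<close>

section \<open>Composing programs\<close>

text \<open>The verifier must be efficient although two quantities it refers to are not: the
  objective of the compressed problem need not be computable in polynomial time, and the real
  \<alpha> need not be computable at all. It therefore never evaluates \<open>objective P'\<close>;
  that a stored solution is optimal is a property of the advice, used only to conclude that its
  ratio is 1. For \<alpha> the advice holds rational bounds, chosen so that an error can only be a
  rejection: soundness has to survive witnesses of any length, whereas completeness concerns honest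
  witnesses, whose numerals have a bit length bounded in terms of n. Tuples consist of strings of
  length n outside A, and only their images under the reduction are composed. Counting is then over
  at most \<open>2 ^ n\<close> strings, whatever the lengths and collisions of the images, while the
  classes are classes of images. Composition and lifting come with guarantees on their promise sets
  only, so membership in these sets is checked before they are run; hence the closure lemmas whose
  domain shrinks along a conjunction.\<close>

fun shift :: "nat \<Rightarrow> prog \<Rightarrow> prog" where
  "shift m Skip = Skip"
| "shift m (Push r b) = Push (m + r) b"
| "shift m (Pop r) = Pop (m + r)"
| "shift m (Seq p q) = Seq (shift m p) (shift m q)"
| "shift m (Branch r p p0 p1) = Branch (m + r) (shift m p) (shift m p0) (shift m p1)"
| "shift m (While r p) = While (m + r) (shift m p)"

definition place :: "nat \<Rightarrow> (nat \<Rightarrow> str) \<Rightarrow> (nat \<Rightarrow> str) \<Rightarrow> nat \<Rightarrow> str" where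
  "place m \<rho> \<sigma> = (\<lambda>i. if i < m then \<rho> i else \<sigma> (i - m))"

lemma place_add [simp]: "place m \<rho> \<sigma> (m + r) = \<sigma> r"
  by (simp add: place_def)

lemma place_upd: "place m \<rho> (\<sigma>(r := x)) = (place m \<rho> \<sigma>)(m + r := x)"
  by (auto simp: place_def fun_eq_iff)

text \<open>Every register that the renamed program touches lies in the upper block, so the run is
  the same step by step and the lower block \<rho> survives. This allows a subroutine to consume a
  copy of its inputs while the originals stay below it.\<close>

lemma exec_shift: "exec p \<sigma> t \<tau> \<Longrightarrow> exec (shift m p) (place m \<rho> \<sigma>) t (place m \<rho> \<tau>)"
proof (induction rule: exec.induct)
  case (exec_Push r b \<sigma>)
  then show ?case using exec.exec_Push[of "m + r" b "place m \<rho> \<sigma>"] by (simp add: place_upd del: fun_upd_apply)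
next
  case (exec_Pop r \<sigma>)
  then show ?case using exec.exec_Pop[of "m + r" "place m \<rho> \<sigma>"] by (simp add: place_upd del: fun_upd_apply)
qed (auto intro: exec.intros exec.intros[simplified])

fun reg_bound :: "prog \<Rightarrow> nat" where
  "reg_bound Skip = 0"
| "reg_bound (Push r b) = Suc r"
| "reg_bound (Pop r) = Suc r"
| "reg_bound (Seq p q) = max (reg_bound p) (reg_bound q)"
| "reg_bound (Branch r p p0 p1) = Max {Suc r, reg_bound p, reg_bound p0, reg_bound p1}"
| "reg_bound (While r p) = max (Suc r) (reg_bound p)"

lemma exec_frame: "exec p \<sigma> t \<tau> \<Longrightarrow> reg_bound p \<le> i \<Longrightarrow> \<tau> i = \<sigma> i"
  by (induction rule: exec.induct) auto

text \<open>A step pushes at most one bit, so every time bound is also a size bound.\<close>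

lemma exec_length: "exec p \<sigma> t \<tau> \<Longrightarrow> length (\<tau> i) \<le> length (\<sigma> i) + t"
  by (induction rule: exec.induct) auto

section \<open>Clearing, moving and copying registers\<close>

definition clear :: "nat \<Rightarrow> prog" where
  "clear r = While r (Pop r)"

lemma exec_clear: "exec (clear r) \<sigma> (2 * length (\<sigma> r) + 1) (\<sigma>(r := []))"
proof (induction "\<sigma> r" arbitrary: \<sigma>)
  case Nil
  then have "\<sigma>(r := []) = \<sigma>" by auto
  then show ?case using exec_While_empty[of \<sigma> r "Pop r"] Nil by (simp add: clear_def)
next
  case (Cons b w)
  let ?\<sigma> = "\<sigma>(r := tl (\<sigma> r))"
  have *: "w = ?\<sigma> r" using Cons.hyps(2) by (metis fun_upd_same list.sel(3))
  have "exec (clear r) ?\<sigma> (2 * length w + 1) (?\<sigma>(r := []))"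
    using Cons.hyps(1)[of ?\<sigma>] * by simp
  then have "exec (While r (Pop r)) \<sigma> (Suc (1 + (2 * length w + 1))) (?\<sigma>(r := []))"
    unfolding clear_def using Cons.hyps(2) by (intro exec_While_step[OF _ exec_Pop]) auto
  moreover have "length (\<sigma> r) = Suc (length w)" using Cons.hyps(2) by (metis length_Cons)
  ultimately show ?case by (simp add: clear_def)
qed

fun clear_from :: "nat \<Rightarrow> nat \<Rightarrow> prog" where
  "clear_from k 0 = Skip"
| "clear_from k (Suc j) = Seq (clear (k + j)) (clear_from k j)"

lemma exec_clear_from:
  assumes "\<And>i. length (\<sigma> i) \<le> l"
  shows "\<exists>t \<le> j * (2 * l + 1) + 1. exec (clear_from k j) \<sigma> t (\<lambda>i. if k \<le> i \<and> i < k + j then [] else \<sigma> i)"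
  using assms
proof (induction j arbitrary: \<sigma>)
  case 0
  have "(\<lambda>i. if k \<le> i \<and> i < k + 0 then [] else \<sigma> i) = \<sigma>" by fastforce
  then show ?case using exec_Skip[of \<sigma>] by (metis add_0 clear_from.simps(1) le_refl mult_0)
next
  case (Suc j)
  let ?\<sigma> = "\<sigma>(k + j := [])"
  have "length (?\<sigma> i) \<le> l" for i using Suc.prems by auto
  from Suc.IH[of ?\<sigma>, OF this] obtain t where t: "t \<le> j * (2 * l + 1) + 1"
    "exec (clear_from k j) ?\<sigma> t (\<lambda>i. if k \<le> i \<and> i < k + j then [] else ?\<sigma> i)" by blast
  have "exec (clear_from k (Suc j)) \<sigma> (2 * length (\<sigma> (k + j)) + 1 + t)
      (\<lambda>i. if k \<le> i \<and> i < k + j then [] else ?\<sigma> i)"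
    unfolding clear_from.simps by (rule exec_Seq[OF exec_clear t(2)])
  moreover have "(\<lambda>i. if k \<le> i \<and> i < k + j then [] else ?\<sigma> i) =
      (\<lambda>i. if k \<le> i \<and> i < k + Suc j then [] else \<sigma> i)" by (rule ext) (auto simp: less_Suc_eq)
  moreover have "2 * length (\<sigma> (k + j)) + 1 + t \<le> Suc j * (2 * l + 1) + 1"
    using t(1) Suc.prems[of "k + j"] by simp
  ultimately show ?case by metis
qed

definition pour :: "nat \<Rightarrow> (bool \<Rightarrow> prog) \<Rightarrow> prog" where
  "pour r p = While r (Branch r Skip (Seq (Pop r) (p False)) (Seq (Pop r) (p True)))"

text \<open>\<open>upd b\<close> is the effect of processing one popped bit. It leaves the drained
  register alone and commutes with writing to it, so the effects collect into a fold over the bits.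
  The 3 extra steps per bit are the loop test, the branch and the pop.\<close>

lemma exec_pour:
  assumes p: "\<And>b \<sigma>. exec (p b) \<sigma> c (upd b \<sigma>)" and upd: "\<And>b \<sigma>. upd b \<sigma> r = \<sigma> r"
    and comm: "\<And>b \<sigma> w. upd b (\<sigma>(r := w)) = (upd b \<sigma>)(r := w)"
  shows "exec (pour r p) \<sigma> ((c + 3) * length (\<sigma> r) + 1) (fold upd (\<sigma> r) (\<sigma>(r := [])))"
proof (induction "\<sigma> r" arbitrary: \<sigma>)
  case Nil
  then have "\<sigma>(r := []) = \<sigma>" by auto
  then show ?case using exec_While_empty[of \<sigma> r] Nil by (simp add: pour_def)
next
  case (Cons b w)
  let ?\<sigma> = "upd b (\<sigma>(r := w))"
  have w: "w = ?\<sigma> r" by (simp add: upd)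
  have sr: "\<sigma> r = b # w" using Cons.hyps(2) by simp
  have IH: "exec (pour r p) ?\<sigma> ((c + 3) * length w + 1) (fold upd w (?\<sigma>(r := [])))"
    using Cons.hyps(1)[of ?\<sigma>] w by simp
  have step: "exec (Seq (Pop r) (p b)) \<sigma> (1 + c) ?\<sigma>"
    using exec_Seq[OF exec_Pop[of r \<sigma>] p[of b]] sr by simp
  have "exec (Branch r Skip (Seq (Pop r) (p False)) (Seq (Pop r) (p True))) \<sigma> (Suc (1 + c)) ?\<sigma>"
    using step sr by (cases b) (auto intro: exec_Branch_False exec_Branch_True)
  then have "exec (pour r p) \<sigma> (Suc (Suc (1 + c) + ((c + 3) * length w + 1))) (fold upd w (?\<sigma>(r := [])))"
    using IH sr unfolding pour_def by (intro exec_While_step) auto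
  moreover have "?\<sigma>(r := []) = upd b (\<sigma>(r := []))"
    using comm[of b \<sigma> w] comm[of b \<sigma> "[]"] by simp
  moreover have "Suc (Suc (1 + c) + ((c + 3) * length w + 1)) = (c + 3) * length (\<sigma> r) + 1"
    by (simp add: sr algebra_simps)
  ultimately show ?case by (simp only: sr fold_simps o_apply)
qed

lemma exec_pour1:
  assumes "r \<noteq> s"
  shows "exec (pour r (Push s)) \<sigma> (4 * length (\<sigma> r) + 1) (\<sigma>(r := [], s := rev (\<sigma> r) @ \<sigma> s))"
proof -
  have "fold (\<lambda>b \<sigma>. \<sigma>(s := b # \<sigma> s)) w \<rho> = \<rho>(s := rev w @ \<rho> s)" for w :: str and \<rho>
    by (induction w arbitrary: \<rho>) (auto simp: fun_eq_iff)
  moreover have "exec (pour r (Push s)) \<sigma> ((1 + 3) * length (\<sigma> r) + 1)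
      (fold (\<lambda>b \<sigma>. \<sigma>(s := b # \<sigma> s)) (\<sigma> r) (\<sigma>(r := [])))"
    by (rule exec_pour[OF exec_Push]) (use assms in \<open>auto simp: fun_eq_iff\<close>)
  ultimately show ?thesis using assms by simp
qed

lemma exec_pour2:
  assumes "r \<noteq> s" "r \<noteq> u" "s \<noteq> u"
  shows "exec (pour r (\<lambda>b. Seq (Push s b) (Push u b))) \<sigma> (5 * length (\<sigma> r) + 1)
    (\<sigma>(r := [], s := rev (\<sigma> r) @ \<sigma> s, u := rev (\<sigma> r) @ \<sigma> u))"
proof -
  have *: "fold (\<lambda>b \<sigma>. \<sigma>(s := b # \<sigma> s, u := b # \<sigma> u)) w \<rho> = \<rho>(s := rev w @ \<rho> s, u := rev w @ \<rho> u)" for w \<rho>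
    using assms by (induction w arbitrary: \<rho>) (auto simp: fun_eq_iff)
  have "exec (Seq (Push s b) (Push u b)) \<rho> 2 (\<rho>(s := b # \<rho> s, u := b # \<rho> u))" for b \<rho>
    using exec_Seq[OF exec_Push[of s b \<rho>] exec_Push[of u b]] assms by (simp add: numeral_2_eq_2)
  then show ?thesis
    using exec_pour[of "\<lambda>b. Seq (Push s b) (Push u b)" 2 "\<lambda>b \<sigma>. \<sigma>(s := b # \<sigma> s, u := b # \<sigma> u)" r \<sigma>] assms
    by (auto simp: * fun_upd_twist)
qed

text \<open>A single pour reverses the bits; the second one, out of the scratch register
  \<open>u\<close>, restores their order.\<close>

definition move :: "nat \<Rightarrow> nat \<Rightarrow> nat \<Rightarrow> prog" where
  "move r s u = Seq (pour r (Push u)) (pour u (Push s))"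

lemma exec_move:
  assumes "r \<noteq> s" "r \<noteq> u" "s \<noteq> u" "\<sigma> u = []"
  shows "exec (move r s u) \<sigma> (8 * length (\<sigma> r) + 2) (\<sigma>(r := [], s := \<sigma> r @ \<sigma> s))"
proof -
  let ?\<sigma> = "\<sigma>(r := [], u := rev (\<sigma> r) @ \<sigma> u)"
  have "exec (pour r (Push u)) \<sigma> (4 * length (\<sigma> r) + 1) ?\<sigma>"
    by (rule exec_pour1) (use assms in auto)
  moreover have "exec (pour u (Push s)) ?\<sigma> (4 * length (?\<sigma> u) + 1) (?\<sigma>(u := [], s := rev (?\<sigma> u) @ ?\<sigma> s))"
    by (rule exec_pour1) (use assms in auto)
  ultimately have "exec (move r s u) \<sigma> (4 * length (\<sigma> r) + 1 + (4 * length (?\<sigma> u) + 1))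
      (?\<sigma>(u := [], s := rev (?\<sigma> u) @ ?\<sigma> s))"
    unfolding move_def by (rule exec_Seq)
  moreover have "?\<sigma>(u := [], s := rev (?\<sigma> u) @ ?\<sigma> s) = \<sigma>(r := [], s := \<sigma> r @ \<sigma> s)"
    using assms by (auto simp: fun_eq_iff)
  moreover have "?\<sigma> u = rev (\<sigma> r)" using assms by simp
  ultimately show ?thesis by (simp add: ac_simps del: fun_upd_apply)
qed

text \<open>Reading a register destroys it, so the way back from the scratch register writes the
  bits to both \<open>r\<close> and \<open>s\<close>.\<close>

definition copy :: "nat \<Rightarrow> nat \<Rightarrow> nat \<Rightarrow> prog" where
  "copy r s u = Seq (pour r (Push u)) (pour u (\<lambda>b. Seq (Push r b) (Push s b)))"

lemma exec_copy:
  assumes "r \<noteq> s" "r \<noteq> u" "s \<noteq> u" "\<sigma> u = []"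
  shows "exec (copy r s u) \<sigma> (9 * length (\<sigma> r) + 2) (\<sigma>(s := \<sigma> r @ \<sigma> s))"
proof -
  let ?\<sigma> = "\<sigma>(r := [], u := rev (\<sigma> r) @ \<sigma> u)"
  have "exec (pour r (Push u)) \<sigma> (4 * length (\<sigma> r) + 1) ?\<sigma>"
    by (rule exec_pour1) (use assms in auto)
  moreover have "exec (pour u (\<lambda>b. Seq (Push r b) (Push s b))) ?\<sigma> (5 * length (?\<sigma> u) + 1)
      (?\<sigma>(u := [], r := rev (?\<sigma> u) @ ?\<sigma> r, s := rev (?\<sigma> u) @ ?\<sigma> s))"
    by (rule exec_pour2) (use assms in auto)
  ultimately have "exec (copy r s u) \<sigma> (4 * length (\<sigma> r) + 1 + (5 * length (?\<sigma> u) + 1))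
      (?\<sigma>(u := [], r := rev (?\<sigma> u) @ ?\<sigma> r, s := rev (?\<sigma> u) @ ?\<sigma> s))"
    unfolding copy_def by (rule exec_Seq)
  moreover have "?\<sigma>(u := [], r := rev (?\<sigma> u) @ ?\<sigma> r, s := rev (?\<sigma> u) @ ?\<sigma> s) = \<sigma>(s := \<sigma> r @ \<sigma> s)"
    using assms by (auto simp: fun_eq_iff)
  moreover have "?\<sigma> u = rev (\<sigma> r)" using assms by simp
  ultimately show ?thesis by (simp add: ac_simps del: fun_upd_apply)
qed

section \<open>Polynomial time with clean final stores\<close>

abbreviation total_length :: "str list \<Rightarrow> nat" where
  "total_length xs \<equiv> sum_list (map length xs)"

lemma poly_nat_mono: "x \<le> y \<Longrightarrow> poly (q :: nat poly) x \<le> poly q y"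
  by (induction q) (auto intro: add_mono mult_mono)

lemma length_nth_le_total: "i < length xs \<Longrightarrow> length (xs ! i) \<le> total_length xs"
  by (simp add: member_le_sum_list)

lemma length_init_store: "length (init_store xs i) \<le> total_length xs"
  by (auto simp: init_store_def length_nth_le_total)

text \<open>
  In contrast to \<^const>\<open>polytime_on\<close>, all registers other than the outputs are required to be empty in
  the end, so that programs compose sequentially. Below, \<open>pt\<close> and \<open>ptb\<close> are the variants of \<open>ptl\<close> for a
  single string and for a truth value.
\<close>

definition ptl :: "str list set \<Rightarrow> (str list \<Rightarrow> str list) \<Rightarrow> bool" where
  "ptl A F \<longleftrightarrow> (\<exists>n. \<forall>xs\<in>A. length xs = n) \<and> (\<exists>k. \<forall>xs\<in>A. length (F xs) = k) \<and>
     (\<exists>p q. \<forall>xs\<in>A. \<exists>t \<le> poly q (total_length xs). exec p (init_store xs) t (init_store (F xs)))"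

lemma ptlI:
  assumes "\<And>xs. xs \<in> A \<Longrightarrow> length xs = n" "\<And>xs. xs \<in> A \<Longrightarrow> length (F xs) = k"
    and "\<And>xs. xs \<in> A \<Longrightarrow> \<exists>t \<le> poly q (total_length xs). exec p (init_store xs) t (init_store (F xs))"
  shows "ptl A F"
  using assms unfolding ptl_def by blast

lemma ptl_mono: "ptl B F \<Longrightarrow> A \<subseteq> B \<Longrightarrow> ptl A F"
  unfolding ptl_def by (meson subsetD)

lemma ptl_cong: "ptl A F \<Longrightarrow> (\<And>xs. xs \<in> A \<Longrightarrow> F xs = G xs) \<Longrightarrow> ptl A G"
  unfolding ptl_def by simp

text \<open>There are \<open>k\<close> outputs, each no longer than the input plus the running
  time.\<close>

lemma ptl_size:
  assumes "ptl A F"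
  obtains q :: "nat poly" where "\<And>xs. xs \<in> A \<Longrightarrow> total_length (F xs) \<le> poly q (total_length xs)"
proof -
  from assms obtain k p q where k: "\<And>xs. xs \<in> A \<Longrightarrow> length (F xs) = k"
    and ex: "\<And>xs. xs \<in> A \<Longrightarrow> \<exists>t \<le> poly q (total_length xs). exec p (init_store xs) t (init_store (F xs))"
    unfolding ptl_def by metis
  have "total_length (F xs) \<le> poly ([:k:] * ([:0, 1:] + q)) (total_length xs)" if "xs \<in> A" for xs
  proof -
    from ex[OF that] obtain t where t: "t \<le> poly q (total_length xs)"
      "exec p (init_store xs) t (init_store (F xs))" by blast
    have "length y \<le> total_length xs + poly q (total_length xs)" if "y \<in> set (F xs)" for y
    proof -
      from that obtain i where i: "i < length (F xs)" "y = F xs ! i" by (metis in_set_conv_nth)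
      then have "length y \<le> length (init_store xs i) + t"
        using exec_length[OF t(2), of i] by (simp add: init_store_def)
      then show ?thesis using t(1) length_init_store[of xs i] by linarith
    qed
    then have "total_length (F xs) \<le> length (F xs) * (total_length xs + poly q (total_length xs))"
      by (induction "F xs" rule: rev_induct)
        (use sum_list_mono[of "F xs" length "\<lambda>_. total_length xs + poly q (total_length xs)"] in \<open>auto simp: sum_list_triv\<close>)
    then show ?thesis using k[OF that] by simp
  qed
  then show ?thesis using that by blast
qed

text \<open>The running time of the second program is measured in the intermediate result, whose
  length \<open>ptl_size\<close> bounds by a polynomial; monotonicity of polynomials over the
  naturals permits the substitution.\<close>

lemma ptl_comp:
  assumes F: "ptl A F" and G: "ptl B G" and AB: "\<And>xs. xs \<in> A \<Longrightarrow> F xs \<in> B"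
  shows "ptl A (\<lambda>xs. G (F xs))"
proof -
  obtain p q where p: "\<And>xs. xs \<in> A \<Longrightarrow> \<exists>t \<le> poly q (total_length xs). exec p (init_store xs) t (init_store (F xs))"
    using F unfolding ptl_def by metis
  obtain p' q' where p': "\<And>xs. xs \<in> B \<Longrightarrow> \<exists>t \<le> poly q' (total_length xs). exec p' (init_store xs) t (init_store (G xs))"
    using G unfolding ptl_def by metis
  obtain s where s: "\<And>xs. xs \<in> A \<Longrightarrow> total_length (F xs) \<le> poly s (total_length xs)"
    using ptl_size[OF F] by blast
  have "\<exists>t \<le> poly (q + pcompose q' s) (total_length xs). exec (Seq p p') (init_store xs) t (init_store (G (F xs)))"
    if "xs \<in> A" for xs
  proof -
    from p[OF that] p'[OF AB[OF that]] obtain t t' where t: "t \<le> poly q (total_length xs)"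
      "exec p (init_store xs) t (init_store (F xs))" "t' \<le> poly q' (total_length (F xs))"
      "exec p' (init_store (F xs)) t' (init_store (G (F xs)))" by blast
    moreover have "poly q' (total_length (F xs)) \<le> poly q' (poly s (total_length xs))"
      by (rule poly_nat_mono[OF s[OF that]])
    ultimately show ?thesis using exec_Seq[OF t(2,4)] by (intro exI[of _ "t + t'"]) (auto simp: poly_pcompose)
  qed
  then show ?thesis using F G AB unfolding ptl_def by meson
qed

text \<open>A program for \<open>polytime_on\<close> may leave garbage behind, but only in registers
  that it mentions or that held inputs. Clearing \<open>reg_bound p + n\<close> registers from
  number \<open>k\<close> on reaches all of them, at polynomial cost since their contents are
  bounded by input plus time. The function \<open>g\<close> recovers the argument from its
  code.\<close>

lemma polytime_on_ptl:
  assumes "polytime_on A ein eout f"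
    and "\<And>a. a \<in> A \<Longrightarrow> length (ein a) = n" "\<And>a. a \<in> A \<Longrightarrow> length (eout (f a)) = k"
    and "\<And>xs. xs \<in> B \<Longrightarrow> g xs \<in> A" "\<And>xs. xs \<in> B \<Longrightarrow> ein (g xs) = xs"
  shows "ptl B (\<lambda>xs. eout (f (g xs)))"
proof -
  from assms(1) obtain p q where p: "\<And>a. a \<in> A \<Longrightarrow> \<exists>t. yields p (ein a) t (eout (f a)) \<and>
        t \<le> poly q (total_length (ein a))" unfolding polytime_on_def by metis
  let ?N = "reg_bound p" let ?j = "?N + n"
  let ?Q = "q + ([:?j:] * (2 * ([:0,1:] + q) + 1) + 1)"
  have "\<exists>t \<le> poly ?Q (total_length xs).
    exec (Seq p (clear_from k ?j)) (init_store xs) t (init_store (eout (f (g xs))))" if xs: "xs \<in> B" for xs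
  proof -
    from p[OF assms(4)[OF xs]] obtain t \<tau> where t: "t \<le> poly q (total_length xs)"
      "exec p (init_store xs) t \<tau>" "\<And>i. i < k \<Longrightarrow> \<tau> i = eout (f (g xs)) ! i"
      unfolding yields_def using assms(3,4,5) xs by metis
    have len: "length (\<tau> i) \<le> total_length xs + t" for i
      using exec_length[OF t(2), of i] length_init_store[of xs i] by linarith
    from exec_clear_from[of \<tau>, OF len] obtain t' where t': "t' \<le> ?j * (2 * (total_length xs + t) + 1) + 1"
      "exec (clear_from k ?j) \<tau> t' (\<lambda>i. if k \<le> i \<and> i < k + ?j then [] else \<tau> i)" by blast
    have ln: "length xs = n" using assms(2,4,5) xs by metis
    have lk: "length (eout (f (g xs))) = k" using assms(3,4) xs by metis
    have "(\<lambda>i. if k \<le> i \<and> i < k + ?j then [] else \<tau> i) = init_store (eout (f (g xs)))"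
      using t(3) exec_frame[OF t(2)] lk ln by (auto simp: fun_eq_iff init_store_def)
    then have "exec (Seq p (clear_from k ?j)) (init_store xs) (t + t') (init_store (eout (f (g xs))))"
      using exec_Seq[OF t(2) t'(2)] by simp
    moreover have "t' \<le> ?j * (2 * (total_length xs + poly q (total_length xs)) + 1) + 1"
      using t'(1) t(1) by (meson add_le_mono le_refl mult_le_mono order_trans)
    then have "t + t' \<le> poly ?Q (total_length xs)" using t(1) by (simp add: algebra_simps)
    ultimately show ?thesis by blast
  qed
  moreover have "length xs = n" if "xs \<in> B" for xs using assms(2,4,5) that by metis
  moreover have "length (eout (f (g xs))) = k" if "xs \<in> B" for xs using assms(3,4) that by metis
  ultimately show ?thesis unfolding ptl_def by blast
qed

lemma ptl_polytime_on:
  assumes "ptl B F" "\<And>a. a \<in> A \<Longrightarrow> ein a \<in> B" "\<And>a. a \<in> A \<Longrightarrow> eout (f a) = F (ein a)"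
  shows "polytime_on A ein eout f"
proof -
  from assms(1) obtain p q where p: "\<And>xs. xs \<in> B \<Longrightarrow> \<exists>t \<le> poly q (total_length xs). exec p (init_store xs) t (init_store (F xs))"
    unfolding ptl_def by metis
  have "\<exists>t. yields p (ein a) t (eout (f a)) \<and> t \<le> poly q (total_length (ein a))" if "a \<in> A" for a
    using p[OF assms(2)[OF that]] assms(3)[OF that]
    unfolding yields_def by (metis (no_types, lifting) init_store_def)
  then show ?thesis unfolding polytime_on_def by blast
qed

lemma place_init_store: "length ys = m \<Longrightarrow> place m (init_store ys) (init_store xs) = init_store (ys @ xs)"
  by (auto simp: place_def init_store_def fun_eq_iff nth_append)

lemma ptl_shift:
  assumes "ptl A F"
  shows "ptl {ys @ xs | ys xs. length ys = m \<and> xs \<in> A} (\<lambda>zs. take m zs @ F (drop m zs))"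
proof -
  from assms obtain n k p q where n: "\<And>xs. xs \<in> A \<Longrightarrow> length xs = n" and k: "\<And>xs. xs \<in> A \<Longrightarrow> length (F xs) = k"
    and ex: "\<And>xs. xs \<in> A \<Longrightarrow> \<exists>t \<le> poly q (total_length xs). exec p (init_store xs) t (init_store (F xs))"
    unfolding ptl_def by metis
  have "\<exists>t \<le> poly q (total_length (ys @ xs)). exec (shift m p) (init_store (ys @ xs)) t (init_store (ys @ F xs))"
    if "xs \<in> A" "length ys = m" for xs ys
  proof -
    from ex[OF that(1)] obtain t where t: "t \<le> poly q (total_length xs)"
      "exec p (init_store xs) t (init_store (F xs))" by blast
    have "poly q (total_length xs) \<le> poly q (total_length (ys @ xs))" by (rule poly_nat_mono) simp
    then show ?thesis using t exec_shift[OF t(2), of m "init_store ys"]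
      by (intro exI[of _ t]) (auto simp: place_init_store that)
  qed
  then show ?thesis
    by (intro ptlI[where n = "m + n" and k = "m + k" and p = "shift m p" and q = q]) (auto simp: n k)
qed

text \<open>Registers \<open>n\<close> and \<open>Suc n\<close> are empty at the start: one receives
  the copy, the other is scratch space.\<close>

lemma ptl_dup:
  assumes "\<And>xs. xs \<in> A \<Longrightarrow> length xs = n" and "i < n"
  shows "ptl A (\<lambda>xs. xs @ [xs ! i])"
proof -
  have "\<exists>t \<le> poly [:2, 9:] (total_length xs). exec (copy i n (Suc n)) (init_store xs) t (init_store (xs @ [xs ! i]))"
    if "xs \<in> A" for xs
  proof -
    have n: "length xs = n" using assms that by auto
    have "exec (copy i n (Suc n)) (init_store xs) (9 * length (init_store xs i) + 2)
        ((init_store xs)(n := init_store xs i @ init_store xs n))"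
      by (rule exec_copy) (use assms(2) n in \<open>auto simp: init_store_def\<close>)
    moreover have "(init_store xs)(n := init_store xs i @ init_store xs n) = init_store (xs @ [xs ! i])"
      using n assms(2) by (auto simp: init_store_def nth_append fun_eq_iff)
    ultimately show ?thesis using length_init_store[of xs i]
      by (intro exI[of _ "9 * length (init_store xs i) + 2"]) auto
  qed
  then show ?thesis unfolding ptl_def using assms(1) by (metis length_append_singleton)
qed

fun move_down :: "nat \<Rightarrow> nat \<Rightarrow> prog" where
  "move_down n 0 = Skip"
| "move_down n (Suc j) = Seq (move_down n j) (move (Suc j) j (Suc n))"

text \<open>Once register 0 is cleared, the others move down by one. After \<open>j\<close> moves
  the first \<open>j\<close> have arrived, register \<open>j\<close> is the empty gap, and the rest
  is as before.\<close>

lemma ptl_tl: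
  assumes "\<And>xs. xs \<in> A \<Longrightarrow> length xs = Suc n"
  shows "ptl A tl"
proof -
  have md: "\<exists>t \<le> 8 * total_length xs + 2 * j + 1. exec (move_down n j) ((init_store xs)(0 := []))
      t (\<lambda>i. if i < j then init_store xs (Suc i) else if i = j then [] else init_store xs i)"
    if "j \<le> n" "xs \<in> A" for j xs
  proof -
    have "\<exists>t \<le> 8 * total_length (take (Suc j) xs) + 2 * j + 1. exec (move_down n j) ((init_store xs)(0 := []))
        t (\<lambda>i. if i < j then init_store xs (Suc i) else if i = j then [] else init_store xs i)"
      using that(1)
    proof (induction j)
      case 0
      then show ?case using exec_Skip by (intro exI[of _ 1]) (auto simp: fun_upd_def)
    next
      case (Suc j)
      let ?\<sigma> = "\<lambda>j i. if i < j then init_store xs (Suc i) else if i = j then [] else init_store xs i"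
      have len: "length xs = Suc n" using assms that(2) by auto
      from Suc obtain t where t: "t \<le> 8 * total_length (take (Suc j) xs) + 2 * j + 1"
        "exec (move_down n j) ((init_store xs)(0 := [])) t (?\<sigma> j)"
        using Suc_leD by blast
      have "exec (move (Suc j) j (Suc n)) (?\<sigma> j) (8 * length (?\<sigma> j (Suc j)) + 2)
          ((?\<sigma> j)(Suc j := [], j := ?\<sigma> j (Suc j) @ ?\<sigma> j j))"
        by (rule exec_move) (use Suc.prems len in \<open>auto simp: init_store_def\<close>)
      also have "(?\<sigma> j)(Suc j := [], j := ?\<sigma> j (Suc j) @ ?\<sigma> j j) = ?\<sigma> (Suc j)"
        by (auto simp: fun_eq_iff)
      finally have "exec (move_down n (Suc j)) ((init_store xs)(0 := []))
          (t + (8 * length (?\<sigma> j (Suc j)) + 2)) (?\<sigma> (Suc j))"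
        unfolding move_down.simps by (rule exec_Seq[OF t(2)])
      moreover have "take (Suc (Suc j)) xs = take (Suc j) xs @ [xs ! Suc j]"
        using Suc.prems len by (simp add: take_Suc_conv_app_nth)
      then have "t + (8 * length (?\<sigma> j (Suc j)) + 2) \<le> 8 * total_length (take (Suc (Suc j)) xs) + 2 * Suc j + 1"
        using t(1) Suc.prems len by (simp add: init_store_def)
      ultimately show ?case by blast
    qed
    moreover have "total_length (take (Suc j) xs) \<le> total_length xs"
      by (metis append_take_drop_id le_add1 map_append sum_list_append)
    ultimately show ?thesis by (meson add_le_mono1 mult_le_mono2 order_trans)
  qed
  have "\<exists>t \<le> poly [:2 * n + 2, 10:] (total_length xs). exec (Seq (clear 0) (move_down n n)) (init_store xs) t (init_store (tl xs))"
    if "xs \<in> A" for xs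
  proof -
    have len: "length xs = Suc n" using assms that by auto
    from md[OF order_refl that] obtain t where t: "t \<le> 8 * total_length xs + 2 * n + 1"
      "exec (move_down n n) ((init_store xs)(0 := [])) t
        (\<lambda>i. if i < n then init_store xs (Suc i) else if i = n then [] else init_store xs i)" by blast
    have "(\<lambda>i. if i < n then init_store xs (Suc i) else if i = n then [] else init_store xs i) = init_store (tl xs)"
      using len by (auto simp: init_store_def nth_tl fun_eq_iff)
    then have "exec (Seq (clear 0) (move_down n n)) (init_store xs) (2 * length (init_store xs 0) + 1 + t) (init_store (tl xs))"
      using exec_Seq[OF exec_clear t(2)] by simp
    then show ?thesis using t(1) length_init_store[of xs 0]
      by (intro exI[of _ "2 * length (init_store xs 0) + 1 + t"]) auto
  qed
  then show ?thesis unfolding ptl_def using assms by (metis length_tl)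
qed

lemma ptl_id: "(\<And>xs. xs \<in> A \<Longrightarrow> length xs = n) \<Longrightarrow> ptl A (\<lambda>xs. xs)"
  by (rule ptlI[where p = Skip and q = 1]) (auto intro: exI[of _ 1] exec_Skip simp del: One_nat_def)

lemma ptl_drop:
  assumes "\<And>xs. xs \<in> A \<Longrightarrow> length xs = m + n"
  shows "ptl A (drop m)"
  using assms
proof (induction m arbitrary: A)
  case 0
  then have "ptl A (\<lambda>xs. xs)" using ptl_id by simp
  moreover have "drop 0 = (\<lambda>xs. xs :: str list)" by auto
  ultimately show ?case by simp
next
  case (Suc m)
  have "ptl A (\<lambda>xs. drop m (tl xs))"
    by (rule ptl_comp[OF ptl_tl[where n = "m + n"], where B = "tl ` A"])
      (use Suc.prems in \<open>auto intro!: Suc.IH\<close>)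
  then show ?case by (simp add: drop_Suc)
qed

lemma ptl_dup_all:
  assumes "\<And>xs. xs \<in> A \<Longrightarrow> length xs = n + k"
  shows "ptl A (\<lambda>xs. xs @ take n xs)"
proof -
  have "ptl A (\<lambda>xs. xs @ take j xs)" if "j \<le> n" for j
    using that
  proof (induction j)
    case 0
    then show ?case using ptl_id[of A "n + k"] assms by simp
  next
    case (Suc j)
    let ?F = "\<lambda>xs :: str list. xs @ take j xs"
    have "ptl A (\<lambda>xs. ?F xs @ [?F xs ! j])"
      by (rule ptl_comp[of A ?F "?F ` A"], use Suc in simp, rule ptl_dup[of _ "n + k + j" j])
        (use Suc assms in auto)
    then show ?case
      by (rule ptl_cong) (use Suc.prems assms in \<open>auto simp: nth_append take_Suc_conv_app_nth\<close>)
  qed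
  then show ?thesis by blast
qed

text \<open>Programs consume their arguments. So \<open>F\<close> runs on a copy placed above the
  inputs, \<open>G\<close> on another copy placed above the result of \<open>F\<close>, and the
  inputs are dropped at the end.\<close>

lemma ptl_append:
  assumes "ptl A F" "ptl A G"
  shows "ptl A (\<lambda>xs. F xs @ G xs)"
proof -
  from assms obtain n k l where n: "\<And>xs. xs \<in> A \<Longrightarrow> length xs = n"
    and k: "\<And>xs. xs \<in> A \<Longrightarrow> length (F xs) = k" and l: "\<And>xs. xs \<in> A \<Longrightarrow> length (G xs) = l"
    unfolding ptl_def by metis
  have "ptl A (\<lambda>xs. xs @ xs)"
    by (rule ptl_cong[OF ptl_dup_all[of A n 0]]) (use n in auto)
  then have "ptl A (\<lambda>xs. take n (xs @ xs) @ F (drop n (xs @ xs)))"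
    by (rule ptl_comp[OF _ ptl_shift[OF assms(1)]]) (use n in auto)
  then have 1: "ptl A (\<lambda>xs. xs @ F xs)"
    by (rule ptl_cong) (simp add: n)
  have "ptl A (\<lambda>xs. (xs @ F xs) @ take n (xs @ F xs))"
    by (rule ptl_comp[OF 1 ptl_dup_all[where k = k], where B = "(\<lambda>xs. xs @ F xs) ` A"]) (auto simp: n k)
  then have 2: "ptl A (\<lambda>xs. (xs @ F xs) @ xs)"
    by (rule ptl_cong) (simp add: n)
  have "ptl A (\<lambda>xs. take (n + k) ((xs @ F xs) @ xs) @ G (drop (n + k) ((xs @ F xs) @ xs)))"
  proof (rule ptl_comp[OF 2 ptl_shift[OF assms(2)]])
    show "(xs @ F xs) @ xs \<in> {ys @ xs |ys xs. length ys = n + k \<and> xs \<in> A}" if "xs \<in> A" for xs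
      using that n k by (intro CollectI exI[of _ "xs @ F xs"] exI[of _ xs]) auto
  qed
  then have 3: "ptl A (\<lambda>xs. xs @ F xs @ G xs)"
    by (rule ptl_cong) (simp add: n k)
  have "ptl A (\<lambda>xs. drop n (xs @ F xs @ G xs))"
    by (rule ptl_comp[OF 3 ptl_drop[where n = "k + l"], where B = "(\<lambda>xs. xs @ F xs @ G xs) ` A"]) (auto simp: n k l)
  then show ?thesis
    by (rule ptl_cong) (simp add: n)
qed

text \<open>The string \<open>c xs\<close> is computed into the fresh register \<open>n\<close> and
  tested there. Both nonempty branches clear it before they continue; in the empty branch the store
  already is that of \<open>xs\<close>. Each of \<open>F\<close>, \<open>G\<close>, \<open>H\<close>
  has to be efficient only on its own part of \<open>A\<close>.\<close>

lemma ptl_branch: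
  assumes c: "ptl A (\<lambda>xs. [c xs])"
    and F: "ptl {xs \<in> A. c xs = []} F"
    and G: "ptl {xs \<in> A. c xs \<noteq> [] \<and> \<not> hd (c xs)} G"
    and H: "ptl {xs \<in> A. c xs \<noteq> [] \<and> hd (c xs)} H"
    and len: "\<And>xs. xs \<in> A \<Longrightarrow> length (F xs) = k" "\<And>xs. xs \<in> A \<Longrightarrow> length (G xs) = k"
      "\<And>xs. xs \<in> A \<Longrightarrow> length (H xs) = k"
  shows "ptl A (\<lambda>xs. if c xs = [] then F xs else if hd (c xs) then H xs else G xs)"
proof -
  from c obtain n where n: "\<And>xs. xs \<in> A \<Longrightarrow> length xs = n" unfolding ptl_def by metis
  obtain pF qF where pF: "\<And>xs. xs \<in> A \<Longrightarrow> c xs = [] \<Longrightarrow>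
      \<exists>t \<le> poly qF (total_length xs). exec pF (init_store xs) t (init_store (F xs))"
    using F unfolding ptl_def by (metis (mono_tags, lifting) mem_Collect_eq)
  obtain pG qG where pG: "\<And>xs. xs \<in> A \<Longrightarrow> c xs \<noteq> [] \<Longrightarrow> \<not> hd (c xs) \<Longrightarrow>
      \<exists>t \<le> poly qG (total_length xs). exec pG (init_store xs) t (init_store (G xs))"
    using G unfolding ptl_def by (metis (mono_tags, lifting) mem_Collect_eq)
  obtain pH qH where pH: "\<And>xs. xs \<in> A \<Longrightarrow> c xs \<noteq> [] \<Longrightarrow> hd (c xs) \<Longrightarrow>
      \<exists>t \<le> poly qH (total_length xs). exec pH (init_store xs) t (init_store (H xs))"
    using H unfolding ptl_def by (metis (mono_tags, lifting) mem_Collect_eq)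
  let ?res = "\<lambda>xs. if c xs = [] then F xs else if hd (c xs) then H xs else G xs"
  let ?p = "Branch n pF (Seq (clear n) pG) (Seq (clear n) pH)"
  let ?q = "qF + qG + qH + [:2, 2:]"
  have "ptl ((\<lambda>xs. xs @ [c xs]) ` A) (\<lambda>ys. ?res (butlast ys))"
  proof -
    have "\<exists>t \<le> poly ?q (total_length (xs @ [c xs])).
        exec ?p (init_store (xs @ [c xs])) t (init_store (?res xs))" if xs: "xs \<in> A" for xs
    proof -
      let ?\<sigma> = "init_store (xs @ [c xs])"
      have \<sigma>n: "?\<sigma> n = c xs" using n that by (simp add: init_store_def nth_append)
      have upd: "?\<sigma>(n := []) = init_store xs"
        using n that by (auto simp: init_store_def fun_eq_iff nth_append)
      have cl: "exec (clear n) ?\<sigma> (2 * length (c xs) + 1) (init_store xs)"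
        using exec_clear[of n ?\<sigma>] upd \<sigma>n by simp
      have mono: "poly q (total_length xs) \<le> poly q (total_length (xs @ [c xs]))" for q :: "nat poly"
        by (rule poly_nat_mono) simp
      show ?thesis
      proof (cases "c xs")
        case Nil
        from pF[OF that Nil] obtain t where t: "t \<le> poly qF (total_length xs)"
          "exec pF (init_store xs) t (init_store (F xs))" by blast
        have "init_store xs = ?\<sigma>" using upd \<sigma>n Nil by (metis fun_upd_triv)
        then have "exec ?p ?\<sigma> (Suc t) (init_store (F xs))"
          using t(2) \<sigma>n Nil by (intro exec_Branch_empty) auto
        then show ?thesis using Nil t(1) mono[of qF] by (intro exI[of _ "Suc t"]) auto
      next
        case (Cons b w)
        show ?thesis
        proof (cases b)
          case True
          then obtain t where t: "t \<le> poly qH (total_length xs)"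
            "exec pH (init_store xs) t (init_store (H xs))" using pH[OF xs] Cons by force
          have "exec ?p ?\<sigma> (Suc (2 * length (c xs) + 1 + t)) (init_store (H xs))"
            using \<sigma>n Cons True by (intro exec_Branch_True[where w = w] exec_Seq[OF cl t(2)]) auto
          then show ?thesis using Cons True t(1) mono[of qH]
            by (intro exI[of _ "Suc (2 * length (c xs) + 1 + t)"]) auto
        next
          case False
          then obtain t where t: "t \<le> poly qG (total_length xs)"
            "exec pG (init_store xs) t (init_store (G xs))" using pG[OF xs] Cons by force
          have "exec ?p ?\<sigma> (Suc (2 * length (c xs) + 1 + t)) (init_store (G xs))"
            using \<sigma>n Cons False by (intro exec_Branch_False[where w = w] exec_Seq[OF cl t(2)]) auto
          then show ?thesis using Cons False t(1) mono[of qG]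
            by (intro exI[of _ "Suc (2 * length (c xs) + 1 + t)"]) auto
        qed
      qed
    qed
    then have key: "\<exists>t \<le> poly ?q (total_length ys). exec ?p (init_store ys) t (init_store (?res (butlast ys)))"
      if "ys \<in> (\<lambda>xs. xs @ [c xs]) ` A" for ys
      using that by (elim imageE) (simp only: butlast_snoc)
    show ?thesis
    proof (rule ptlI[OF _ _ key])
      show "length ys = Suc n" "length (?res (butlast ys)) = k" if "ys \<in> (\<lambda>xs. xs @ [c xs]) ` A" for ys
        using that n len by auto
    qed
  qed
  from ptl_comp[OF ptl_append[OF ptl_id c] this, OF n] show ?thesis by (simp cong: if_cong)
qed

text \<open>The caller supplies the trajectory \<open>S\<close> and the number of rounds
  \<open>N\<close>. A size bound along the whole trajectory is demanded separately, because a body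
  that doubles a string takes little time per round and still produces exponential length.\<close>

lemma ptl_while:
  assumes B: "ptl B F" and "j < n"
    and n: "\<And>xs. xs \<in> A \<Longrightarrow> length xs = n" "\<And>xs. xs \<in> B \<Longrightarrow> length xs = n" "\<And>xs. xs \<in> B \<Longrightarrow> length (F xs) = n"
    and st: "\<And>xs. xs \<in> A \<Longrightarrow> S xs 0 = xs" "\<And>xs i. xs \<in> A \<Longrightarrow> i < N xs \<Longrightarrow> S xs (Suc i) = F (S xs i)"
      "\<And>xs i. xs \<in> A \<Longrightarrow> i < N xs \<Longrightarrow> S xs i \<in> B \<and> S xs i ! j \<noteq> []"
      "\<And>xs. xs \<in> A \<Longrightarrow> S xs (N xs) ! j = []"
    and N: "\<And>xs. xs \<in> A \<Longrightarrow> N xs \<le> poly r (total_length xs)"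
    and size: "\<And>xs i. xs \<in> A \<Longrightarrow> i < N xs \<Longrightarrow> total_length (S xs i) \<le> poly s (total_length xs)"
  shows "ptl A (\<lambda>xs. S xs (N xs))"
proof -
  from B obtain p q where p: "\<And>xs. xs \<in> B \<Longrightarrow> \<exists>t \<le> poly q (total_length xs). exec p (init_store xs) t (init_store (F xs))"
    unfolding ptl_def by metis
  have len: "length (S xs i) = n" if "xs \<in> A" "i \<le> N xs" for xs i
    using that by (cases i) (auto simp: st n)
  \<comment> \<open>The induction is on the number \<open>i\<close> of rounds still to run, since
    the loop rule unfolds from the front.\<close>
  have ex: "\<exists>t \<le> i * (poly q (poly s (total_length xs)) + 1) + 1.
      exec (While j p) (init_store (S xs (N xs - i))) t (init_store (S xs (N xs)))"
    if xs: "xs \<in> A" and "i \<le> N xs" for xs i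
    using that(2)
  proof (induction i)
    case 0
    have "init_store (S xs (N xs)) j = []" using st(4)[OF that(1)] by (simp add: init_store_def)
    then show ?case using exec_While_empty by (intro exI[of _ 1]) auto
  next
    case (Suc i)
    define m where "m = N xs - Suc i"
    have m: "m < N xs" "N xs - i = Suc m" using Suc.prems by (auto simp: m_def)
    from Suc m obtain t where t: "t \<le> i * (poly q (poly s (total_length xs)) + 1) + 1"
      "exec (While j p) (init_store (S xs (Suc m))) t (init_store (S xs (N xs)))" by auto
    obtain t' where t': "t' \<le> poly q (total_length (S xs m))"
      "exec p (init_store (S xs m)) t' (init_store (S xs (Suc m)))"
      using p[of "S xs m"] st(2)[OF xs m(1)] st(3)[OF xs m(1)] by auto
    have "poly q (total_length (S xs m)) \<le> poly q (poly s (total_length xs))"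
      by (rule poly_nat_mono[OF size[OF that(1) m(1)]])
    moreover have "init_store (S xs m) j \<noteq> []"
      using st(3)[OF that(1) m(1)] n(2) \<open>j < n\<close> by (auto simp: init_store_def)
    then have "exec (While j p) (init_store (S xs m)) (Suc (t' + t)) (init_store (S xs (N xs)))"
      using t' t by (intro exec_While_step)
    ultimately show ?case using t t' m_def by (intro exI[of _ "Suc (t' + t)"]) auto
  qed
  let ?q = "r * (pcompose q s + 1) + 1"
  have "\<exists>t \<le> poly ?q (total_length xs). exec (While j p) (init_store xs) t (init_store (S xs (N xs)))"
    if xs: "xs \<in> A" for xs
  proof -
    from ex[OF xs order_refl] obtain t where t: "t \<le> N xs * (poly q (poly s (total_length xs)) + 1) + 1"
      "exec (While j p) (init_store xs) t (init_store (S xs (N xs)))" using st(1)[OF xs] by auto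
    have "N xs * (poly q (poly s (total_length xs)) + 1) \<le> poly r (total_length xs) * (poly q (poly s (total_length xs)) + 1)"
      by (rule mult_le_mono1[OF N[OF xs]])
    then show ?thesis using t by (intro exI[of _ t]) (auto simp: poly_pcompose)
  qed
  then show ?thesis
    by (intro ptlI[where n = n and k = n and p = "While j p" and q = ?q]) (auto simp: n len)
qed

section \<open>Closure properties of polynomial time\<close>

definition arity :: "str list set \<Rightarrow> bool" where
  "arity A \<longleftrightarrow> (\<exists>n. \<forall>xs\<in>A. length xs = n)"

definition pt :: "str list set \<Rightarrow> (str list \<Rightarrow> str) \<Rightarrow> bool" where
  "pt A f \<longleftrightarrow> ptl A (\<lambda>xs. [f xs])"

definition ptb :: "str list set \<Rightarrow> (str list \<Rightarrow> bool) \<Rightarrow> bool" where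
  "ptb A P \<longleftrightarrow> pt A (\<lambda>xs. [P xs])"

text \<open>A total head function: the end of a string reads as \<open>False\<close>, so missing
  high-order bits of a number count as zeros.\<close>

fun hdb :: "str \<Rightarrow> bool" where
  "hdb [] = False"
| "hdb (b # w) = b"

lemma arity_Collect: "arity {xs. length xs = n}"
  by (auto simp: arity_def)

lemma arity_subset: "arity B \<Longrightarrow> A \<subseteq> B \<Longrightarrow> arity A"
  by (auto simp: arity_def)

lemma ptl_arity: "ptl A F \<Longrightarrow> arity A"
  by (auto simp: arity_def ptl_def)

lemma pt_arity: "pt A f \<Longrightarrow> arity A"
  by (auto simp: pt_def ptl_arity)

lemma pt_mono: "pt B f \<Longrightarrow> A \<subseteq> B \<Longrightarrow> pt A f"
  unfolding pt_def by (rule ptl_mono)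

lemma ptb_mono: "ptb B P \<Longrightarrow> A \<subseteq> B \<Longrightarrow> ptb A P"
  unfolding ptb_def by (rule pt_mono)

lemma pt_cong: "pt A f \<Longrightarrow> (\<And>xs. xs \<in> A \<Longrightarrow> f xs = g xs) \<Longrightarrow> pt A g"
  unfolding pt_def by (erule ptl_cong) simp

lemma ptb_cong: "ptb A P \<Longrightarrow> (\<And>xs. xs \<in> A \<Longrightarrow> P xs = Q xs) \<Longrightarrow> ptb A Q"
  unfolding ptb_def by (erule pt_cong) simp

lemma ptl_empty: "ptl {} F"
  by (simp add: ptl_def)

lemma ptl_Nil:
  assumes "arity A"
  shows "ptl A (\<lambda>xs. [])"
proof -
  from assms obtain n where n: "\<And>xs. xs \<in> A \<Longrightarrow> length xs = n" by (auto simp: arity_def)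
  show ?thesis by (rule ptl_cong[OF ptl_drop[where m = n and n = 0]]) (auto simp: n)
qed

lemma ptl_single: "pt A f \<Longrightarrow> ptl A (\<lambda>xs. [f xs])"
  by (simp add: pt_def)

lemma ptl_Cons: "pt A f \<Longrightarrow> ptl A F \<Longrightarrow> ptl A (\<lambda>xs. f xs # F xs)"
  unfolding pt_def by (drule (1) ptl_append) simp

lemma pt_nth:
  assumes "arity A" "\<And>xs. xs \<in> A \<Longrightarrow> i < length xs"
  shows "pt A (\<lambda>xs. xs ! i)"
proof (cases "A = {}")
  case True
  then show ?thesis by (simp add: pt_def ptl_empty)
next
  case False
  from assms(1) obtain n where n: "\<And>xs. xs \<in> A \<Longrightarrow> length xs = n" by (auto simp: arity_def)
  then have i: "i < n" using False assms(2) by fastforce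
  have "ptl A (\<lambda>xs. drop n (xs @ [xs ! i]))"
    by (rule ptl_comp[OF ptl_dup[OF n i] ptl_drop[where n = 1], where B = "(\<lambda>xs. xs @ [xs ! i]) ` A"])
      (auto simp: n)
  then show ?thesis unfolding pt_def by (rule ptl_cong) (simp add: n)
qed

lemma ptl_nth:
  assumes F: "ptl A F" and i: "\<And>xs. xs \<in> A \<Longrightarrow> i < length (F xs)"
  shows "pt A (\<lambda>xs. F xs ! i)"
proof -
  from F have "arity (F ` A)" by (auto simp: ptl_def arity_def)
  then have "pt (F ` A) (\<lambda>xs. xs ! i)" by (rule pt_nth) (use i in auto)
  from ptl_comp[OF F this[unfolded pt_def]] show ?thesis by (simp add: pt_def)
qed

lemma ptl_map_nth: "arity A \<Longrightarrow> (\<And>xs i. xs \<in> A \<Longrightarrow> i \<in> set is \<Longrightarrow> i < length xs) \<Longrightarrow> ptl A (\<lambda>xs. map ((!) xs) is)"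
  by (induction "is") (auto intro!: ptl_Nil ptl_Cons pt_nth)

text \<open>No outputs and a single empty output are the same store, so \<open>Skip\<close> passes
  from one arity to the other.\<close>

lemma pt_Nil:
  assumes "arity A"
  shows "pt A (\<lambda>xs. [])"
proof -
  have "init_store [] = init_store [[]]" by (auto simp: init_store_def fun_eq_iff)
  then have "ptl {[]} (\<lambda>xs. [[]])"
    by (intro ptlI[where n = 0 and k = 1 and p = Skip and q = 1])
      (auto intro!: exI[of _ 1] exec_Skip simp del: One_nat_def)
  from ptl_comp[OF ptl_Nil[OF assms] this] show ?thesis by (simp add: pt_def)
qed

lemma pt_push:
  assumes f: "pt A f"
  shows "pt A (\<lambda>xs. b # f xs)"
proof -
  have "exec (Push 0 b) (init_store [x]) 1 (init_store [b # x])" for x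
  proof -
    have "(init_store [x])(0 := b # init_store [x] 0) = init_store [b # x]"
      by (auto simp: init_store_def fun_eq_iff)
    then show ?thesis using exec_Push[of 0 b "init_store [x]"] by metis
  qed
  then have "ptl (range (\<lambda>x. [x])) (\<lambda>xs. [b # xs ! 0])"
    by (intro ptlI[where n = 1 and k = 1 and p = "Push 0 b" and q = 1])
      (auto intro!: exI[of _ 1] simp del: One_nat_def)
  from ptl_comp[OF ptl_single[OF f] this] show ?thesis by (simp add: pt_def)
qed

lemma pt_tl:
  assumes f: "pt A f"
  shows "pt A (\<lambda>xs. tl (f xs))"
proof -
  have "exec (Pop 0) (init_store [x]) 1 (init_store [tl x])" for x
  proof -
    have "(init_store [x])(0 := tl (init_store [x] 0)) = init_store [tl x]"
      by (auto simp: init_store_def fun_eq_iff)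
    then show ?thesis using exec_Pop[of 0 "init_store [x]"] by metis
  qed
  then have "ptl (range (\<lambda>x. [x])) (\<lambda>xs. [tl (xs ! 0)])"
    by (intro ptlI[where n = 1 and k = 1 and p = "Pop 0" and q = 1])
      (auto intro!: exI[of _ 1] simp del: One_nat_def)
  from ptl_comp[OF ptl_single[OF f] this] show ?thesis by (simp add: pt_def)
qed

lemma pt_const: "arity A \<Longrightarrow> pt A (\<lambda>xs. w)"
  by (induction w) (auto intro: pt_Nil pt_push)

lemma ptb_const: "arity A \<Longrightarrow> ptb A (\<lambda>xs. b)"
  unfolding ptb_def by (rule pt_const)

lemma ptl_if_on:
  assumes P: "ptb A P" and F: "ptl {xs \<in> A. P xs} F" and G: "ptl {xs \<in> A. \<not> P xs} G"
    and len: "\<And>xs. xs \<in> A \<Longrightarrow> length (F xs) = k" "\<And>xs. xs \<in> A \<Longrightarrow> length (G xs) = k"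
  shows "ptl A (\<lambda>xs. if P xs then F xs else G xs)"
  using ptl_branch[where A = A and c = "\<lambda>xs. [P xs]" and F = F and G = G and H = F and k = k] assms
  by (auto simp: ptb_def pt_def ptl_empty)

lemma pt_if_on:
  assumes "ptb A P" "pt {xs \<in> A. P xs} f" "pt {xs \<in> A. \<not> P xs} g"
  shows "pt A (\<lambda>xs. if P xs then f xs else g xs)"
proof -
  have "ptl A (\<lambda>xs. if P xs then [f xs] else [g xs])"
    by (rule ptl_if_on) (use assms in \<open>auto simp: pt_def\<close>)
  then show ?thesis unfolding pt_def by (rule ptl_cong) simp
qed

lemma pt_if: "ptb A P \<Longrightarrow> pt A f \<Longrightarrow> pt A g \<Longrightarrow> pt A (\<lambda>xs. if P xs then f xs else g xs)"
  by (rule pt_if_on) (auto elim: pt_mono)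

lemma ptb_if_on:
  assumes "ptb A P" "ptb {xs \<in> A. P xs} Q" "ptb {xs \<in> A. \<not> P xs} R"
  shows "ptb A (\<lambda>xs. if P xs then Q xs else R xs)"
proof -
  have "pt A (\<lambda>xs. if P xs then [Q xs] else [R xs])"
    by (rule pt_if_on) (use assms in \<open>auto simp: ptb_def\<close>)
  then show ?thesis unfolding ptb_def by (rule pt_cong) simp
qed

lemma ptb_if: "ptb A P \<Longrightarrow> ptb A Q \<Longrightarrow> ptb A R \<Longrightarrow> ptb A (\<lambda>xs. if P xs then Q xs else R xs)"
  by (rule ptb_if_on) (auto elim: ptb_mono)

lemma ptb_arity: "ptb A P \<Longrightarrow> arity A"
  by (simp add: ptb_def pt_arity)

text \<open>Short-circuit evaluation: \<open>Q\<close> has to be efficient only where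
  \<open>P\<close> holds. This is how calls to algorithms with a promise are guarded.\<close>

lemma ptb_conj_on: "ptb A P \<Longrightarrow> ptb {xs \<in> A. P xs} Q \<Longrightarrow> ptb A (\<lambda>xs. P xs \<and> Q xs)"
  by (rule ptb_cong[OF ptb_if_on[of A P Q "\<lambda>xs. False"]])
    (auto intro: ptb_const arity_subset[OF ptb_arity])

lemma ptb_conj: "ptb A P \<Longrightarrow> ptb A Q \<Longrightarrow> ptb A (\<lambda>xs. P xs \<and> Q xs)"
  by (rule ptb_conj_on) (auto elim: ptb_mono)

lemma ptb_not: "ptb A P \<Longrightarrow> ptb A (\<lambda>xs. \<not> P xs)"
  by (rule ptb_cong[OF ptb_if[of A P "\<lambda>xs. False" "\<lambda>xs. True"]]) (auto intro: ptb_const ptb_arity)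

lemma ptb_disj: "ptb A P \<Longrightarrow> ptb A Q \<Longrightarrow> ptb A (\<lambda>xs. P xs \<or> Q xs)"
  by (rule ptb_cong[OF ptb_if[of A P "\<lambda>xs. True" Q]]) (auto intro: ptb_const ptb_arity)

lemma ptb_iff: "ptb A P \<Longrightarrow> ptb A Q \<Longrightarrow> ptb A (\<lambda>xs. P xs = Q xs)"
  by (rule ptb_cong[OF ptb_if[of A P Q "\<lambda>xs. \<not> Q xs"]]) (auto intro: ptb_not)

lemma pt_Cons: "ptb A P \<Longrightarrow> pt A f \<Longrightarrow> pt A (\<lambda>xs. P xs # f xs)"
  by (rule pt_cong[OF pt_if[of A P "\<lambda>xs. True # f xs" "\<lambda>xs. False # f xs"]]) (auto intro: pt_push)

lemma ptb_branch:
  assumes "pt A f"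
  shows "ptb A (\<lambda>xs. if f xs = [] then b0 else if hd (f xs) then b1 else b2)"
proof -
  have ar: "arity {xs \<in> A. Q xs}" for Q using arity_subset[OF pt_arity[OF assms]] by auto
  have "ptl A (\<lambda>xs. if f xs = [] then [[b0]] else if hd (f xs) then [[b1]] else [[b2]])"
    by (rule ptl_branch[OF assms[unfolded pt_def], where k = 1])
      (auto intro!: ptl_single pt_const ar)
  then show ?thesis unfolding ptb_def pt_def by (rule ptl_cong) simp
qed

lemma ptb_is_Nil: "pt A f \<Longrightarrow> ptb A (\<lambda>xs. f xs = [])"
  by (rule ptb_cong[OF ptb_branch[of A f True False False]]) auto

lemma ptb_hdb:
  assumes "pt A f"
  shows "ptb A (\<lambda>xs. hdb (f xs))"
proof -
  have "hdb w \<longleftrightarrow> (if w = [] then False else if hd w then True else False)" for w by (cases w) auto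
  then show ?thesis using ptb_branch[OF assms, of False True False] by simp
qed

lemma pt_comp1:
  assumes "pt {ys. length ys = 1} (\<lambda>ys. F (ys ! 0))" "pt A f"
  shows "pt A (\<lambda>xs. F (f xs))"
  using ptl_comp[OF ptl_single[OF assms(2)] assms(1)[unfolded pt_def]] by (simp add: pt_def)

lemma pt_comp2:
  assumes "pt {ys. length ys = 2} (\<lambda>ys. F (ys ! 0) (ys ! 1))" "pt A f" "pt A g"
  shows "pt A (\<lambda>xs. F (f xs) (g xs))"
  using ptl_comp[OF ptl_Cons[OF assms(2) ptl_single[OF assms(3)]] assms(1)[unfolded pt_def]]
  by (simp add: pt_def)

lemma ptb_comp2:
  assumes "ptb {ys. length ys = 2} (\<lambda>ys. P (ys ! 0) (ys ! 1))" "pt A f" "pt A g"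
  shows "ptb A (\<lambda>xs. P (f xs) (g xs))"
  using pt_comp2[of "\<lambda>x y. [P x y]"] assms by (simp add: ptb_def)

section \<open>Bounded loops driven by a counter string\<close>

text \<open>The remaining counter \<open>r\<close> is visible to the body.\<close>

fun loop :: "(str list \<Rightarrow> str list) \<Rightarrow> str list \<Rightarrow> str list \<Rightarrow> str \<Rightarrow> str list" where
  "loop H xs s [] = s"
| "loop H xs s (b # r) = loop H xs (H (xs @ s @ [b # r])) r"

text \<open>The store holds inputs, state and counter; each round retains the inputs, replaces the
  state and pops one counter bit, so there are \<open>length (c xs)\<close> rounds. The invariant
  keeps the arguments of the body inside its domain \<open>B\<close> and the state polynomially
  bounded.\<close>

lemma ptl_loop:
  assumes S: "ptl A S" and c: "pt A c" and H: "ptl B H"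
    and Inv0: "\<And>xs. xs \<in> A \<Longrightarrow> Inv xs (S xs) (c xs)"
    and step: "\<And>xs s b r. xs \<in> A \<Longrightarrow> Inv xs s (b # r) \<Longrightarrow> xs @ s @ [b # r] \<in> B"
      "\<And>xs s b r. xs \<in> A \<Longrightarrow> Inv xs s (b # r) \<Longrightarrow> Inv xs (H (xs @ s @ [b # r])) r"
    and len: "\<And>xs s r. xs \<in> A \<Longrightarrow> Inv xs s r \<Longrightarrow> length s = k"
    and size: "\<And>xs s r. xs \<in> A \<Longrightarrow> Inv xs s r \<Longrightarrow> total_length s + length r \<le> poly q (total_length xs)"
  shows "ptl A (\<lambda>xs. loop H xs (S xs) (c xs))"
proof -
  from S obtain n where n: "\<And>xs. xs \<in> A \<Longrightarrow> length xs = n" unfolding ptl_def by metis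
  let ?B = "{xs @ s @ [b # r] | xs s b r. xs \<in> A \<and> Inv xs s (b # r)}"
  let ?F = "\<lambda>ys. map ((!) ys) [0..<n] @ H ys @ [tl (ys ! (n + k))]"
  let ?init = "\<lambda>xs. xs @ S xs @ [c xs]"
  have arB: "arity ?B" unfolding arity_def by (intro exI[of _ "n + k + 1"]) (auto simp: n len)
  have F: "ptl ?B ?F"
    by (intro ptl_append ptl_map_nth arB ptl_single pt_tl pt_nth ptl_mono[OF H])
      (auto simp: n len step nth_append)
  have F_eq: "?F (xs @ s @ [r]) = xs @ H (xs @ s @ [r]) @ [tl r]" if "xs \<in> A" "Inv xs s r'" for xs s r r'
    using n[OF that(1)] len[OF that] by (auto simp: nth_append intro!: nth_equalityI)
  define st where "st ys i = (?F ^^ i) ys" for ys i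
  have inv: "\<exists>s. st (?init xs) i = xs @ s @ [drop i (c xs)] \<and> Inv xs s (drop i (c xs)) \<and>
      loop H xs s (drop i (c xs)) = loop H xs (S xs) (c xs)" if "xs \<in> A" "i \<le> length (c xs)" for xs i
    using that(2)
  proof (induction i)
    case 0
    then show ?case using Inv0[OF that(1)] by (simp add: st_def)
  next
    case (Suc i)
    then obtain s where s: "st (?init xs) i = xs @ s @ [drop i (c xs)]" "Inv xs s (drop i (c xs))"
      "loop H xs s (drop i (c xs)) = loop H xs (S xs) (c xs)" by auto
    have dr: "drop i (c xs) = c xs ! i # drop (Suc i) (c xs)"
      using Suc.prems by (simp add: Cons_nth_drop_Suc)
    show ?case
      using s F_eq[OF that(1) s(2)] step(2)[OF that(1), of s "c xs ! i" "drop (Suc i) (c xs)"]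
      by (intro exI[of _ "H (xs @ s @ [drop i (c xs)])"]) (simp add: st_def dr)
  qed
  have init: "ptl A ?init" using n
    by (intro ptl_append ptl_id S ptl_single c) auto
  have sz: "total_length (st (?init xs) i) \<le> poly ([:0, 1:] + q) (total_length (?init xs))"
    if xs: "xs \<in> A" and i: "i \<le> length (c xs)" for xs i
  proof -
    from inv[OF that] obtain s where s: "st (?init xs) i = xs @ s @ [drop i (c xs)]" "Inv xs s (drop i (c xs))"
      by blast
    have "poly q (total_length xs) \<le> poly q (total_length (?init xs))" by (rule poly_nat_mono) simp
    moreover have "total_length s + length (drop i (c xs)) \<le> poly q (total_length xs)" by (rule size[OF xs s(2)])
    ultimately show ?thesis using s(1) by simp
  qed
  have "ptl (?init ` A) (\<lambda>ys. st ys (length (ys ! (n + k))))"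
  proof (rule ptl_while[OF F, where j = "n + k" and n = "n + k + 1" and r = "[:0, 1:]" and s = "[:0, 1:] + q"])
    show "length ys = n + k + 1" if "ys \<in> ?init ` A" for ys
      using that Inv0 len[OF _ Inv0] n by auto
    show "length ys = n + k + 1" if "ys \<in> ?B" for ys
      using that len n by auto
    show "length (?F ys) = n + k + 1" if "ys \<in> ?B" for ys
      using that len n step by fastforce
    have ck: "?init xs ! (n + k) = c xs" if "xs \<in> A" for xs
      using n[OF that] len[OF that Inv0[OF that]] by (simp add: nth_append)
    show "st ys 0 = ys" for ys by (simp add: st_def)
    show "st ys (Suc i) = ?F (st ys i)" for ys i by (simp add: st_def)
    show "st ys i \<in> ?B \<and> st ys i ! (n + k) \<noteq> []" if "ys \<in> ?init ` A" and i: "i < length (ys ! (n + k))" for ys i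
    proof -
      from that(1) obtain xs where xs: "xs \<in> A" "ys = ?init xs" by blast
      with i ck have i': "i < length (c xs)" by simp
      from inv[OF xs(1), of i] i' obtain s where s: "st ys i = xs @ s @ [drop i (c xs)]" "Inv xs s (drop i (c xs))"
        using xs(2) by auto
      have dr: "drop i (c xs) = c xs ! i # drop (Suc i) (c xs)"
        using i' by (simp add: Cons_nth_drop_Suc)
      show ?thesis using s xs(1) dr n[OF xs(1)] len[OF xs(1) s(2)] by (auto simp: nth_append)
    qed
    show "st ys (length (ys ! (n + k))) ! (n + k) = []" if "ys \<in> ?init ` A" for ys
    proof -
      from that(1) obtain xs where xs: "xs \<in> A" "ys = ?init xs" by blast
      from inv[OF xs(1) order_refl] obtain s where s: "st ys (length (c xs)) = xs @ s @ [[]]" "Inv xs s []"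
        using xs(2) by auto
      show ?thesis using s xs(1) n[OF xs(1)] len[OF xs(1) s(2)] ck[OF xs(1)] xs(2) by (auto simp: nth_append)
    qed
    show "length (ys ! (n + k)) \<le> poly [:0, 1:] (total_length ys)" if "ys \<in> ?init ` A" for ys
      using that ck by auto
    show "total_length (st ys i) \<le> poly ([:0, 1:] + q) (total_length ys)"
      if "ys \<in> ?init ` A" "i < length (ys ! (n + k))" for ys i
      using that sz ck by (auto simp del: poly_add)
  qed auto
  from ptl_comp[OF init this]
  have "ptl A (\<lambda>xs. st (?init xs) (length (?init xs ! (n + k))))" by simp
  then have 1: "ptl A (\<lambda>xs. xs @ loop H xs (S xs) (c xs) @ [[]])"
  proof (rule ptl_cong)
    fix xs assume xs: "xs \<in> A"
    have "?init xs ! (n + k) = c xs"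
      using n[OF xs] len[OF xs Inv0[OF xs]] by (simp add: nth_append)
    with inv[OF xs order_refl] show "st (?init xs) (length (?init xs ! (n + k))) = xs @ loop H xs (S xs) (c xs) @ [[]]"
      by auto
  qed
  have lenl: "length (loop H xs (S xs) (c xs)) = k" if "xs \<in> A" for xs
    using inv[OF that order_refl] len[OF that] by auto
  have "ptl A (\<lambda>xs. map ((!) (xs @ loop H xs (S xs) (c xs) @ [[]])) [n..<n + k])"
    by (rule ptl_comp[OF 1 ptl_map_nth, where B = "(\<lambda>xs. xs @ loop H xs (S xs) (c xs) @ [[]]) ` A"])
      (auto simp: arity_def n lenl)
  then show ?thesis
    by (rule ptl_cong) (auto simp: n lenl nth_append intro!: nth_equalityI)
qed


text \<open>If a round lengthens the state by at most a polynomial in the inputs, the total growth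
  is polynomial as well. The invariant is a potential that never increases: state length plus
  remaining rounds times growth per round.\<close>

lemma ptl_loop_add:
  assumes S: "ptl A S" and c: "pt A c" and H: "ptl B H"
    and k: "\<And>xs. xs \<in> A \<Longrightarrow> length (S xs) = k"
    and B: "\<And>xs s b r. xs \<in> A \<Longrightarrow> length s = k \<Longrightarrow> xs @ s @ [b # r] \<in> B"
    and Hlen: "\<And>ys. ys \<in> B \<Longrightarrow> length (H ys) = k"
    and size: "\<And>xs s b r. xs \<in> A \<Longrightarrow> length s = k \<Longrightarrow>
      total_length (H (xs @ s @ [b # r])) \<le> total_length s + poly d (total_length xs)"
  shows "ptl A (\<lambda>xs. loop H xs (S xs) (c xs))"
proof -
  obtain qS where qS: "\<And>xs. xs \<in> A \<Longrightarrow> total_length (S xs) \<le> poly qS (total_length xs)"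
    using ptl_size[OF S] by blast
  obtain qc where qc: "\<And>xs. xs \<in> A \<Longrightarrow> length (c xs) \<le> poly qc (total_length xs)"
    using ptl_size[OF ptl_single[OF c]] by auto
  define Inv where "Inv xs s r \<longleftrightarrow> length s = k \<and> length r \<le> length (c xs) \<and>
      total_length s + length r * poly d (total_length xs) \<le> total_length (S xs) + length (c xs) * poly d (total_length xs)"
    for xs s and r :: str
  show ?thesis
  proof (rule ptl_loop[OF S c H, where Inv = Inv and k = k and q = "qS + qc * d + qc"])
    show "Inv xs (H (xs @ s @ [b # r])) r" if "xs \<in> A" "Inv xs s (b # r)" for xs s b r
      using size[OF that(1), of s b r] that B Hlen by (auto simp: Inv_def)
    show "total_length s + length r \<le> poly (qS + qc * d + qc) (total_length xs)" if "xs \<in> A" "Inv xs s r" for xs s r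
    proof -
      have "length (c xs) * poly d (total_length xs) \<le> poly qc (total_length xs) * poly d (total_length xs)"
        by (rule mult_le_mono1[OF qc[OF that(1)]])
      then show ?thesis using that qS[OF that(1)] qc[OF that(1)]
        unfolding Inv_def poly_add poly_mult by linarith
    qed
  qed (auto simp: Inv_def k B)
qed

lemma pt_loop_add:
  assumes "ptl A S" "pt A c" "ptl {ys. length ys = n + k + 1} H"
    and A: "A = {xs. length xs = n}"
    and k: "\<And>xs. length (S xs) = k" "\<And>ys. length (H ys) = k"
    and size: "\<And>xs s b r. length xs = n \<Longrightarrow> length s = k \<Longrightarrow>
      total_length (H (xs @ s @ [b # r])) \<le> total_length s + poly d (total_length xs)"
    and "i < k"
  shows "pt A (\<lambda>xs. loop H xs (S xs) (c xs) ! i)"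
proof -
  have "length (loop H xs s r) = k" if "length s = k" for xs s r
    using that by (induction r arbitrary: s) (auto simp: k)
  then show ?thesis using assms by (intro ptl_nth ptl_loop_add[where d = d and k = k]) auto
qed

lemmas pt_intros = ptl_Nil ptl_single ptl_Cons pt_nth pt_Nil pt_push pt_Cons pt_tl pt_if
  ptb_const ptb_if ptb_conj ptb_disj ptb_not ptb_iff ptb_is_Nil ptb_hdb arity_Collect

section \<open>Reversal, concatenation and comparison of strings\<close>

lemma length_eq_lists: "length xs = 2 \<Longrightarrow> \<exists>a b. xs = [a, b]" "length xs = 1 \<Longrightarrow> \<exists>a. xs = [a]"
    "length xs = 3 \<Longrightarrow> \<exists>a b c. xs = [a, b, c]"
  by (auto simp: numeral_eq_Suc length_Suc_conv)

text \<open>Here the counter is the data: its bits are pushed onto the accumulator in reading order,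
  which reverses them. Reversal and concatenation are both instances.\<close>

lemma pt_rev_append:
  assumes "pt A f" "pt A g"
  shows "pt A (\<lambda>xs. rev (f xs) @ g xs)"
proof -
  define H where "H ys = [hdb (ys ! 3) # ys ! 2]" for ys :: "str list"
  have "pt {xs. length xs = 2} (\<lambda>xs. loop H xs [xs ! 1] (xs ! 0) ! 0)"
  proof (rule pt_loop_add[where n = 2 and k = 1 and d = 1])
    show "ptl {ys. length ys = 2 + 1 + 1} H" unfolding H_def by (intro pt_intros) auto
    show "total_length (H (xs @ s @ [b # r])) \<le> total_length s + poly 1 (total_length xs)"
      if "length xs = 2" "length s = 1" for xs s b r
      using length_eq_lists(1)[OF that(1)] length_eq_lists(2)[OF that(2)] by (auto simp: H_def)
  qed (auto simp: H_def intro!: pt_intros)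
  moreover have "loop H [x, y] [w] r = [rev r @ w]" for x y w r
    by (induction r arbitrary: w) (auto simp: H_def)
  ultimately have "pt {xs. length xs = 2} (\<lambda>xs. rev (xs ! 0) @ xs ! 1)"
    by (elim pt_cong) (use length_eq_lists(1) in fastforce)
  from pt_comp2[OF this assms] show ?thesis .
qed

lemma pt_rev: "pt A f \<Longrightarrow> pt A (\<lambda>xs. rev (f xs))"
  using pt_rev_append[of A f "\<lambda>xs. []"] pt_Nil[OF pt_arity] by auto

lemma pt_append: "pt A f \<Longrightarrow> pt A g \<Longrightarrow> pt A (\<lambda>xs. f xs @ g xs)"
  using pt_rev_append[of A "\<lambda>xs. rev (f xs)" g] pt_rev by auto

text \<open>Both strings are popped in parallel, with their concatenation as a clock that outlasts
  either. Emptiness is compared along with the top bits, as \<open>hdb\<close> does not tell the end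
  of a string from \<open>False\<close>.\<close>

lemma ptb_eq:
  assumes "pt A f" "pt A g"
  shows "ptb A (\<lambda>xs. f xs = g xs)"
proof -
  define H where "H ys = [tl (ys ! 2), tl (ys ! 3),
    [hdb (ys ! 4) \<and> (ys ! 2 = []) = (ys ! 3 = []) \<and> hdb (ys ! 2) = hdb (ys ! 3)]]" for ys :: "str list"
  have "pt {xs. length xs = 2} (\<lambda>xs. loop H xs [xs ! 0, xs ! 1, [True]] (xs ! 0 @ xs ! 1) ! 2)"
  proof (rule pt_loop_add[where n = 2 and k = 3 and d = 1])
    show "ptl {ys. length ys = 2 + 3 + 1} H" unfolding H_def by (intro pt_intros) auto
    show "total_length (H (xs @ s @ [b # r])) \<le> total_length s + poly 1 (total_length xs)"
      if "length xs = 2" "length s = 3" for xs s b r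
      using length_eq_lists(1)[OF that(1)] length_eq_lists(3)[OF that(2)] by (auto simp: H_def)
  qed (auto simp: H_def intro!: pt_intros pt_append)
  moreover have "loop H [x, y] [v, w, [b]] r ! 2 = [b \<and> v = w]" if "length v \<le> length r" "length w \<le> length r" for x y v w r b
    using that
  proof (induction r arbitrary: v w b)
    case (Cons c r)
    then show ?case by (cases v; cases w) (auto simp: H_def)
  qed (auto simp: H_def)
  ultimately have "pt {xs. length xs = 2} (\<lambda>xs. [xs ! 0 = xs ! 1])"
    by (elim pt_cong) (use length_eq_lists(1) in fastforce)
  then have "ptb {xs. length xs = 2} (\<lambda>xs. xs ! 0 = xs ! 1)" by (simp add: ptb_def)
  from ptb_comp2[OF this assms] show ?thesis .
qed

text \<open>One bit of the first string is dropped per bit of the second, and it remains to see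
  whether anything is left.\<close>

lemma ptb_length_le:
  assumes "pt A f" "pt A g"
  shows "ptb A (\<lambda>xs. length (f xs) \<le> length (g xs))"
proof -
  define H where "H ys = [tl (ys ! 2)]" for ys :: "str list"
  have "pt {xs. length xs = 2} (\<lambda>xs. loop H xs [xs ! 0] (xs ! 1) ! 0)"
  proof (rule pt_loop_add[where n = 2 and k = 1 and d = 1])
    show "ptl {ys. length ys = 2 + 1 + 1} H" unfolding H_def by (intro pt_intros) auto
    show "total_length (H (xs @ s @ [b # r])) \<le> total_length s + poly 1 (total_length xs)"
      if "length xs = 2" "length s = 1" for xs s b r
      using length_eq_lists(1)[OF that(1)] length_eq_lists(2)[OF that(2)] by (auto simp: H_def)
  qed (auto simp: H_def intro!: pt_intros)
  then have "ptb {xs. length xs = 2} (\<lambda>xs. loop H xs [xs ! 0] (xs ! 1) ! 0 = [])"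
    by (rule ptb_is_Nil)
  moreover have "loop H [x, y] [w] r = [drop (length r) w]" for x y w r
    by (induction r arbitrary: w) (auto simp: H_def drop_Suc)
  ultimately have "ptb {xs. length xs = 2} (\<lambda>xs. length (xs ! 0) \<le> length (xs ! 1))"
    by (elim ptb_cong) (use length_eq_lists(1) in fastforce)
  from ptb_comp2[OF this assms] show ?thesis .
qed

section \<open>Lists of strings\<close>

text \<open>Total, because witnesses are arbitrary strings: an unterminated code is read to its end,
  and a dangling \<open>True\<close> counts as a bit \<open>False\<close>, which is what
  \<open>hdb\<close> returns on the empty remainder.\<close>

fun decode1 :: "str \<Rightarrow> str \<times> str" where
  "decode1 [] = ([], [])"
| "decode1 (False # w) = ([], w)"
| "decode1 [True] = ([False], [])"
| "decode1 (True # b # w) = (b # fst (decode1 w), snd (decode1 w))"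

definition "first = (\<lambda>w. fst (decode1 w))"
definition "rest = (\<lambda>w. snd (decode1 w))"

lemma length_decode1: "length (fst (decode1 w)) + length (snd (decode1 w)) \<le> length w"
  by (induction w rule: decode1.induct) auto

lemma length_rest_less: "w \<noteq> [] \<Longrightarrow> length (rest w) < length w"
  unfolding rest_def
proof (induction w rule: decode1.induct)
  case (4 b w)
  then show ?case using length_decode1[of w] by simp
qed auto

lemma length_first_le: "length (first w) \<le> length w"
  and length_rest_le: "length (rest w) \<le> length w"
  using length_decode1[of w] by (auto simp: first_def rest_def)

function decode :: "str \<Rightarrow> str list" where
  "decode w = (if w = [] then [] else first w # decode (rest w))"
  by auto
termination by (relation "measure length") (auto simp: length_rest_less)

declare decode.simps [simp del]

lemma decode_Nil [simp]: "decode [] = []"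
  by (simp add: decode.simps)

lemma decode_eq_Cons: "w \<noteq> [] \<Longrightarrow> decode w = first w # decode (rest w)"
  by (simp add: decode.simps[of w])

definition enc1 :: "str \<Rightarrow> str" where
  "enc1 x = concat (map (\<lambda>b. [True, b]) x) @ [False]"

lemma enc_list_eq: "enc_list xs = concat (map enc1 xs)"
  by (simp add: enc_list_def enc1_def[abs_def])

lemma enc_list_Nil [simp]: "enc_list [] = []"
  and enc_list_Cons [simp]: "enc_list (x # xs) = enc1 x @ enc_list xs"
  by (simp_all add: enc_list_eq)

lemma length_enc1: "length (enc1 x) = 2 * length x + 1"
  by (induction x) (auto simp: enc1_def)

lemma decode1_enc1: "decode1 (enc1 x @ w) = (x, w)"
  by (induction x) (auto simp: enc1_def)

lemma first_enc1 [simp]: "first (enc1 x @ w) = x" "first (enc1 x) = x"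
  and rest_enc1 [simp]: "rest (enc1 x @ w) = w" "rest (enc1 x) = []"
  using decode1_enc1[of x w] decode1_enc1[of x "[]"] by (auto simp: first_def rest_def)

lemma enc1_not_Nil [simp]: "enc1 x \<noteq> []"
  by (simp add: enc1_def)

lemma decode_enc_list [simp]: "decode (enc_list xs) = xs"
  by (induction xs) (auto simp: decode_eq_Cons)

lemma length_mem_decode: "x \<in> set (decode w) \<Longrightarrow> length x \<le> length w"
proof (induction w rule: decode.induct)
  case (1 w)
  then show ?case using length_first_le[of w] length_rest_le[of w]
    by (cases "w = []") (auto simp: decode_eq_Cons)
qed

lemma pt_decode1:
  assumes "pt A f"
  shows "pt A (\<lambda>xs. first (f xs))" "pt A (\<lambda>xs. rest (f xs))"
proof -
  \<comment> \<open>The state is the unread part, the reversed word read so far and a flag for the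
    end marker. The string itself is the clock, so the rounds after the marker must do
    nothing.\<close>
  define H where "H ys = (if hdb (ys ! 3) \<or> ys ! 1 = [] then [ys ! 1, ys ! 2, ys ! 3]
    else if hdb (ys ! 1) then [tl (tl (ys ! 1)), hdb (tl (ys ! 1)) # ys ! 2, ys ! 3]
    else [tl (ys ! 1), ys ! 2, [True]])" for ys :: "str list"
  \<comment> \<open>The same function with one case distinction per output, the shape to which the
    closure rules apply.\<close>
  have H': "H = (\<lambda>ys. [if hdb (ys ! 3) \<or> ys ! 1 = [] then ys ! 1
      else if hdb (ys ! 1) then tl (tl (ys ! 1)) else tl (ys ! 1),
      if hdb (ys ! 3) \<or> ys ! 1 = [] \<or> \<not> hdb (ys ! 1) then ys ! 2 else hdb (tl (ys ! 1)) # ys ! 2,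
      if hdb (ys ! 3) \<or> ys ! 1 = [] \<or> hdb (ys ! 1) then ys ! 3 else [True]])"
    by (auto simp: H_def fun_eq_iff)
  have *: "pt {xs. length xs = 1} (\<lambda>xs. loop H xs [xs ! 0, [], []] (xs ! 0) ! i)" if "i < 3" for i
  proof (rule pt_loop_add[where n = 1 and k = 3 and d = 1])
    show "ptl {ys. length ys = 1 + 3 + 1} H" unfolding H' by (intro pt_intros) auto
    show "total_length (H (xs @ s @ [b # r])) \<le> total_length s + poly 1 (total_length xs)"
      if "length xs = 1" "length s = 3" for xs s b r
      using length_eq_lists(2)[OF that(1)] length_eq_lists(3)[OF that(2)] by (auto simp: H_def)
  qed (auto simp: H_def that intro!: pt_intros pt_append)
  have H: "H [x, [], v, f, r] = [[], v, f]" "H [x, False # w, v, [], r] = [w, v, [True]]"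
    "H [x, [True], v, [], r] = [[], False # v, []]" "H [x, True # b # w, v, [], r] = [w, b # v, []]"
    "H [x, w, v, [True], r] = [w, v, [True]]" for x w v f r b
    by (simp_all add: H_def)
  have finished: "loop H [x] [w, v, [True]] r = [w, v, [True]]" for x w v r
    by (induction r) (auto simp: H)
  have empty: "loop H [x] [[], v, f] r = [[], v, f]" for x v f r
    by (induction r) (auto simp: H)
  have run: "\<exists>f. loop H [x] [w, v, []] r = [rest w, rev (first w) @ v, f]" if "length w \<le> length r" for x w v r
    using that
  proof (induction r arbitrary: w v)
    case (Cons c r)
    show ?case
    proof (cases w rule: decode1.cases)
      case (4 b w')
      then show ?thesis using Cons.IH[of w' "b # v"] Cons.prems by (auto simp: H first_def rest_def)
    qed (auto simp: H first_def rest_def finished empty)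
  qed (auto simp: first_def rest_def)
  have "pt {xs. length xs = 1} (\<lambda>xs. rev (loop H xs [xs ! 0, [], []] (xs ! 0) ! 1))"
    by (intro pt_rev *) simp
  moreover have "rev (loop H [w] [w, [], []] w ! 1) = first w" for w
    using run[of w w w "[]"] by auto
  ultimately have "pt {xs. length xs = 1} (\<lambda>xs. first (xs ! 0))"
    by (elim pt_cong) (use length_eq_lists(2) in fastforce)
  from pt_comp1[OF this assms] show "pt A (\<lambda>xs. first (f xs))" .
  have "pt {xs. length xs = 1} (\<lambda>xs. loop H xs [xs ! 0, [], []] (xs ! 0) ! 0)"
    by (intro *) simp
  moreover have "loop H [w] [w, [], []] w ! 0 = rest w" for w
    using run[of w w w "[]"] by auto
  ultimately have "pt {xs. length xs = 1} (\<lambda>xs. rest (xs ! 0))"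
    by (elim pt_cong) (use length_eq_lists(2) in fastforce)
  from pt_comp1[OF this assms] show "pt A (\<lambda>xs. rest (f xs))" .
qed

lemma pt_enc1:
  assumes "pt A f"
  shows "pt A (\<lambda>xs. enc1 (f xs))"
proof -
  define H where "H ys = [True # hdb (ys ! 2) # ys ! 1]" for ys :: "str list"
  have "pt {xs. length xs = 1} (\<lambda>xs. loop H xs [[False]] (rev (xs ! 0)) ! 0)"
  proof (rule pt_loop_add[where n = 1 and k = 1 and d = 2])
    show "ptl {ys. length ys = 1 + 1 + 1} H" unfolding H_def by (intro pt_intros) auto
    show "total_length (H (xs @ s @ [b # r])) \<le> total_length s + poly 2 (total_length xs)"
      if "length xs = 1" "length s = 1" for xs s b r
      using length_eq_lists(2)[OF that(1)] length_eq_lists(2)[OF that(2)] by (auto simp: H_def)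
  qed (auto simp: H_def intro!: pt_intros pt_rev)
  moreover have "loop H [x] [w] r = [concat (map (\<lambda>b. [True, b]) (rev r)) @ w]" for x w r
    by (induction r arbitrary: w) (auto simp: H_def)
  ultimately have "pt {xs. length xs = 1} (\<lambda>xs. enc1 (xs ! 0))"
    by (elim pt_cong) (use length_eq_lists(2) in \<open>fastforce simp: enc1_def\<close>)
  from pt_comp1[OF this assms] show ?thesis .
qed

text \<open>A list is only available through its code: the state is the unread code and the
  accumulator, and the code is a clock with at least one bit per entry. Growth per entry is bounded
  in the entry alone, not in the accumulator, which keeps the whole fold polynomial.\<close>

lemma pt_fold_decode:
  fixes n :: nat
  assumes l: "pt A l" and a0: "pt A a0" and h: "pt B h"
    and n: "\<And>xs. xs \<in> A \<Longrightarrow> length xs = n"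
    and B: "\<And>xs acc it. xs \<in> A \<Longrightarrow> it \<in> set (decode (l xs)) \<Longrightarrow> xs @ [acc, it] \<in> B"
    and size: "\<And>xs acc it. xs \<in> A \<Longrightarrow> it \<in> set (decode (l xs)) \<Longrightarrow>
      length (h (xs @ [acc, it])) \<le> length acc + poly d (length it)"
  shows "pt A (\<lambda>xs. fold (\<lambda>it acc. h (xs @ [acc, it])) (decode (l xs)) (a0 xs))"
proof -
  define arg where "arg ys = map ((!) ys) [0..<n] @ [ys ! (n + 1), first (ys ! n)]" for ys :: "str list"
  define H where "H ys = (if ys ! n = [] then [ys ! n, ys ! (n + 1)] else [rest (ys ! n), h (arg ys)])" for ys
  let ?C = "{xs @ [w, acc] @ [r] | xs w acc r. xs \<in> A \<and> set (decode w) \<subseteq> set (decode (l xs))}"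
  have arC: "arity ?C" unfolding arity_def by (intro exI[of _ "n + 3"]) (auto simp: n)
  have arg: "arg (xs @ [w, acc, r]) = xs @ [acc, first w]" if "xs \<in> A" for xs w acc r
    using n[OF that] by (auto simp: arg_def nth_append intro!: nth_equalityI)
  have H_eq: "H (xs @ [w, acc, r]) = (if w = [] then [w, acc] else [rest w, h (xs @ [acc, first w])])"
    if "xs \<in> A" for xs w acc r
    using n[OF that] arg[OF that] by (simp add: H_def nth_append)
  have H: "ptl ?C H"
    unfolding H_def
  proof (rule ptl_if_on[where k = 2])
    let ?C' = "{ys \<in> ?C. ys ! n \<noteq> []}"
    have arC': "arity ?C'" using arity_subset[OF arC, of ?C'] by auto
    have nC': "length ys = n + 3" if "ys \<in> ?C'" for ys using that by (auto simp: n)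
    have "ptl ?C' arg" unfolding arg_def
      by (intro ptl_append ptl_map_nth arC' ptl_Cons ptl_single pt_decode1 pt_nth) (auto simp: nC')
    then have "ptl ?C' (\<lambda>ys. [h (arg ys)])"
    proof (rule ptl_comp[OF _ h[unfolded pt_def]])
      fix ys assume "ys \<in> ?C'"
      then obtain xs w acc r where xs: "ys = xs @ [w, acc, r]" "xs \<in> A" "set (decode w) \<subseteq> set (decode (l xs))" "w \<noteq> []"
        using n by (auto simp: nth_append)
      then show "arg ys \<in> B" using B[of xs "first w" acc] arg[of xs w acc r]
        by (auto simp: decode_eq_Cons)
    qed
    then have "pt ?C' (\<lambda>ys. h (arg ys))" by (simp add: pt_def)
    then show "ptl ?C' (\<lambda>ys. [rest (ys ! n), h (arg ys)])"
      by (intro ptl_Cons ptl_single pt_decode1 pt_nth arC') (auto simp: nC')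
    have arD: "arity {ys \<in> ?C. ys ! n = []}" using arity_subset[OF arC, of "{ys \<in> ?C. ys ! n = []}"] by auto
    show "ptl {ys \<in> ?C. ys ! n = []} (\<lambda>ys. [ys ! n, ys ! (n + 1)])"
      by (intro ptl_Cons ptl_single pt_nth arD) (auto simp: n)
    show "ptb ?C (\<lambda>ys. ys ! n = [])"
      by (intro ptb_is_Nil pt_nth arC) (auto simp: n)
  qed auto
  obtain ql where ql: "\<And>xs. xs \<in> A \<Longrightarrow> length (l xs) \<le> poly ql (total_length xs)"
    using ptl_size[OF ptl_single[OF l]] by auto
  obtain qa where qa: "\<And>xs. xs \<in> A \<Longrightarrow> length (a0 xs) \<le> poly qa (total_length xs)"
    using ptl_size[OF ptl_single[OF a0]] by auto
  define D where "D xs = poly d (length (l xs))" for xs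
  define Inv where "Inv xs s r \<longleftrightarrow> (\<exists>w acc. s = [w, acc] \<and> set (decode w) \<subseteq> set (decode (l xs)) \<and>
      length w \<le> length (l xs) \<and> length r \<le> length (l xs) \<and>
      length acc + length r * D xs \<le> length (a0 xs) + length (l xs) * D xs)" for xs s and r :: str
  have L: "ptl A (\<lambda>xs. loop H xs [l xs, a0 xs] (l xs))"
  proof (rule ptl_loop[OF _ l H, where Inv = Inv and k = 2 and q = "ql + qa + ql * pcompose d ql + ql"])
    show "ptl A (\<lambda>xs. [l xs, a0 xs])" by (intro ptl_Cons ptl_single l a0)
    show "Inv xs [l xs, a0 xs] (l xs)" for xs by (simp add: Inv_def)
    show "xs @ s @ [b # r] \<in> ?C" if "xs \<in> A" "Inv xs s (b # r)" for xs s b r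
      using that by (auto simp: Inv_def)
    show "length s = 2" if "Inv xs s r" for xs s r using that by (auto simp: Inv_def)
    show "Inv xs (H (xs @ s @ [b # r])) r" if "xs \<in> A" "Inv xs s (b # r)" for xs s b r
    proof -
      from that(2) obtain w acc where w: "s = [w, acc]" "set (decode w) \<subseteq> set (decode (l xs))"
        "length w \<le> length (l xs)" "length r < length (l xs)"
        "length acc + length (b # r) * D xs \<le> length (a0 xs) + length (l xs) * D xs"
        by (auto simp: Inv_def)
      show ?thesis
      proof (cases "w = []")
        case True
        then show ?thesis using w H_eq[OF that(1)] by (simp add: Inv_def)
      next
        case False
        then have it: "first w \<in> set (decode (l xs))" using w(2) by (auto simp: decode_eq_Cons)
        have "poly d (length (first w)) \<le> D xs"
          unfolding D_def by (rule poly_nat_mono[OF length_mem_decode[OF it]])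
        then have "length (h (xs @ [acc, first w])) \<le> length acc + D xs"
          using size[OF that(1) it, of acc] by linarith
        then show ?thesis using w H_eq[OF that(1)] False length_rest_le[of w]
          by (auto simp: Inv_def decode_eq_Cons)
      qed
    qed
    show "total_length s + length r \<le> poly (ql + qa + ql * pcompose d ql + ql) (total_length xs)"
      if "xs \<in> A" "Inv xs s r" for xs s r
    proof -
      have "D xs \<le> poly d (poly ql (total_length xs))"
        unfolding D_def by (rule poly_nat_mono[OF ql[OF that(1)]])
      then have "length (l xs) * D xs \<le> poly ql (total_length xs) * poly d (poly ql (total_length xs))"
        by (rule mult_le_mono[OF ql[OF that(1)]])
      moreover from that(2) obtain w acc where w: "s = [w, acc]"
        "length w \<le> length (l xs)" "length r \<le> length (l xs)"
        "length acc + length r * D xs \<le> length (a0 xs) + length (l xs) * D xs"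
        by (auto simp: Inv_def)
      ultimately show ?thesis using ql[OF that(1)] qa[OF that(1)]
        unfolding poly_add poly_mult poly_pcompose by simp
    qed
  qed
  have fin: "loop H xs [[], acc] r = [[], acc]" if "xs \<in> A" for xs acc r
    using that by (induction r) (auto simp: H_eq)
  have run: "loop H xs [w, acc] r = [[], fold (\<lambda>it acc. h (xs @ [acc, it])) (decode w) acc]"
    if "length w \<le> length r" "xs \<in> A" for xs w acc r
    using that
  proof (induction r arbitrary: w acc)
    case (Cons c r)
    show ?case
    proof (cases "w = []")
      case True
      then show ?thesis using Cons.prems(2) fin[of xs acc "c # r"] by simp
    next
      case False
      then show ?thesis using Cons.IH[of "rest w"] Cons.prems length_rest_less[OF False]
        by (simp add: H_eq decode_eq_Cons)
    qed
  qed simp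
  have "pt A (\<lambda>xs. loop H xs [l xs, a0 xs] (l xs) ! 1)"
    by (rule ptl_nth[OF L]) (simp add: run)
  then show ?thesis by (rule pt_cong) (simp add: run)
qed

lemma ptb_ball_decode:
  fixes n :: nat
  assumes l: "pt A l" and P: "ptb B P"
    and n: "\<And>xs. xs \<in> A \<Longrightarrow> length xs = n"
    and B: "\<And>xs it. xs \<in> A \<Longrightarrow> it \<in> set (decode (l xs)) \<Longrightarrow> xs @ [it] \<in> B"
  shows "ptb A (\<lambda>xs. \<forall>it\<in>set (decode (l xs)). P (xs @ [it]))"
proof -
  let ?C = "{xs @ [acc, it] | xs acc it. xs \<in> A \<and> it \<in> set (decode (l xs))}"
  let ?arg = "\<lambda>ys. map ((!) ys) ([0..<n] @ [n + 1]) :: str list"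
  have arC: "arity ?C" unfolding arity_def by (intro exI[of _ "n + 2"]) (auto simp: n)
  have arg: "?arg (xs @ [acc, it]) = xs @ [it]" if "xs \<in> A" for xs acc it
    using n[OF that] by (auto simp: nth_append intro!: nth_equalityI)
  have "ptl ?C (\<lambda>ys. [[P (?arg ys)]])"
    by (rule ptl_comp[OF ptl_map_nth P[unfolded ptb_def pt_def]]) (use arC arg B in \<open>auto simp: n\<close>)
  then have "ptb ?C (\<lambda>ys. P (?arg ys))" by (simp add: ptb_def pt_def)
  then have h: "pt ?C (\<lambda>ys. [hdb (ys ! n) \<and> P (?arg ys)])"
    by (intro pt_intros arC) (auto simp: n)
  have f: "hdb (fold (\<lambda>it acc. [hdb ((xs @ [acc, it]) ! n) \<and> P (?arg (xs @ [acc, it]))]) its [b]) \<longleftrightarrow>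
      b \<and> (\<forall>it\<in>set its. P (xs @ [it]))" if "xs \<in> A" for xs its b
  proof -
    have "(xs @ [acc, it]) ! n = acc" for acc it using n[OF that] by (simp add: nth_append)
    moreover have "hdb (fold (\<lambda>it acc. [hdb acc \<and> P (xs @ [it])]) its [b]) \<longleftrightarrow> b \<and> (\<forall>it\<in>set its. P (xs @ [it]))"
      by (induction its arbitrary: b) auto
    ultimately show ?thesis by (simp only: arg[OF that])
  qed
  have "pt A (\<lambda>xs. fold (\<lambda>it acc. [hdb ((xs @ [acc, it]) ! n) \<and> P (?arg (xs @ [acc, it]))]) (decode (l xs)) [True])"
    by (rule pt_fold_decode[OF l _ h, where d = 1 and n = n]) (auto simp: n intro!: pt_const pt_arity[OF l])
  then have "ptb A (\<lambda>xs. hdb (fold (\<lambda>it acc. [hdb ((xs @ [acc, it]) ! n) \<and> P (?arg (xs @ [acc, it]))]) (decode (l xs)) [True]))"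
    by (rule ptb_hdb)
  then show ?thesis by (rule ptb_cong) (simp only: f simp_thms)
qed

text \<open>Obtained from the bounded universal quantifier by a double negation.\<close>

lemma ptb_mem_decode:
  assumes x: "pt A x" and l: "pt A l"
  shows "ptb A (\<lambda>xs. x xs \<in> set (decode (l xs)))"
proof -
  from pt_arity[OF l] obtain n where n: "\<And>xs. xs \<in> A \<Longrightarrow> length xs = n" by (auto simp: arity_def)
  let ?C = "{xs @ [it] | xs it. xs \<in> A}"
  have arC: "arity ?C" unfolding arity_def by (intro exI[of _ "n + 1"]) (auto simp: n)
  have take: "map ((!) (xs @ [it])) [0..<n] = xs" if "xs \<in> A" for xs it
    using n[OF that] by (auto simp: nth_append intro!: nth_equalityI)
  have "ptl ?C (\<lambda>ys. [x (map ((!) ys) [0..<n])])"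
    by (rule ptl_comp[OF ptl_map_nth x[unfolded pt_def]]) (use arC take in \<open>auto simp: n\<close>)
  then have "pt ?C (\<lambda>ys. x (map ((!) ys) [0..<n]))" by (simp add: pt_def)
  then have "ptb ?C (\<lambda>ys. ys ! n \<noteq> x (map ((!) ys) [0..<n]))"
    by (intro ptb_not ptb_eq pt_nth arC) (auto simp: n)
  then have "ptb A (\<lambda>xs. \<forall>it\<in>set (decode (l xs)). (xs @ [it]) ! n \<noteq> x (map ((!) (xs @ [it])) [0..<n]))"
    by (rule ptb_ball_decode[OF l]) (auto simp: n)
  then have "ptb A (\<lambda>xs. \<not> (\<forall>it\<in>set (decode (l xs)). (xs @ [it]) ! n \<noteq> x (map ((!) (xs @ [it])) [0..<n])))"
    by (rule ptb_not)
  then show ?thesis by (rule ptb_cong) (auto simp: take n nth_append)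
qed

lemma pt_map_decode:
  assumes l: "pt A l" and f: "pt {ys. length ys = 1} (\<lambda>ys. f (ys ! 0))"
  shows "pt A (\<lambda>xs. enc_list (map f (decode (l xs))))"
proof -
  from pt_arity[OF l] obtain n where n: "\<And>xs. xs \<in> A \<Longrightarrow> length xs = n" by (auto simp: arity_def)
  let ?C = "{xs @ [acc, it] | xs acc it. xs \<in> A}"
  have arC: "arity ?C" unfolding arity_def by (intro exI[of _ "n + 2"]) (auto simp: n)
  have h: "pt ?C (\<lambda>ys. ys ! n @ enc1 (f (ys ! (n + 1))))"
    by (intro pt_append pt_enc1 pt_comp1[OF f] pt_nth arC) (auto simp: n)
  obtain q where q: "\<And>x. length (f x) \<le> poly q (length x)"
  proof -
    from ptl_size[OF ptl_single[OF f]] obtain q where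
      q: "\<And>xs. xs \<in> {ys. length ys = 1} \<Longrightarrow> total_length [f (xs ! 0)] \<le> poly q (total_length xs)" by blast
    have "length (f x) \<le> poly q (length x)" for x using q[of "[x]"] by simp
    then show ?thesis by (rule that)
  qed
  have "pt A (\<lambda>xs. fold (\<lambda>it acc. (xs @ [acc, it]) ! n @ enc1 (f ((xs @ [acc, it]) ! (n + 1)))) (decode (l xs)) [])"
    by (rule pt_fold_decode[OF l _ h, where d = "[:2:] * q + 1" and n = n])
      (use q in \<open>auto simp: n nth_append length_enc1 intro!: pt_Nil pt_arity[OF l]\<close>)
  moreover have "fold (\<lambda>it acc. (xs @ [acc, it]) ! n @ enc1 (f ((xs @ [acc, it]) ! (n + 1)))) its acc
      = acc @ enc_list (map f its)" if "xs \<in> A" for xs its acc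
    using n[OF that] by (induction its arbitrary: acc) (auto simp: nth_append)
  ultimately show ?thesis by (elim pt_cong) simp
qed

section \<open>Binary arithmetic\<close>

lemma binary_simps [simp]: "binary [] = 0" "binary (b # w) = of_bool b + 2 * binary w"
  by (simp_all add: binary_def)

lemma binary_append: "binary (v @ w) = binary v + 2 ^ length v * binary w"
  by (induction v) (auto simp: algebra_simps)

lemma binary_less: "binary w < 2 ^ length w"
  by (induction w) auto

lemma binary_hdb_tl: "binary w = of_bool (hdb w) + 2 * binary (tl w)"
  by (cases w) auto

lemma ex_binary: "m < 2 ^ k \<Longrightarrow> \<exists>w. length w = k \<and> binary w = m"
proof (induction k arbitrary: m)
  case (Suc k)
  then have "m div 2 < 2 ^ k" by auto
  from Suc.IH[OF this] obtain w where "length w = k" "binary w = m div 2" by blast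
  then show ?case by (intro exI[of _ "odd m # w"]) auto
qed auto

text \<open>The least significant bit comes first, so the flag is overwritten at every position
  where the bits differ and the last, most significant difference decides.\<close>

lemma ptb_binary_less:
  assumes "pt A f" "pt A g"
  shows "ptb A (\<lambda>xs. binary (f xs) < binary (g xs))"
proof -
  define H where "H ys = [tl (ys ! 2), tl (ys ! 3),
    [if hdb (ys ! 2) = hdb (ys ! 3) then hdb (ys ! 4) else hdb (ys ! 3)]]" for ys :: "str list"
  have "pt {xs. length xs = 2} (\<lambda>xs. loop H xs [xs ! 0, xs ! 1, []] (xs ! 0 @ xs ! 1) ! 2)"
  proof (rule pt_loop_add[where n = 2 and k = 3 and d = 1])
    show "ptl {ys. length ys = 2 + 3 + 1} H" unfolding H_def by (intro pt_intros) auto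
    show "total_length (H (xs @ s @ [b # r])) \<le> total_length s + poly 1 (total_length xs)"
      if "length xs = 2" "length s = 3" for xs s b r
      using length_eq_lists(1)[OF that(1)] length_eq_lists(3)[OF that(2)] by (auto simp: H_def)
  qed (auto simp: H_def intro!: pt_intros pt_append)
  then have "ptb {xs. length xs = 2} (\<lambda>xs. hdb (loop H xs [xs ! 0, xs ! 1, []] (xs ! 0 @ xs ! 1) ! 2))"
    by (rule ptb_hdb)
  moreover have "hdb (loop H [x, y] [v, w, f] r ! 2) \<longleftrightarrow> binary v < binary w \<or> binary v = binary w \<and> hdb f"
    if "length v \<le> length r" "length w \<le> length r" for x y v w r f
    using that
  proof (induction r arbitrary: v w f)
    case (Cons c r)
    show ?case
      using Cons.IH[of "tl v" "tl w"] Cons.prems binary_hdb_tl[of v] binary_hdb_tl[of w]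
      by (simp add: H_def) (auto simp: of_bool_def split: if_splits)
  qed (auto simp: H_def)
  ultimately have "ptb {xs. length xs = 2} (\<lambda>xs. binary (xs ! 0) < binary (xs ! 1))"
    by (elim ptb_cong) (use length_eq_lists(1) in fastforce)
  from ptb_comp2[OF this assms] show ?thesis .
qed

text \<open>A full adder: the carry is the majority of the three bits, and
  \<open>(a = b) = c\<close> is their parity.\<close>

definition add_step :: "str list \<Rightarrow> str list" where
  "add_step ys = (let a = hdb (ys ! 2); b = hdb (ys ! 3); c = hdb (ys ! 4) in
    [tl (ys ! 2), tl (ys ! 3), [a \<and> b \<or> a \<and> c \<or> b \<and> c], ((a = b) = c) # ys ! 5])"

text \<open>One round more than the bits of both summands: each summand is then below half the range
  of the output, so no carry is left over.\<close>

definition add :: "str \<Rightarrow> str \<Rightarrow> str" where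
  "add x y = rev (loop add_step [x, y] [x, y, [], []] (True # x @ y) ! 3)"

text \<open>The invariant is that the digits written so far, plus the unread parts and the carry at
  their current weight, keep the same total value.\<close>

lemma loop_add:
  assumes "loop add_step xs [v, w, c, out] r = s'" "length xs = 2"
  shows "\<exists>c' out'. s' = [drop (length r) v, drop (length r) w, c', out'] \<and> length out' = length out + length r \<and>
    binary (rev out') + 2 ^ length out' * (binary (drop (length r) v) + binary (drop (length r) w) + of_bool (hdb c')) =
    binary (rev out) + 2 ^ length out * (binary v + binary w + of_bool (hdb c))"
  using assms(1)
proof (induction r arbitrary: v w c out)
  case (Cons b r)
  obtain x y where xs: "xs = [x, y]" using length_eq_lists(1)[OF assms(2)] by blast
  let ?a = "hdb v" and ?b = "hdb w" and ?c = "hdb c"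
  define m where "m \<longleftrightarrow> ?a \<and> ?b \<or> ?a \<and> ?c \<or> ?b \<and> ?c"
  define z where "z \<longleftrightarrow> (?a = ?b) = ?c"
  have step: "add_step [x, y, v, w, c, out, b # r] = [tl v, tl w, [m], z # out]"
    by (simp add: add_step_def Let_def m_def z_def)
  from Cons.prems have "loop add_step xs [tl v, tl w, [m], z # out] r = s'" by (simp add: xs step)
  from Cons.IH[OF this] obtain c' out' where
    "s' = [drop (length r) (tl v), drop (length r) (tl w), c', out']" "length out' = length (z # out) + length r"
    "binary (rev out') + 2 ^ length out' * (binary (drop (length r) (tl v)) + binary (drop (length r) (tl w)) + of_bool (hdb c')) =
    binary (rev (z # out)) + 2 ^ length (z # out) * (binary (tl v) + binary (tl w) + of_bool m)" by auto
  moreover have "of_bool z + 2 * (binary (tl v) + binary (tl w) + of_bool m) = binary v + binary w + of_bool (hdb c)"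
    unfolding binary_hdb_tl[of v] binary_hdb_tl[of w] m_def z_def by (auto simp: of_bool_def)
  moreover have "binary (rev (z # out)) + 2 ^ length (z # out) * (binary (tl v) + binary (tl w) + of_bool m) =
      binary (rev out) + 2 ^ length out * (of_bool z + 2 * (binary (tl v) + binary (tl w) + of_bool m))"
    by (simp add: binary_append algebra_simps)
  ultimately show ?case by (intro exI[of _ c'] exI[of _ out']) (simp add: drop_Suc)
qed auto

lemma binary_add: "binary (add x y) = binary x + binary y"
  and length_add: "length (add x y) = length x + length y + 1"
proof -
  from loop_add[OF refl, of "[x, y]" x y "[]" "[]" "True # x @ y"] obtain c out where
    o: "loop add_step [x, y] [x, y, [], []] (True # x @ y) = [[], [], c, out]"
    "length out = length x + length y + 1" "binary (rev out) + 2 ^ length out * of_bool (hdb c) = binary x + binary y"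
    by auto
  show "length (add x y) = length x + length y + 1" unfolding add_def o(1) by (simp add: o(2))
  have "(2::nat) ^ length x \<le> 2 ^ (length x + length y)" "(2::nat) ^ length y \<le> 2 ^ (length x + length y)"
    by (auto intro: power_increasing)
  moreover have "(2::nat) ^ length out = 2 ^ (length x + length y) + 2 ^ (length x + length y)" by (simp add: o(2))
  ultimately have "binary x + binary y < 2 ^ length out" using binary_less[of x] binary_less[of y] by linarith
  with o(3) have "\<not> hdb c" by (cases "hdb c") auto
  with o show "binary (add x y) = binary x + binary y" unfolding add_def o(1) by simp
qed

lemma pt_add:
  assumes "pt A f" "pt A g"
  shows "pt A (\<lambda>xs. add (f xs) (g xs))"
proof -
  have "pt {xs. length xs = 2} (\<lambda>xs. loop add_step xs [xs ! 0, xs ! 1, [], []] (True # xs ! 0 @ xs ! 1) ! 3)"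
  proof (rule pt_loop_add[where n = 2 and k = 4 and d = 2])
    show "ptl {ys. length ys = 2 + 4 + 1} add_step" unfolding add_step_def Let_def by (intro pt_intros) auto
    show "total_length (add_step (xs @ s @ [b # r])) \<le> total_length s + poly 2 (total_length xs)"
      if "length xs = 2" "length s = 4" for xs s b r
      using length_eq_lists(1)[OF that(1)] that(2) by (auto simp: add_step_def Let_def numeral_eq_Suc length_Suc_conv)
  qed (auto simp: add_step_def Let_def intro!: pt_intros pt_append)
  then have "pt {xs. length xs = 2} (\<lambda>xs. add (xs ! 0) (xs ! 1))"
    unfolding add_def by (intro pt_rev) (rule pt_cong, assumption, use length_eq_lists(1) in fastforce)
  from pt_comp2[OF this assms] show ?thesis .
qed

text \<open>Horner's scheme: prepending \<open>False\<close> doubles the accumulator, then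
  \<open>y\<close> is added if the current bit of \<open>x\<close> is set. The bits of
  \<open>x\<close> are taken from the most significant one, hence the reversal in
  \<open>mul\<close>.\<close>

definition mul_step :: "str list \<Rightarrow> str list" where
  "mul_step ys = [add (False # ys ! 2) (if hdb (ys ! 3) then ys ! 1 else [])]"

definition mul :: "str \<Rightarrow> str \<Rightarrow> str" where
  "mul x y = loop mul_step [x, y] [[]] (rev x) ! 0"

lemma loop_mul: "\<exists>w'. loop mul_step [x, y] [w] r = [w'] \<and>
    binary w' = 2 ^ length r * binary w + binary (rev r) * binary y"
proof (induction r arbitrary: w)
  case (Cons b r)
  have "mul_step [x, y, w, b # r] = [add (False # w) (if b then y else [])]"
    by (simp add: mul_step_def)
  moreover from Cons.IH obtain w' where "loop mul_step [x, y] [add (False # w) (if b then y else [])] r = [w']"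
    "binary w' = 2 ^ length r * binary (add (False # w) (if b then y else [])) + binary (rev r) * binary y" by blast
  ultimately show ?case by (auto simp: binary_add binary_append algebra_simps)
qed auto

lemma binary_mul: "binary (mul x y) = binary x * binary y"
  using loop_mul[of x y "[]" "rev x"] by (auto simp: mul_def)

lemma pt_mul:
  assumes "pt A f" "pt A g"
  shows "pt A (\<lambda>xs. mul (f xs) (g xs))"
proof -
  have "pt {xs. length xs = 2} (\<lambda>xs. loop mul_step xs [[]] (rev (xs ! 0)) ! 0)"
  \<comment> \<open>Doubling adds one bit and \<open>add\<close> adds the length of \<open>y\<close>
    plus one more.\<close>
  proof (rule pt_loop_add[where n = 2 and k = 1 and d = "[:2, 1:]"])
    show "ptl {ys. length ys = 2 + 1 + 1} mul_step" unfolding mul_step_def by (intro pt_intros pt_add) auto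
    show "total_length (mul_step (xs @ s @ [b # r])) \<le> total_length s + poly [:2, 1:] (total_length xs)"
      if "length xs = 2" "length s = 1" for xs s b r
      using length_eq_lists(1)[OF that(1)] length_eq_lists(2)[OF that(2)] by (auto simp: mul_step_def length_add)
  qed (auto simp: mul_step_def intro!: pt_intros pt_rev)
  then have "pt {xs. length xs = 2} (\<lambda>xs. mul (xs ! 0) (xs ! 1))"
    unfolding mul_def by (elim pt_cong) (use length_eq_lists(1) in fastforce)
  from pt_comp2[OF this assms] show ?thesis .
qed

section \<open>Comparing numbers up to a real factor\<close>

text \<open>
  The factor \<open>\<alpha>\<close> need not be computable.  On numbers of bounded bit length \<open>\<alpha> < P / Q\<close> is equivalent to
  \<open>g / h \<le> P / Q\<close> for the least such fraction \<open>g / h\<close> above \<open>\<alpha>\<close>, and dually for \<open>e / f\<close> below \<open>\<alpha>\<close>;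
  for larger numbers the two tests remain sufficient conditions.
\<close>

definition num_less :: "str \<Rightarrow> str \<Rightarrow> str \<Rightarrow> str \<Rightarrow> numeral_code \<Rightarrow> numeral_code \<Rightarrow> bool" where
  "num_less g h e f = (\<lambda>(sp, a, b) (sq, c, d).
     let P = binary c * binary b; Q = binary a * binary d in
     if sp = [] then sq = [] \<and> 0 < P \<and> binary g * Q \<le> P * binary h
     else if sq = [] then 0 < binary a \<or> 0 < binary c
     else 0 < Q \<and> P * binary f \<le> binary e * Q)"

definition thresholds :: "real \<Rightarrow> str \<Rightarrow> str \<Rightarrow> str \<Rightarrow> str \<Rightarrow> bool" where
  "thresholds \<alpha> g h e f \<longleftrightarrow> \<alpha> * real (binary h) < real (binary g) \<and> real (binary e) < \<alpha> * real (binary f)"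

text \<open>No fraction with entries below \<open>2 ^ K\<close> lies strictly between \<alpha> and
  either threshold, so in this range nothing is lost by comparing with the thresholds instead of
  \<alpha>. The cross-multiplied form also covers \<open>Q = 0\<close>.\<close>

definition sharp_thresholds :: "real \<Rightarrow> nat \<Rightarrow> str \<Rightarrow> str \<Rightarrow> str \<Rightarrow> str \<Rightarrow> bool" where
  "sharp_thresholds \<alpha> K g h e f \<longleftrightarrow> thresholds \<alpha> g h e f \<and> (\<forall>P Q. P < 2 ^ K \<longrightarrow> Q < 2 ^ K \<longrightarrow>
     (\<alpha> * real Q < real P \<longrightarrow> binary g * Q \<le> P * binary h) \<and>
     (real P < \<alpha> * real Q \<longrightarrow> P * binary f \<le> binary e * Q))"

text \<open>There are finitely many such fractions; take the least one above \<alpha> and the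
  greatest one below. Both kinds exist: \<open>2 ^ K - 1\<close> exceeds \<alpha> by the choice of
  \<open>K\<close>, and 0 is below \<alpha>.\<close>

lemma ex_sharp_thresholds:
  assumes "\<alpha> \<ge> 1" and K: "\<alpha> + 1 < 2 ^ K"
  shows "\<exists>g h e f. length g = K \<and> length h = K \<and> length e = K \<and> length f = K \<and> sharp_thresholds \<alpha> K g h e f"
proof -
  define T where "T = {..<2 ^ K :: nat} \<times> {0<..<2 ^ K :: nat}"
  define r where "r = (\<lambda>(P, Q). real P / real Q)"
  define U where "U = {x \<in> T. \<alpha> < r x}"
  define W where "W = {x \<in> T. r x < \<alpha>}"
  have K1: "1 < (2::nat) ^ K"
  proof -
    have "(1::real) < 2 ^ K" using assms by linarith
    then show ?thesis by (metis of_nat_1 of_nat_less_iff of_nat_numeral of_nat_power)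
  qed
  have fin: "finite T" by (simp add: T_def)
  have "(2 ^ K - 1, 1) \<in> U" using K K1 by (simp add: U_def T_def r_def of_nat_diff)
  then have "finite (r ` U)" "r ` U \<noteq> {}" using fin by (auto simp: U_def)
  then obtain g h where gh: "(g, h) \<in> U" "\<And>x. x \<in> U \<Longrightarrow> r (g, h) \<le> r x"
    using Min_in[of "r ` U"] Min_le[of "r ` U"] by (metis (no_types, lifting) imageE image_eqI surj_pair)
  have "(0, 1) \<in> W" using K1 assms by (simp add: W_def T_def r_def)
  then have "finite (r ` W)" "r ` W \<noteq> {}" using fin by (auto simp: W_def)
  then obtain e f where ef: "(e, f) \<in> W" "\<And>x. x \<in> W \<Longrightarrow> r x \<le> r (e, f)"
    using Max_in[of "r ` W"] Max_ge[of "r ` W"] by (metis (no_types, lifting) imageE image_eqI surj_pair)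
  have pos: "0 < h" "0 < f" "\<alpha> < real g / real h" "real e / real f < \<alpha>" using gh(1) ef(1) by (auto simp: U_def W_def T_def r_def)
  from gh(1) ef(1) have "g < 2 ^ K" "h < 2 ^ K" "e < 2 ^ K" "f < 2 ^ K" by (auto simp: U_def W_def T_def)
  then obtain g' h' e' f' where b: "length g' = K" "binary g' = g" "length h' = K" "binary h' = h"
    "length e' = K" "binary e' = e" "length f' = K" "binary f' = f" using ex_binary by metis
  have 1: "g * Q \<le> P * h" if "P < 2 ^ K" "Q < 2 ^ K" "\<alpha> * real Q < real P" for P Q
  proof (cases "Q = 0")
    case False
    then have "(P, Q) \<in> U" using that by (simp add: U_def T_def r_def field_simps)
    from gh(2)[OF this] have "real g * real Q \<le> real P * real h" using pos False by (simp add: r_def field_simps)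
    then show ?thesis by (metis of_nat_le_iff of_nat_mult)
  qed simp
  have 2: "P * f \<le> e * Q" if "P < 2 ^ K" "Q < 2 ^ K" "real P < \<alpha> * real Q" for P Q
  proof -
    have "Q \<noteq> 0" using that(3) by (metis mult_zero_right of_nat_0 of_nat_less_0_iff)
    then have "(P, Q) \<in> W" using that by (simp add: W_def T_def r_def field_simps)
    from ef(2)[OF this] have "real P * real f \<le> real e * real Q" using pos \<open>Q \<noteq> 0\<close> by (simp add: r_def field_simps)
    then show ?thesis by (metis of_nat_le_iff of_nat_mult)
  qed
  have "sharp_thresholds \<alpha> K g' h' e' f'" unfolding sharp_thresholds_def thresholds_def b
    using 1 2 pos by (auto simp: field_simps)
  then show ?thesis using b by blast
qed

lemma num_value_simps:
  "num_value (sg, a, b) = (if binary b = 0 then if sg = [] then \<infinity> else - \<infinity>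
    else if sg = [] then ereal (real (binary a) / real (binary b)) else ereal (- (real (binary a) / real (binary b))))"
  by (simp add: num_value_def)

text \<open>Let \<open>P / Q\<close> be the quotient of the absolute values of \<open>q\<close> and
  \<open>p\<close>. For two nonnegative numbers the claim is \<alpha> < \<open>P / Q\<close>, which
  the upper threshold certifies; two negative signs reverse it to \<open>P / Q\<close> < \<alpha>,
  which the lower threshold certifies. For mixed signs \<alpha> does not matter.\<close>

lemma num_less_sound:
  assumes "thresholds \<alpha> g h e f" "\<alpha> \<ge> 1" "num_less g h e f p q"
  shows "num_value p * ereal \<alpha> < num_value q"
proof -
  obtain sp a b sq c d where pq: "p = (sp, a, b)" "q = (sq, c, d)" by (metis surj_pair)
  let ?a = "binary a" and ?b = "binary b" and ?c = "binary c" and ?d = "binary d"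
  let ?P = "?c * ?b" and ?Q = "?a * ?d"
  from assms(1) have th: "\<alpha> * real (binary h) < real (binary g)" "real (binary e) < \<alpha> * real (binary f)" by (auto simp: thresholds_def)
  consider "sp = []" "sq = []" "0 < ?P" "binary g * ?Q \<le> ?P * binary h"
    | "sp \<noteq> []" "sq = []" "0 < ?a \<or> 0 < ?c"
    | "sp \<noteq> []" "sq \<noteq> []" "0 < ?Q" "?P * binary f \<le> binary e * ?Q"
    using assms(3) by (auto simp: num_less_def pq Let_def split: if_splits)
  then show ?thesis
  proof cases
    case 1
    have "\<alpha> * real ?Q < real ?P"
    proof (cases "?Q = 0")
      case False
      have "real (binary g) * real ?Q \<le> real ?P * real (binary h)" using 1(4) by (metis of_nat_le_iff of_nat_mult)
      moreover have "\<alpha> * real (binary h) * real ?Q < real (binary g) * real ?Q" using th(1) False by simp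
      ultimately have "(\<alpha> * real ?Q) * real (binary h) < real ?P * real (binary h)" by (simp add: algebra_simps)
      then show ?thesis by (simp add: mult_less_cancel_right)
    next
      case True
      then show ?thesis using 1(3) by (metis mult_zero_right of_nat_0 of_nat_0_less_iff)
    qed
    then show ?thesis using 1 assms(2) by (auto simp: pq num_value_simps field_simps)
  next
    case 2
    have nn: "0 \<le> real ?a / real ?b * \<alpha>" "0 \<le> real ?c / real ?d" using assms(2) by auto
    have pp: "0 < ?a \<Longrightarrow> 0 < ?b \<Longrightarrow> 0 < real ?a / real ?b * \<alpha>" "0 < ?c \<Longrightarrow> 0 < ?d \<Longrightarrow> 0 < real ?c / real ?d"
      using assms(2) by auto
    have "?b \<noteq> 0 \<Longrightarrow> ?d \<noteq> 0 \<Longrightarrow> - (real ?a / real ?b * \<alpha>) < real ?c / real ?d"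
      using 2(3) nn pp by (metis add.inverse_neutral bot_nat_0.not_eq_extremum le_less_trans less_le_trans neg_le_0_iff_le neg_less_0_iff_less)
    then show ?thesis using 2 assms(2) by (auto simp: pq num_value_simps)
  next
    case 3
    have "real ?P < \<alpha> * real ?Q"
    proof -
      have "real ?P * real (binary f) \<le> real (binary e) * real ?Q" using 3(4) by (metis of_nat_le_iff of_nat_mult)
      also have "\<dots> < \<alpha> * real (binary f) * real ?Q"
        using 3(3) by (intro mult_strict_right_mono[OF th(2)]) (simp only: of_nat_0_less_iff)
      finally have "real ?P * real (binary f) < (\<alpha> * real ?Q) * real (binary f)" by (simp add: algebra_simps)
      then show ?thesis by (simp add: mult_less_cancel_right)
    qed
    then show ?thesis using 3 assms(2) by (auto simp: pq num_value_simps field_simps)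
  qed
qed

text \<open>A numeral with denominator 0 is infinite whatever its numerator, but with numerator 0
  its cross products vanish and say nothing. Excluding 0/0 makes them decide comparisons with
  infinite values too.\<close>

definition proper :: "numeral_code \<Rightarrow> bool" where
  "proper = (\<lambda>(sg, a, b). binary b = 0 \<longrightarrow> 0 < binary a)"

text \<open>The test compares products of two numerals. These have at most \<open>2 * M\<close>
  bits, hence stay in the range where the thresholds are sharp.\<close>

lemma num_less_complete:
  assumes "sharp_thresholds \<alpha> K g h e f" "\<alpha> \<ge> 1" and pr: "proper p" "proper q"
    and less: "num_value p * ereal \<alpha> < num_value q"
    and len: "\<And>w. w \<in> set (num_code p) \<union> set (num_code q) \<Longrightarrow> length w \<le> M" "2 * M \<le> K"
  shows "num_less g h e f p q"
proof -
  obtain sp a b sq c d where pq: "p = (sp, a, b)" "q = (sq, c, d)" by (metis surj_pair)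
  let ?a = "binary a" and ?b = "binary b" and ?c = "binary c" and ?d = "binary d"
  let ?P = "?c * ?b" and ?Q = "?a * ?d"
  have lt: "binary v * binary w < 2 ^ K" if "length v \<le> M" "length w \<le> M" for v w
  proof -
    have "binary v * binary w < 2 ^ length v * 2 ^ length w"
      using binary_less[of v] binary_less[of w] by (intro mult_strict_mono) auto
    also have "\<dots> \<le> 2 ^ K" unfolding power_add[symmetric] using that len(2) by (intro power_increasing) auto
    finally show ?thesis .
  qed
  have PQ: "?P < 2 ^ K" "?Q < 2 ^ K" using len(1) by (auto intro!: lt simp: pq num_code_def)
  have sharp: "\<alpha> * real ?Q < real ?P \<Longrightarrow> binary g * ?Q \<le> ?P * binary h"
    "real ?P < \<alpha> * real ?Q \<Longrightarrow> ?P * binary f \<le> binary e * ?Q"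
    using assms(1) PQ unfolding sharp_thresholds_def by blast+
  have nn: "0 \<le> real ?a / real ?b * \<alpha>" "0 \<le> real ?c / real ?d" using assms(2) by auto
  have pr': "?b = 0 \<Longrightarrow> 0 < ?a" "?d = 0 \<Longrightarrow> 0 < ?c" using pr by (auto simp: proper_def pq)
  show ?thesis
  proof (cases "sp = []")
    case sp: True
    have b: "?b \<noteq> 0"
    proof
      assume "?b = 0"
      then have "num_value p * ereal \<alpha> = \<infinity>" using assms(2) sp by (simp add: pq num_value_simps)
      with less show False by simp
    qed
    have sq: "sq = []"
    proof (rule ccontr)
      assume "sq \<noteq> []"
      then have "real ?a / real ?b * \<alpha> < - (real ?c / real ?d)" using less b sp by (auto simp: pq num_value_simps split: if_splits)
      with nn show False by linarith
    qed
    have "\<alpha> * real ?Q < real ?P"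
    proof (cases "?d = 0")
      case True
      then show ?thesis using pr' b by simp
    next
      case False
      then show ?thesis using less b sp sq by (simp add: pq num_value_simps field_simps)
    qed
    moreover from this have "0 < ?P" using assms(2) nn
      by (metis le_less_trans mult_nonneg_nonneg of_nat_0_le_iff of_nat_0_less_iff order_trans zero_le_one)
    ultimately show ?thesis using sp sq sharp(1) by (simp add: num_less_def pq Let_def)
  next
    case sp: False
    show ?thesis
    proof (cases "sq = []")
      case True
      have "0 < ?a \<or> 0 < ?c"
      proof (rule ccontr)
        assume "\<not> (0 < ?a \<or> 0 < ?c)"
        then show False using less pr' sp True by (auto simp: pq num_value_simps split: if_splits)
      qed
      then show ?thesis using sp True by (simp add: num_less_def pq Let_def)
    next
      case sq: False
      have d: "?d \<noteq> 0"
      proof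
        assume "?d = 0"
        then have "num_value q = - \<infinity>" using sq by (simp add: pq num_value_simps)
        with less show False by simp
      qed
      have "real ?P < \<alpha> * real ?Q"
      proof (cases "?b = 0")
        case True
        then show ?thesis using pr' d assms(2) by simp
      next
        case False
        then show ?thesis using less d sp sq by (simp add: pq num_value_simps field_simps)
      qed
      moreover from this have "0 < ?Q"
        by (metis mult_zero_right neq0_conv of_nat_0 of_nat_less_0_iff)
      ultimately show ?thesis using sp sq sharp(2) by (simp add: num_less_def pq Let_def)
    qed
  qed
qed

lemma ptb_num_less:
  assumes "pt A g" "pt A h" "pt A e" "pt A f"
    and "ptl A (\<lambda>xs. num_code (p xs))" "ptl A (\<lambda>xs. num_code (q xs))"
  shows "ptb A (\<lambda>xs. num_less (g xs) (h xs) (e xs) (f xs) (p xs) (q xs))"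
proof -
  have pt_num: "pt A (\<lambda>xs. fst (r xs))" "pt A (\<lambda>xs. fst (snd (r xs)))" "pt A (\<lambda>xs. snd (snd (r xs)))"
    if r: "ptl A (\<lambda>xs. num_code (r xs))" for r :: "str list \<Rightarrow> numeral_code"
    using ptl_nth[OF r, of 0] ptl_nth[OF r, of 1] ptl_nth[OF r, of 2]
    by (simp_all add: num_code_def case_prod_unfold)
  note p = pt_num[OF assms(5)] and q = pt_num[OF assms(6)]
  \<comment> \<open>\<open>num_less\<close> in terms of string operations only:
    \<open>binary []\<close> is 0, and a weak inequality is a negated strict one.\<close>
  define mk where "mk xs = (let a = fst (snd (p xs)); b = snd (snd (p xs)); c = fst (snd (q xs)); d = snd (snd (q xs)) in
    if fst (p xs) = [] then fst (q xs) = [] \<and> binary [] < binary (mul c b) \<and>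
      \<not> binary (mul (mul c b) (h xs)) < binary (mul (g xs) (mul a d))
    else if fst (q xs) = [] then binary [] < binary a \<or> binary [] < binary c
    else binary [] < binary (mul a d) \<and> \<not> binary (mul (e xs) (mul a d)) < binary (mul (mul c b) (f xs)))" for xs
  have "ptb A mk" unfolding mk_def Let_def
    by (intro ptb_if ptb_conj ptb_disj ptb_not ptb_is_Nil ptb_binary_less pt_mul pt_Nil assms p q pt_arity[OF assms(1)])
  then show ?thesis
    by (rule ptb_cong) (simp add: mk_def Let_def num_less_def case_prod_unfold binary_mul not_less)
qed

definition make_proper :: "numeral_code \<Rightarrow> numeral_code" where
  "make_proper = (\<lambda>(sg, a, b). (sg, if binary b = 0 then [True] else a, b))"

lemma proper_make_proper: "proper (make_proper c)"
  and num_value_make_proper: "num_value (make_proper c) = num_value c"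
  by (auto simp: make_proper_def proper_def num_value_simps split: prod.splits)

lemma ptl_make_proper:
  assumes r: "ptl A (\<lambda>xs. num_code (r xs))"
  shows "ptl A (\<lambda>xs. num_code (make_proper (r xs)))"
proof -
  have pt: "pt A (\<lambda>xs. fst (r xs))" "pt A (\<lambda>xs. fst (snd (r xs)))" "pt A (\<lambda>xs. snd (snd (r xs)))"
    using ptl_nth[OF r, of 0] ptl_nth[OF r, of 1] ptl_nth[OF r, of 2]
    by (simp_all add: num_code_def case_prod_unfold)
  have "ptl A (\<lambda>xs. [fst (r xs), if binary [] < binary (snd (snd (r xs))) then fst (snd (r xs)) else [True],
      snd (snd (r xs))])"
    by (intro ptl_single ptl_Cons pt_if ptb_binary_less pt pt_const ptl_arity[OF r])
  then show ?thesis
    by (rule ptl_cong) (auto simp: num_code_def make_proper_def case_prod_unfold)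
qed

section \<open>Approximation ratios\<close>

text \<open>A suboptimal \<open>v\<close> with a finite guarantee forces \<open>opt > 0\<close>,
  since the ratio would be \<open>-\<infinity>\<close> otherwise; then
  \<open>v * \<alpha> \<ge> opt \<ge> r\<close>. For \<open>v = opt\<close> the bound
  \<open>opt \<ge> r / \<alpha>\<close> is used instead, because \<open>opt \<ge> r\<close> does not
  yield it when \<open>r\<close> is negative.\<close>

lemma gap_maximize:
  fixes v opt :: ereal and \<alpha> r :: real
  assumes "\<alpha> \<ge> 1" "v \<le> opt" "approx_ratio v opt * ereal \<alpha> \<ge> 1" "opt \<ge> ereal r" "\<not> opt < ereal (r / \<alpha>)"
  shows "\<not> v * ereal \<alpha> < ereal r"
proof (cases "v = opt")
  case True
  then show ?thesis using assms(1,5) by (cases opt) (auto simp: field_simps)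
next
  case False
  then have pos: "opt > 0" and le: "v / opt * ereal \<alpha> \<ge> 1"
    using assms by (auto simp: approx_ratio_def split: if_splits)
  show ?thesis
  proof (cases opt)
    case (real o')
    then show ?thesis using pos le assms(4) assms(1) by (cases v) (auto simp: field_simps)
  next
    case PInf
    then show ?thesis using le False by (cases v) auto
  qed (use pos in auto)
qed

text \<open>As \<open>opt \<le> r\<close> and the ratio of a suboptimal \<open>v\<close> is finite,
  \<open>opt\<close> is a positive real, and
  \<open>v \<le> \<alpha> * opt \<le> \<alpha> * r\<close>.\<close>

lemma gap_minimize:
  fixes v opt :: ereal and \<alpha> r :: real
  assumes "\<alpha> \<ge> 1" "opt \<le> v" "approx_ratio v opt \<le> ereal \<alpha> * 1" "opt \<le> ereal r" "\<not> opt > ereal (r * \<alpha>)"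
  shows "\<not> ereal r * ereal \<alpha> < v"
proof (cases "v = opt")
  case True
  then show ?thesis using assms(5) by simp
next
  case False
  then have pos: "opt > 0" and le: "v / opt \<le> ereal \<alpha>"
    using assms by (auto simp: approx_ratio_def split: if_splits)
  obtain o' where o: "opt = ereal o'" "0 < o'" "o' \<le> r" using pos assms(4) by (cases opt) auto
  have "\<alpha> * o' \<le> \<alpha> * r" using o assms(1) by simp
  then show ?thesis using le o by (cases v) (auto simp: field_simps)
qed

lemma finite_solutions: "finite (solutions I k)"
  using finite_lists_length_le[of "UNIV :: bool set" "length I + k"] by (simp add: solutions_def)

lemma solutions_not_empty: "solutions I k \<noteq> {}"
  unfolding solutions_def by (auto intro: exI[of _ "[]"])

lemma ex_optimal: "\<exists>s \<in> solutions I k. objective P I k s = OPT P I k"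
  using Min_in[of "objective P I k ` solutions I k"] Max_in[of "objective P I k ` solutions I k"]
  by (cases "sense P") (auto simp: OPT_def finite_solutions solutions_not_empty image_iff)

section \<open>Covering by few tuples\<close>

text \<open>Tuples mapped to \<open>z\<close> have all their entries in the set \<open>Wz z\<close>
  covered by \<open>z\<close>. If all these sets had less than half the size of \<open>W\<close>,
  then summing \<open>card (Wz z) ^ t\<close> over at most \<open>2 ^ t\<close> values
  \<open>z\<close> would give fewer than \<open>card W ^ t\<close> tuples.\<close>

lemma covering_step:
  assumes W: "finite W" "W \<noteq> {}" and Z: "finite Z" "card Z \<le> 2 ^ t" and t: "t \<ge> 1"
    and \<Phi>: "\<And>xs. length xs = t \<Longrightarrow> set xs \<subseteq> W \<Longrightarrow> \<Phi> xs \<in> Z"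
  shows "\<exists>z\<in>Z. card W \<le> 2 * card (\<Union>{set xs | xs. length xs = t \<and> set xs \<subseteq> W \<and> \<Phi> xs = z})"
proof (rule ccontr)
  define Wz where "Wz z = \<Union>{set xs | xs. length xs = t \<and> set xs \<subseteq> W \<and> \<Phi> xs = z}" for z
  assume "\<not> ?thesis"
  \<comment> \<open>Integrality gains the 1 here, and it is what keeps the final estimate
    strict.\<close>
  then have small: "2 * card (Wz z) \<le> card W - 1" if "z \<in> Z" for z
    using that by (force simp: Wz_def not_le)
  have fin: "finite (Wz z)" for z by (rule finite_subset[OF _ W(1)]) (auto simp: Wz_def)
  let ?T = "\<lambda>V. {xs. set xs \<subseteq> V \<and> length xs = t}"
  have "?T W \<subseteq> (\<Union>z\<in>Z. ?T (Wz z))"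
  proof
    fix xs assume "xs \<in> ?T W"
    then have "\<Phi> xs \<in> Z" "xs \<in> ?T (Wz (\<Phi> xs))" using \<Phi> by (auto simp: Wz_def)
    then show "xs \<in> (\<Union>z\<in>Z. ?T (Wz z))" by blast
  qed
  then have "card (?T W) \<le> card (\<Union>z\<in>Z. ?T (Wz z))"
    by (intro card_mono) (auto simp: Z fin finite_lists_length_eq)
  also have "\<dots> \<le> (\<Sum>z\<in>Z. card (?T (Wz z)))" by (rule card_UN_le[OF Z(1)])
  finally have "card W ^ t \<le> (\<Sum>z\<in>Z. card (Wz z) ^ t)"
    by (simp add: card_lists_length_eq W(1) fin)
  then have "2 ^ t * card W ^ t \<le> (\<Sum>z\<in>Z. (2 * card (Wz z)) ^ t)"
    by (simp add: power_mult_distrib flip: sum_distrib_left)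
  also have "\<dots> \<le> (\<Sum>z\<in>Z. (card W - 1) ^ t)" using small by (intro sum_mono power_mono) auto
  also have "\<dots> \<le> 2 ^ t * (card W - 1) ^ t" using Z(2) by simp
  finally have "card W ^ t \<le> (card W - 1) ^ t" by simp
  moreover have "card W > 0" using W by (simp add: card_gt_0_iff)
  then have "(card W - 1) ^ t < card W ^ t" using t by (intro power_strict_mono) auto
  ultimately show False by simp
qed

text \<open>Each chosen \<open>z\<close> removes at least half of the remaining strings, and later
  tuples are drawn from the remainder only. Fewer than \<open>2 ^ j\<close> strings are exhausted
  after \<open>j\<close> rounds.\<close>

lemma covering:
  assumes Z: "finite Z" "card Z \<le> 2 ^ t" and t: "t \<ge> 1"
    and W: "finite W" "card W < 2 ^ j"
    and \<Phi>: "\<And>xs. length xs = t \<Longrightarrow> set xs \<subseteq> W \<Longrightarrow> \<Phi> xs \<in> Z"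
  shows "\<exists>D \<subseteq> Z. card D \<le> j \<and>
    (\<forall>x\<in>W. \<exists>xs. length xs = t \<and> set xs \<subseteq> W \<and> x \<in> set xs \<and> \<Phi> xs \<in> D)"
  using W \<Phi>
proof (induction j arbitrary: W)
  case 0
  then show ?case by (intro exI[of _ "{}"]) auto
next
  case (Suc j)
  show ?case
  proof (cases "W = {}")
    case True
    then show ?thesis by (intro exI[of _ "{}"]) auto
  next
    case False
    define Wz where "Wz z = \<Union>{set xs | xs. length xs = t \<and> set xs \<subseteq> W \<and> \<Phi> xs = z}" for z
    from covering_step[OF Suc.prems(1) False Z t, of \<Phi>, OF Suc.prems(3)]
    obtain z where z: "z \<in> Z" "card W \<le> 2 * card (Wz z)" unfolding Wz_def by blast
    have sub: "Wz z \<subseteq> W" by (auto simp: Wz_def)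
    have "card (W - Wz z) = card W - card (Wz z)"
      using sub Suc.prems(1) by (simp add: card_Diff_subset finite_subset)
    then have "card (W - Wz z) < 2 ^ j" using z(2) Suc.prems(2) by simp
    have "\<exists>D \<subseteq> Z. card D \<le> j \<and>
        (\<forall>x\<in>W - Wz z. \<exists>xs. length xs = t \<and> set xs \<subseteq> W - Wz z \<and> x \<in> set xs \<and> \<Phi> xs \<in> D)"
      by (rule Suc.IH) (use Suc.prems \<open>card (W - Wz z) < 2 ^ j\<close> in auto)
    then obtain D where D: "D \<subseteq> Z" "card D \<le> j"
      "\<And>x. x \<in> W - Wz z \<Longrightarrow> \<exists>xs. length xs = t \<and> set xs \<subseteq> W - Wz z \<and> x \<in> set xs \<and> \<Phi> xs \<in> D"
      by blast
    have "\<exists>xs. length xs = t \<and> set xs \<subseteq> W \<and> x \<in> set xs \<and> \<Phi> xs \<in> insert z D" if "x \<in> W" for x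
    proof (cases "x \<in> Wz z")
      case True
      then show ?thesis by (auto simp: Wz_def)
    next
      case False
      then show ?thesis using D(3)[of x] that by blast
    qed
    moreover have "card (insert z D) \<le> Suc j" using D(2) by (metis Suc_le_mono card_insert_le_m1 diff_Suc_1 le_trans zero_less_Suc)
    ultimately show ?thesis using D(1) z(1) by (intro exI[of _ "insert z D"]) auto
  qed
qed

text \<open>At most \<open>2 ^ (m + 1)\<close> strings and \<open>m + 1 \<le> 2 ^ m\<close>
  parameters. This is the source of the requirement that the tuple length be at least twice the
  compressed size plus 1.\<close>

lemma card_instances:
  "finite {(I :: str, k :: nat). length I + k \<le> m}" "card {(I :: str, k :: nat). length I + k \<le> m} \<le> 2 ^ (2 * m + 1)"
proof -
  let ?L = "{I :: str. length I \<le> m}"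
  have fin: "finite ?L" using finite_lists_length_le[of "UNIV :: bool set" m] by simp
  have sub: "{(I :: str, k). length I + k \<le> m} \<subseteq> ?L \<times> {..m}" by auto
  then show "finite {(I :: str, k :: nat). length I + k \<le> m}" by (rule finite_subset) (simp add: fin)
  have "card ?L = (\<Sum>i\<le>m. 2 ^ i)" using card_lists_length_le[of "UNIV :: bool set" m] by simp
  also have "\<dots> < 2 ^ (m + 1)" by (induction m) auto
  finally have L: "card ?L \<le> 2 ^ (m + 1)" by simp
  have "card {(I :: str, k). length I + k \<le> m} \<le> card (?L \<times> {..m})"
    by (rule card_mono) (use sub fin in auto)
  also have "\<dots> \<le> 2 ^ (m + 1) * (m + 1)" using mult_le_mono1[OF L, of "m + 1"] by (simp add: card_cartesian_product)
  also have "\<dots> \<le> 2 ^ (m + 1) * 2 ^ m" using less_exp[of m] by (intro mult_le_mono) (auto simp: Suc_le_eq)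
  also have "\<dots> = 2 ^ (2 * m + 1)" by (simp only: flip: power_add) simp
  finally show "card {(I :: str, k :: nat). length I + k \<le> m} \<le> 2 ^ (2 * m + 1)" .
qed

section \<open>The length of the tuples\<close>

lemma real_poly_bound: "\<exists>(c::nat) d. \<forall>x\<ge>0. poly (q :: real poly) x \<le> real c * (x + 1) ^ d"
proof (induction q)
  case (pCons a q)
  then obtain c d where cd: "\<And>x. x \<ge> 0 \<Longrightarrow> poly q x \<le> real c * (x + 1) ^ d" by blast
  have "poly (pCons a q) x \<le> real (nat \<lceil>\<bar>a\<bar>\<rceil> + c) * (x + 1) ^ (Suc d)" if "x \<ge> 0" for x
  proof -
    have 1: "1 \<le> (x + 1) ^ Suc d" using that by (intro one_le_power) auto
    have "a \<le> real (nat \<lceil>\<bar>a\<bar>\<rceil>)" by linarith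
    also have "\<dots> \<le> real (nat \<lceil>\<bar>a\<bar>\<rceil>) * (x + 1) ^ Suc d" using mult_left_mono[OF 1] by fastforce
    finally have 2: "a \<le> real (nat \<lceil>\<bar>a\<bar>\<rceil>) * (x + 1) ^ Suc d" .
    have "x * poly q x \<le> x * (real c * (x + 1) ^ d)" using cd that by (intro mult_left_mono) auto
    also have "\<dots> \<le> (x + 1) * (real c * (x + 1) ^ d)" using that by (intro mult_right_mono) auto
    finally show ?thesis using 2 by (simp add: algebra_simps)
  qed
  then show ?case by blast
qed (auto intro!: exI[of _ 0])

lemma nat_poly_bound: "\<exists>c d. \<forall>x. poly (q :: nat poly) x \<le> c * (x + 1) ^ d"
proof (induction q)
  case (pCons a q)
  then obtain c d where cd: "\<And>x. poly q x \<le> c * (x + 1) ^ d" by blast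
  have "poly (pCons a q) x \<le> (a + c) * (x + 1) ^ (Suc d)" for x
  proof -
    have 1: "1 \<le> (x + 1) ^ Suc d" by (intro one_le_power) auto
    have "a \<le> a * (x + 1) ^ Suc d" using mult_le_mono2[OF 1, of a] by simp
    moreover have "x * poly q x \<le> (x + 1) * (c * (x + 1) ^ d)" using cd by (intro mult_le_mono) auto
    ultimately show ?thesis by (simp add: algebra_simps)
  qed
  then show ?case by blast
qed (auto intro!: exI[of _ 0])

text \<open>
  Tuples of length \<open>S ^ e\<close> with \<open>S\<close> linear in the length bound: the logarithm of the tuple length is only
  \<open>O(S)\<close>, so the exponent \<open>e\<close> needed to beat the compressed size does not depend on \<open>e\<close> itself.
\<close>

lemma ex_tuple_length:
  fixes q :: "real poly" and g p :: "nat poly"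
  shows "\<exists>T :: nat poly. \<forall>n m k. 1 \<le> poly T n \<and>
    (m \<le> poly p n \<and> real k \<le> poly q (log 2 (real (poly T n)) + real m) \<longrightarrow> 2 * poly g k + 1 \<le> poly T n)"
proof -
  obtain c d where cd: "\<And>x. x \<ge> 0 \<Longrightarrow> poly q x \<le> real c * (x + 1) ^ d" using real_poly_bound by blast
  obtain c' d' where cd': "\<And>x. poly g x \<le> c' * (x + 1) ^ d'" using nat_poly_bound by blast
  \<comment> \<open>The two bounds compose to \<open>poly g k \<le> C * S n ^ (d * d')\<close>. The
    one additional factor \<open>S n\<close>, which is at least \<open>2 * C + 1\<close>, absorbs
    the constants.\<close>
  define e where "e = d * d' + 1"
  define C where "C = c' * (c * (e + 1) ^ d + 1) ^ d'"
  define S where "S n = poly p n + 2 * C + 1" for n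
  define T where "T = (p + [:2 * C + 1:]) ^ e"
  have T: "poly T n = S n ^ e" for n by (simp add: T_def S_def poly_power algebra_simps)
  have S1: "1 \<le> S n" for n by (simp add: S_def)
  have "2 * poly g k + 1 \<le> poly T n"
    if m: "m \<le> poly p n" and k: "real k \<le> poly q (log 2 (real (poly T n)) + real m)" for n m k
  proof -
    have "real (S n) \<le> 2 ^ S n" using less_exp[of "S n"] by (metis less_imp_le of_nat_le_iff of_nat_numeral of_nat_power)
    then have "log 2 (real (S n)) \<le> real (S n)" using S1[of n] by (simp add: log_le_iff powr_realpow)
    then have log: "log 2 (real (poly T n)) \<le> real e * real (S n)"
      using S1[of n] by (simp add: T log_nat_power mult_left_mono)
    have nonneg: "0 \<le> log 2 (real (poly T n))" using S1[of n] by (simp add: T)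
    have "log 2 (real (poly T n)) + real m + 1 \<le> real ((e + 1) * S n)"
      using log m by (simp add: S_def algebra_simps)
    then have "(log 2 (real (poly T n)) + real m + 1) ^ d \<le> real ((e + 1) * S n) ^ d"
      using nonneg by (intro power_mono) auto
    moreover have "real k \<le> real c * (log 2 (real (poly T n)) + real m + 1) ^ d"
      using k cd[of "log 2 (real (poly T n)) + real m"] nonneg by linarith
    ultimately have "real k \<le> real c * real ((e + 1) * S n) ^ d"
      by (meson mult_left_mono of_nat_0_le_iff order_trans)
    then have "real k \<le> real (c * ((e + 1) * S n) ^ d)" by simp
    then have "k \<le> c * ((e + 1) * S n) ^ d" by (simp only: of_nat_le_iff)
    then have "k + 1 \<le> c * (e + 1) ^ d * S n ^ d + S n ^ d"
      using one_le_power[OF S1[of n], of d] unfolding power_mult_distrib by (simp add: mult.assoc)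
    then have "k + 1 \<le> (c * (e + 1) ^ d + 1) * S n ^ d" by (simp add: algebra_simps)
    then have "(k + 1) ^ d' \<le> ((c * (e + 1) ^ d + 1) * S n ^ d) ^ d'" by (rule power_mono) simp
    then have "c' * (k + 1) ^ d' \<le> c' * ((c * (e + 1) ^ d + 1) * S n ^ d) ^ d'" by (rule mult_le_mono2)
    also have "\<dots> = C * S n ^ (d * d')"
      unfolding C_def power_mult_distrib power_mult by (simp only: mult.assoc)
    finally have "c' * (k + 1) ^ d' \<le> C * S n ^ (d * d')" .
    then have "poly g k \<le> C * S n ^ (d * d')" using cd'[of k] by linarith
    then have "2 * poly g k + 1 \<le> (2 * C + 1) * S n ^ (d * d')"
      using one_le_power[OF S1[of n], of "d * d'"] by (simp add: algebra_simps)
    also have "\<dots> \<le> S n * S n ^ (d * d')" by (rule mult_le_mono1) (simp add: S_def)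
    also have "\<dots> = poly T n" by (simp add: T e_def)
    finally show ?thesis .
  qed
  moreover have "1 \<le> poly T n" for n unfolding T using S1[of n] by (rule one_le_power)
  ultimately show ?thesis by blast
qed

section \<open>The verifier\<close>

text \<open>Inserts an algorithm with promise set \<open>D\<close> into a larger program.
  Injectivity of the encoding makes its argument a function of the registers.\<close>

lemma ptl_polytime_comp:
  assumes f: "polytime_on D ein eout f" and "inj_on ein D"
    and "\<And>a. a \<in> D \<Longrightarrow> length (ein a) = n" "\<And>a. a \<in> D \<Longrightarrow> length (eout (f a)) = k"
    and h: "ptl A (\<lambda>xs. ein (h xs))" "\<And>xs. xs \<in> A \<Longrightarrow> h xs \<in> D"
  shows "ptl A (\<lambda>xs. eout (f (h xs)))"
proof -
  have "ptl (ein ` D) (\<lambda>ys. eout (f (inv_into D ein ys)))"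
    by (rule polytime_on_ptl[OF f]) (use assms in \<open>auto simp: f_inv_into_f intro: inv_into_into\<close>)
  from ptl_comp[OF h(1) this] h(2) have "ptl A (\<lambda>xs. eout (f (inv_into D ein (ein (h xs)))))" by auto
  then show ?thesis by (rule ptl_cong) (use assms in simp)
qed

lemma length_unary [simp]: "length (unary k) = k"
  by (simp add: unary_def)

lemma unary_inject [simp]: "unary k = unary l \<longleftrightarrow> k = l"
  by (metis length_unary)

definition entry :: "instance_pair \<Rightarrow> str \<Rightarrow> str" where
  "entry = (\<lambda>(I, k) s. enc_list [I, unary k, s])"

lemma entry_inject: "entry z s = entry z' s' \<longleftrightarrow> z = z' \<and> s = s'"
proof
  assume "entry z s = entry z' s'"
  then have "decode (entry z s) = decode (entry z' s')" by simp
  then show "z = z' \<and> s = s'" by (auto simp: entry_def simp del: enc_list_Cons split: prod.splits)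
qed simp

lemma length_enc_list_le: "(\<And>x. x \<in> set xs \<Longrightarrow> length x \<le> m) \<Longrightarrow> length (enc_list xs) \<le> length xs * (2 * m + 1)"
proof (induction xs)
  case (Cons x xs)
  then have "length (enc_list xs) \<le> length xs * (2 * m + 1)" "length x \<le> m" by auto
  then show ?case by (simp add: length_enc1)
qed simp

lemma polytime_length:
  assumes "polytime_on UNIV str_code str_code f"
  obtains p :: "nat poly" where "\<And>x. length (f x) \<le> poly p (length x)"
proof -
  have "ptl (range (\<lambda>x. [x])) (\<lambda>xs. str_code (f (xs ! 0)))"
    by (rule polytime_on_ptl[OF assms]) (auto simp: str_code_def)
  then obtain p where p: "\<And>xs. xs \<in> range (\<lambda>x. [x]) \<Longrightarrow> total_length (str_code (f (xs ! 0))) \<le> poly p (total_length xs)"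
    using ptl_size by blast
  have "length (f x) \<le> poly p (length x)" for x using p[of "[x]"] by (simp add: str_code_def)
  then show ?thesis by (rule that)
qed

text \<open>Fixes the witnesses of all existential assumptions at once, together with a reduction
  \<open>f\<close> of one language \<open>A\<close> to \<open>L\<close>.\<close>

locale gap_compression =
  fixes \<alpha> :: real and A L :: "str set" and P P' :: opt_problem
    and R :: "(str \<times> str) set" and comp :: "str list \<Rightarrow> instance_pair \<times> numeral_code" and q :: "real poly"
    and red :: "instance_pair \<Rightarrow> instance_pair" and lift :: "instance_pair \<times> instance_pair \<times> str \<Rightarrow> str"
    and g :: "nat poly" and val :: "instance_pair \<times> str \<Rightarrow> numeral_code" and f :: "str \<Rightarrow> str"
  assumes alpha: "\<alpha> \<ge> 1"
    and f_poly: "polytime_on UNIV str_code str_code f" and f_iff: "\<And>x. x \<in> A \<longleftrightarrow> f x \<in> L"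
    and R: "poly_equiv_rel R"
    and comp_poly: "polytime_on {xs. xs \<noteq> [] \<and> set xs \<times> set xs \<subseteq> R} str_list_code composed_code comp"
    and comp: "\<forall>xs. xs \<noteq> [] \<and> set xs \<times> set xs \<subseteq> R \<longrightarrow>
           (\<exists>y k c r. comp xs = ((y, k), c) \<and> num_value c = ereal r \<and>
              (case sense P of
                 Maximize \<Rightarrow>
                   (OPT P y k \<ge> ereal r \<longleftrightarrow> (\<exists>x\<in>set xs. x \<in> L)) \<and>
                   (OPT P y k < ereal (r / \<alpha>) \<longleftrightarrow> (\<forall>x\<in>set xs. x \<notin> L))
               | Minimize \<Rightarrow>
                   (OPT P y k \<le> ereal r \<longleftrightarrow> (\<exists>x\<in>set xs. x \<in> L)) \<and>
                   (OPT P y k > ereal (r * \<alpha>) \<longleftrightarrow> (\<forall>x\<in>set xs. x \<notin> L))) \<and>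
              real k \<le> poly q (log 2 (real (length xs)) + real (Max (length ` set xs))))"
    and ppt: "approx_ppt \<alpha> P P' red lift"
    and red_size: "\<And>I k I' k'. red (I, k) = (I', k') \<Longrightarrow> length I' + k' \<le> poly g k"
    and val_poly: "polytime_on UNIV inst_sol_code num_code val"
    and val: "\<And>I k s. num_value (val ((I, k), s)) = objective P I k s"
begin

definition valid :: "str list \<Rightarrow> bool" where
  "valid xs \<longleftrightarrow> xs \<noteq> [] \<and> set xs \<times> set xs \<subseteq> R"

definition target :: "str list \<Rightarrow> instance_pair" where
  "target xs = red (fst (comp xs))"

definition value_of :: "str list \<Rightarrow> str \<Rightarrow> numeral_code" where
  "value_of xs s = make_proper (val (fst (comp xs), lift (fst (comp xs), target xs, s)))"

text \<open>Certifies the side of the gap on which no tuple member is in \<open>L\<close>: value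
  times \<alpha> below the threshold for maximization, threshold times \<alpha> below the value for
  minimization.\<close>

definition below :: "str \<Rightarrow> str \<Rightarrow> str \<Rightarrow> str \<Rightarrow> numeral_code \<Rightarrow> numeral_code \<Rightarrow> bool" where
  "below g' h e f' v c = (case sense P of Maximize \<Rightarrow> num_less g' h e f' v c | Minimize \<Rightarrow> num_less g' h e f' c v)"

text \<open>
  The verifier is run on \<open>u = enc_list [x, adv]\<close> and \<open>w = enc_list [enc_list xs, s]\<close>; the advice is
  \<open>adv = enc_list [g', h, e, f', enc_list D]\<close> where \<open>g' / h\<close> and \<open>e / f'\<close> replace \<open>\<alpha>\<close> in comparisons and \<open>D\<close>
  lists pairs of a compressed instance and an optimal solution.
\<close>

definition accepts :: "str list \<Rightarrow> str \<Rightarrow> str \<Rightarrow> bool" where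
  "accepts xs s adv \<longleftrightarrow> s \<in> case_prod solutions (target xs) \<and>
     entry (target xs) s \<in> set (decode (first (rest (rest (rest (rest adv)))))) \<and>
     below (first adv) (first (rest adv)) (first (rest (rest adv))) (first (rest (rest (rest adv))))
       (value_of xs s) (snd (comp xs))"

definition images :: "str \<Rightarrow> str list" where
  "images w = map f (decode (first w))"

text \<open>The witness lists strings before reduction, so \<open>x\<close> itself is looked up in
  it. Relating every image to the first one suffices, as \<open>R\<close> is an equivalence
  relation. The images occur in coded form because programs see lists only through their
  codes.\<close>

definition verifies :: "str \<Rightarrow> str \<Rightarrow> bool" where
  "verifies u w \<longleftrightarrow> first u \<in> set (decode (first w)) \<and>
     (\<forall>y\<in>set (decode (enc_list (images w))). (first (enc_list (images w)), y) \<in> R) \<and>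
     accepts (images w) (first (rest w)) (first (rest u))"

lemma ptl_comp_code:
  assumes h: "pt D (\<lambda>zs. enc_list (h zs))" "\<And>zs. zs \<in> D \<Longrightarrow> valid (h zs)"
  shows "ptl D (\<lambda>zs. inst_code (fst (comp (h zs))))" "ptl D (\<lambda>zs. num_code (snd (comp (h zs))))"
proof -
  have c: "ptl D (\<lambda>zs. composed_code (comp (h zs)))"
  proof (rule ptl_polytime_comp[OF comp_poly, where n = 1 and k = 5])
    show "inj_on str_list_code X" for X by (rule inj_onI) (metis decode_enc_list list.inject str_list_code_def)
    show "ptl D (\<lambda>zs. str_list_code (h zs))" using ptl_single[OF h(1)] by (simp add: str_list_code_def)
  qed (use h(2) in \<open>auto simp: str_list_code_def composed_code_def inst_code_def num_code_def valid_def split: prod.splits\<close>)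
  have i: "pt D (\<lambda>zs. composed_code (comp (h zs)) ! j)" if "j < 5" for j
    by (rule ptl_nth[OF c]) (use that in \<open>auto simp: composed_code_def inst_code_def num_code_def split: prod.splits\<close>)
  have "ptl D (\<lambda>zs. [composed_code (comp (h zs)) ! 0, composed_code (comp (h zs)) ! 1])"
    by (intro ptl_Cons ptl_single i) auto
  then show "ptl D (\<lambda>zs. inst_code (fst (comp (h zs))))"
    by (rule ptl_cong) (auto simp: composed_code_def inst_code_def num_code_def split: prod.splits)
  have "ptl D (\<lambda>zs. [composed_code (comp (h zs)) ! 2, composed_code (comp (h zs)) ! 3, composed_code (comp (h zs)) ! 4])"
    by (intro ptl_Cons ptl_single i) auto
  then show "ptl D (\<lambda>zs. num_code (snd (comp (h zs))))"
    by (rule ptl_cong) (auto simp: composed_code_def inst_code_def num_code_def split: prod.splits)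
qed

lemma inj_inst_code: "inj_on inst_code X"
  by (auto simp: inj_on_def inst_code_def)

lemma length_inst_code: "length (inst_code x) = 2"
  by (simp add: inst_code_def split: prod.splits)

lemma ptl_target:
  assumes h: "pt D (\<lambda>zs. enc_list (h zs))" "\<And>zs. zs \<in> D \<Longrightarrow> valid (h zs)"
  shows "ptl D (\<lambda>zs. inst_code (target (h zs)))"
  unfolding target_def
  by (rule ptl_polytime_comp[where D = UNIV and ein = inst_code and n = 2 and k = 2])
    (use ppt ptl_comp_code[OF h] in \<open>auto simp: approx_ppt_def inj_inst_code length_inst_code\<close>)

lemma ptl_value_of:
  assumes h: "pt D (\<lambda>zs. enc_list (h zs))" "\<And>zs. zs \<in> D \<Longrightarrow> valid (h zs)"
    and s: "pt D s" "\<And>zs. zs \<in> D \<Longrightarrow> s zs \<in> case_prod solutions (target (h zs))"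
  shows "ptl D (\<lambda>zs. num_code (value_of (h zs) (s zs)))"
proof -
  let ?x = "\<lambda>zs. fst (comp (h zs))"
  let ?D = "{(x, x', s'). x' = red x \<and> s' \<in> case_prod solutions x'}"
  have "polytime_on ?D lift_code str_code lift"
    using ppt unfolding approx_ppt_def by blast
  then have "ptl D (\<lambda>zs. str_code (lift (?x zs, target (h zs), s zs)))"
  proof (rule ptl_polytime_comp[where n = 5 and k = 1])
    have "ptl D (\<lambda>zs. inst_code (?x zs) @ inst_code (target (h zs)) @ [s zs])"
      by (intro ptl_append ptl_single ptl_comp_code ptl_target h s)
    then show "ptl D (\<lambda>zs. lift_code (?x zs, target (h zs), s zs))" by (simp add: lift_code_def)
    show "inj_on lift_code ?D" by (auto simp: inj_on_def lift_code_def inst_code_def)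
  qed (use s(2) in \<open>auto simp: lift_code_def inst_code_def str_code_def target_def\<close>)
  then have l: "ptl D (\<lambda>zs. [lift (?x zs, target (h zs), s zs)])" by (simp add: str_code_def)
  have "ptl D (\<lambda>zs. num_code (val (?x zs, lift (?x zs, target (h zs), s zs))))"
  proof (rule ptl_polytime_comp[OF val_poly, where n = 3 and k = 3])
    have "ptl D (\<lambda>zs. inst_code (?x zs) @ [lift (?x zs, target (h zs), s zs)])"
      by (intro ptl_append ptl_comp_code h l)
    then show "ptl D (\<lambda>zs. inst_sol_code (?x zs, lift (?x zs, target (h zs), s zs)))" by (simp add: inst_sol_code_def)
    show "inj inst_sol_code" by (auto simp: inj_on_def inst_sol_code_def inst_code_def)
  qed (auto simp: inst_sol_code_def inst_code_def num_code_def split: prod.splits)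
  then show ?thesis unfolding value_of_def by (rule ptl_make_proper)
qed

lemma ptb_accepts:
  assumes h: "pt D (\<lambda>zs. enc_list (h zs))" "\<And>zs. zs \<in> D \<Longrightarrow> valid (h zs)" and s: "pt D s" and adv: "pt D adv"
  shows "ptb D (\<lambda>zs. accepts (h zs) (s zs) (adv zs))"
  unfolding accepts_def
proof (rule ptb_conj_on)
  have z: "pt D (\<lambda>zs. fst (target (h zs)))" "pt D (\<lambda>zs. unary (snd (target (h zs))))"
    using ptl_nth[OF ptl_target[OF h], of 0] ptl_nth[OF ptl_target[OF h], of 1]
    by (simp_all add: inst_code_def case_prod_unfold)
  \<comment> \<open>Solutions are limited only in length, so being one is a length comparison with
    the instance followed by its unary parameter.\<close>
  have "ptb D (\<lambda>zs. length (s zs) \<le> length (fst (target (h zs)) @ unary (snd (target (h zs)))))"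
    by (intro ptb_length_le pt_append z s)
  then show "ptb D (\<lambda>zs. s zs \<in> case_prod solutions (target (h zs)))"
    by (rule ptb_cong) (simp add: solutions_def case_prod_unfold)
  let ?D = "{zs \<in> D. s zs \<in> case_prod solutions (target (h zs))}"
  have sub: "?D \<subseteq> D" by auto
  have "pt D (\<lambda>zs. enc1 (fst (target (h zs))) @ enc1 (unary (snd (target (h zs)))) @ enc1 (s zs))"
    by (intro pt_append pt_enc1 z s)
  then have "pt D (\<lambda>zs. entry (target (h zs)) (s zs))"
    by (rule pt_cong) (simp add: entry_def case_prod_unfold)
  then have mem: "ptb ?D (\<lambda>zs. entry (target (h zs)) (s zs) \<in> set (decode (first (rest (rest (rest (rest (adv zs))))))))"
    by (intro ptb_mono[OF ptb_mem_decode sub] pt_decode1 adv)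
  have v: "ptl ?D (\<lambda>zs. num_code (value_of (h zs) (s zs)))"
    by (intro ptl_value_of pt_mono[OF _ sub] h s) auto
  have c: "ptl ?D (\<lambda>zs. num_code (snd (comp (h zs))))"
    by (intro ptl_mono[OF _ sub] ptl_comp_code h)
  have "ptb ?D (\<lambda>zs. below (first (adv zs)) (first (rest (adv zs))) (first (rest (rest (adv zs))))
      (first (rest (rest (rest (adv zs))))) (value_of (h zs) (s zs)) (snd (comp (h zs))))"
    unfolding below_def
    by (cases "sense P") (auto intro!: ptb_num_less pt_decode1 pt_mono[OF adv sub] v c)
  with mem show "ptb ?D (\<lambda>zs. entry (target (h zs)) (s zs) \<in> set (decode (first (rest (rest (rest (rest (adv zs))))))) \<and>
      below (first (adv zs)) (first (rest (adv zs))) (first (rest (rest (adv zs))))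
      (first (rest (rest (rest (adv zs))))) (value_of (h zs) (s zs)) (snd (comp (h zs))))"
    by (rule ptb_conj)
qed

lemma equiv_R: "equiv UNIV R"
  using R by (simp add: poly_equiv_rel_def)

lemma ptb_R:
  assumes "pt D a" "pt D b"
  shows "ptb D (\<lambda>zs. (a zs, b zs) \<in> R)"
proof -
  have "polytime_on UNIV str_pair_code bool_code (\<lambda>z. z \<in> R)"
    using R by (simp add: poly_equiv_rel_def)
  then have "ptl D (\<lambda>zs. bool_code ((a zs, b zs) \<in> R))"
  proof (rule ptl_polytime_comp[where n = 2 and k = 1])
    show "ptl D (\<lambda>zs. str_pair_code (a zs, b zs))"
      unfolding str_pair_code_def by (simp add: ptl_Cons ptl_single assms)
  qed (auto simp: str_pair_code_def bool_code_def inj_on_def)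
  then show ?thesis by (simp add: ptb_def pt_def bool_code_def)
qed

lemma valid_images:
  assumes "x \<in> set (decode (first w))"
    and "\<forall>y\<in>set (decode (enc_list (images w))). (first (enc_list (images w)), y) \<in> R"
  shows "valid (images w)"
proof -
  have "images w \<noteq> []" using assms(1) by (auto simp: images_def)
  moreover have "(y, z) \<in> R" if "y \<in> set (images w)" "z \<in> set (images w)" for y z
    using that assms(2) equiv_R by (metis decode_enc_list equivE symD transD)
  ultimately show ?thesis by (auto simp: valid_def)
qed

lemma ptb_verifies: "ptb {zs. length zs = 2} (\<lambda>zs. verifies (zs ! 0) (zs ! 1))"
  unfolding verifies_def
\<comment> \<open>The order of the conjuncts matters: when the composition is run, the earlier ones
  have established a nonempty tuple of images within one class.\<close>
proof (intro ptb_conj_on)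
  have f: "pt {ys. length ys = 1} (\<lambda>ys. f (ys ! 0))"
  proof -
    have "ptl {ys. length ys = 1} (\<lambda>ys. str_code (f (ys ! 0)))"
      by (rule polytime_on_ptl[OF f_poly]) (use length_eq_lists(2) in \<open>fastforce simp: str_code_def\<close>)+
    then show ?thesis by (simp add: pt_def str_code_def)
  qed
  show "ptb {zs. length zs = 2} (\<lambda>zs. first (zs ! 0) \<in> set (decode (first (zs ! 1))))"
    by (intro ptb_mem_decode pt_decode1 pt_nth arity_Collect) auto
  let ?D = "{zs \<in> {zs. length zs = 2}. first (zs ! 0) \<in> set (decode (first (zs ! 1)))}"
  \<comment> \<open>For two registers and also for three, where the quantified \<open>y\<close>
    occupies the third.\<close>
  have im: "pt {zs. length zs = n} (\<lambda>zs. enc_list (images (zs ! 1)))" if "1 < n" for n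
    unfolding images_def by (intro pt_map_decode f pt_decode1 pt_nth arity_Collect) (use that in auto)
  have "ptb {zs. length zs = 3} (\<lambda>zs. (first (enc_list (images (zs ! 1))), zs ! 2) \<in> R)"
    by (intro ptb_R pt_decode1 im pt_nth arity_Collect) auto
  then have "ptb {zs. length zs = 2} (\<lambda>zs. \<forall>y\<in>set (decode (enc_list (images (zs ! 1)))).
      (first (enc_list (images ((zs @ [y]) ! 1))), (zs @ [y]) ! 2) \<in> R)"
    by (intro ptb_ball_decode im) auto
  then show "ptb ?D (\<lambda>zs. \<forall>y\<in>set (decode (enc_list (images (zs ! 1)))). (first (enc_list (images (zs ! 1))), y) \<in> R)"
    by (intro ptb_mono[of "{zs. length zs = 2}" _ ?D]) (auto elim!: ptb_cong simp: nth_append)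
  let ?E = "{zs \<in> ?D. \<forall>y\<in>set (decode (enc_list (images (zs ! 1)))). (first (enc_list (images (zs ! 1))), y) \<in> R}"
  have sub: "?E \<subseteq> {zs. length zs = 2}" by auto
  show "ptb ?E (\<lambda>zs. accepts (images (zs ! 1)) (first (rest (zs ! 1))) (first (rest (zs ! 0))))"
  proof (rule ptb_accepts)
    show "pt ?E (\<lambda>zs. enc_list (images (zs ! 1)))" by (intro pt_mono[OF im sub]) simp
    show "pt ?E (\<lambda>zs. first (rest (zs ! 1)))" "pt ?E (\<lambda>zs. first (rest (zs ! 0)))"
      by (intro pt_decode1 pt_nth arity_subset[OF arity_Collect sub], simp)+
    show "valid (images (zs ! 1))" if "zs \<in> ?E" for zs using that valid_images by blast
  qed
qed

section \<open>Correctness of the verifier\<close>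

lemma lift_solution:
  assumes "s \<in> case_prod solutions (red x)"
  shows "lift (x, red x, s) \<in> case_prod solutions x"
    and "case sense P of
        Minimize \<Rightarrow> sol_ratio P x (lift (x, red x, s)) \<le> ereal \<alpha> * sol_ratio P' (red x) s
      | Maximize \<Rightarrow> sol_ratio P x (lift (x, red x, s)) * ereal \<alpha> \<ge> sol_ratio P' (red x) s"
  using ppt[unfolded approx_ppt_def, THEN conjunct2, THEN conjunct2, rule_format, OF assms]
  by (rule conjunct1, rule conjunct2)

lemma value_bound:
  assumes "fst (comp xs) = (y, k)" "s \<in> case_prod solutions (target xs)"
  shows "sense P = Maximize \<Longrightarrow> num_value (value_of xs s) \<le> OPT P y k"
    and "sense P = Minimize \<Longrightarrow> OPT P y k \<le> num_value (value_of xs s)"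
proof -
  have "lift ((y, k), target xs, s) \<in> solutions y k"
    using lift_solution(1)[of s "(y, k)"] assms by (simp add: target_def)
  then have "objective P y k (lift ((y, k), target xs, s)) \<in> objective P y k ` solutions y k" by blast
  moreover have "finite (objective P y k ` solutions y k)" by (simp add: finite_solutions)
  moreover have "num_value (value_of xs s) = objective P y k (lift ((y, k), target xs, s))"
    by (simp add: value_of_def num_value_make_proper val assms(1))
  ultimately show "sense P = Maximize \<Longrightarrow> num_value (value_of xs s) \<le> OPT P y k"
    "sense P = Minimize \<Longrightarrow> OPT P y k \<le> num_value (value_of xs s)"
    by (simp_all add: OPT_def)
qed

text \<open>The gap puts the optimum strictly beyond the threshold, and no lifted solution is better
  than the optimum. Sharpness of the thresholds turns this real inequality into a passed rational
  test.\<close>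

lemma accepts_complete:
  assumes "valid xs" "\<forall>x\<in>set xs. x \<notin> L"
    and s: "s \<in> case_prod solutions (target xs)" "entry (target xs) s \<in> set D"
    and th: "sharp_thresholds \<alpha> K g' h e f'"
    and len: "\<And>w. w \<in> set (num_code (value_of xs s)) \<union> set (num_code (snd (comp xs))) \<Longrightarrow> length w \<le> M" "2 * M \<le> K"
  shows "accepts xs s (enc_list [g', h, e, f', enc_list D])"
proof -
  obtain y k c r where c: "comp xs = ((y, k), c)" "num_value c = ereal r"
    and opt: "case sense P of Maximize \<Rightarrow> OPT P y k < ereal (r / \<alpha>) | Minimize \<Rightarrow> OPT P y k > ereal (r * \<alpha>)"
    using comp[THEN spec, of xs] assms(1,2) unfolding valid_def by (cases "sense P") auto
  \<comment> \<open>A finite value excludes denominator 0, so only the computed objective value has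
    to pass through \<open>make_proper\<close>.\<close>
  have "proper c" using c(2) by (cases c) (auto simp: proper_def num_value_simps split: if_splits)
  have pv: "proper (value_of xs s)" by (simp add: value_of_def proper_make_proper)
  have fc: "fst (comp xs) = (y, k)" using c by simp
  have "below g' h e f' (value_of xs s) c"
  proof (cases "sense P")
    case Maximize
    then have "num_value (value_of xs s) < ereal (r / \<alpha>)"
      using value_bound(1)[OF fc s(1)] opt by (auto elim: le_less_trans)
    then have "num_value (value_of xs s) * ereal \<alpha> < ereal r"
      using alpha by (cases "num_value (value_of xs s)") (auto simp: field_simps)
    then have "num_less g' h e f' (value_of xs s) c"
      by (intro num_less_complete[OF th alpha pv \<open>proper c\<close>, where M = M]) (use len c in auto)
    then show ?thesis by (simp add: below_def Maximize)
  next
    case Minimize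
    then have "ereal (r * \<alpha>) < num_value (value_of xs s)"
      using value_bound(2)[OF fc s(1)] opt by (auto elim: less_le_trans)
    then have "num_less g' h e f' c (value_of xs s)"
      by (intro num_less_complete[OF th alpha \<open>proper c\<close> pv, where M = M]) (use len c in auto)
    then show ?thesis by (simp add: below_def Minimize)
  qed
  then show ?thesis using s c by (simp add: accepts_def)
qed

text \<open>Exactly what soundness relies on; sharpness and covering concern completeness. That a
  listed \<open>s\<close> is a solution is left to the check in \<open>accepts\<close>.\<close>

definition good_advice :: "str \<Rightarrow> bool" where
  "good_advice adv \<longleftrightarrow> (\<exists>g' h e f' D. adv = enc_list [g', h, e, f', enc_list D] \<and> thresholds \<alpha> g' h e f' \<and>
     (\<forall>d\<in>set D. \<exists>I k s. d = entry (I, k) s \<and> objective P' I k s = OPT P' I k))"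

lemma accepts_sound:
  assumes "valid xs" "accepts xs s adv" "good_advice adv"
  shows "\<forall>x\<in>set xs. x \<notin> L"
proof (rule ccontr)
  assume "\<not> ?thesis"
  then have ex: "\<exists>x\<in>set xs. x \<in> L" "\<not> (\<forall>x\<in>set xs. x \<notin> L)" by auto
  obtain y k c r where c: "comp xs = ((y, k), c)" "num_value c = ereal r"
    and opt: "case sense P of Maximize \<Rightarrow> OPT P y k \<ge> ereal r \<and> \<not> OPT P y k < ereal (r / \<alpha>)
      | Minimize \<Rightarrow> OPT P y k \<le> ereal r \<and> \<not> OPT P y k > ereal (r * \<alpha>)"
    using comp[THEN spec, of xs] assms(1) ex unfolding valid_def by (cases "sense P") auto
  from assms(3) obtain g' h e f' D where adv: "adv = enc_list [g', h, e, f', enc_list D]" "thresholds \<alpha> g' h e f'"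
    "\<And>d. d \<in> set D \<Longrightarrow> \<exists>I k s. d = entry (I, k) s \<and> objective P' I k s = OPT P' I k"
    unfolding good_advice_def by blast
  from assms(2) have s: "s \<in> case_prod solutions (target xs)" "entry (target xs) s \<in> set D"
    "below g' h e f' (value_of xs s) c"
    by (auto simp: accepts_def adv(1) c)
  have fc: "fst (comp xs) = (y, k)" using c by simp
  obtain I' k' where t: "target xs = (I', k')" by fastforce
  \<comment> \<open>Injectivity of \<open>entry\<close> ties the listed solution to this very
    target.\<close>
  from adv(3)[OF s(2)] have "objective P' I' k' s = OPT P' I' k'" by (auto simp: entry_inject t)
  then have "sol_ratio P' (target xs) s = 1" by (simp add: sol_ratio_def t approx_ratio_def)
  moreover have "sol_ratio P (y, k) (lift ((y, k), target xs, s)) = approx_ratio (num_value (value_of xs s)) (OPT P y k)"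
    by (simp add: sol_ratio_def value_of_def num_value_make_proper val c)
  ultimately have ratio: "case sense P of Minimize \<Rightarrow> approx_ratio (num_value (value_of xs s)) (OPT P y k) \<le> ereal \<alpha> * 1
      | Maximize \<Rightarrow> approx_ratio (num_value (value_of xs s)) (OPT P y k) * ereal \<alpha> \<ge> 1"
    using lift_solution(2)[of s "(y, k)"] s(1) c by (cases "sense P") (simp_all add: target_def)
  show False
  proof (cases "sense P")
    case Maximize
    have "num_value (value_of xs s) * ereal \<alpha> < ereal r"
      using num_less_sound[OF adv(2) alpha, of "value_of xs s" c] s(3) c(2) by (simp add: below_def Maximize)
    moreover have "\<not> num_value (value_of xs s) * ereal \<alpha> < ereal r"
      by (rule gap_maximize[OF alpha value_bound(1)[OF fc s(1) Maximize]]) (use ratio opt Maximize in auto)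
    ultimately show False by blast
  next
    case Minimize
    have "ereal r * ereal \<alpha> < num_value (value_of xs s)"
      using num_less_sound[OF adv(2) alpha, of c "value_of xs s"] s(3) c(2) by (simp add: below_def Minimize)
    moreover have "\<not> ereal r * ereal \<alpha> < num_value (value_of xs s)"
      by (rule gap_minimize[OF alpha value_bound(2)[OF fc s(1) Minimize]]) (use ratio opt Minimize in auto)
    ultimately show False by blast
  qed
qed

lemma verifies_sound:
  assumes "verifies (enc_list [x, adv]) w" "good_advice adv"
  shows "x \<notin> A"
proof -
  have x: "x \<in> set (decode (first w))" and v: "valid (images w)" and a: "accepts (images w) (first (rest w)) adv"
    using assms(1) valid_images[of x w] by (auto simp: verifies_def)
  from accepts_sound[OF v a assms(2)] x show ?thesis by (auto simp: images_def f_iff)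
qed

text \<open>The numerals are outputs of a polynomial-time program, hence short. This bounds the
  precision of the thresholds before any witness is known.\<close>

lemma ex_code_bound:
  "\<exists>b :: nat poly. \<forall>xs s w. valid xs \<longrightarrow> s \<in> case_prod solutions (target xs) \<longrightarrow>
     w \<in> set (num_code (value_of xs s)) \<union> set (num_code (snd (comp xs))) \<longrightarrow>
     length w \<le> poly b (length (enc_list xs) + length s)"
proof -
  let ?D = "{[enc_list xs, s] | xs s. valid xs \<and> s \<in> case_prod solutions (target xs)}"
  have ar: "arity ?D" unfolding arity_def by (intro exI[of _ 2]) auto
  have h: "pt ?D (\<lambda>zs. enc_list (decode (zs ! 0)))"
    by (rule pt_cong[OF pt_nth[OF ar, of 0]]) auto
  have "ptl ?D (\<lambda>zs. num_code (value_of (decode (zs ! 0)) (zs ! 1)) @ num_code (snd (comp (decode (zs ! 0)))))"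
    by (intro ptl_append ptl_value_of ptl_comp_code h pt_nth ar) auto
  then obtain b where b: "\<And>zs. zs \<in> ?D \<Longrightarrow>
      total_length (num_code (value_of (decode (zs ! 0)) (zs ! 1)) @ num_code (snd (comp (decode (zs ! 0)))))
      \<le> poly b (total_length zs)" using ptl_size by blast
  have "length w \<le> poly b (length (enc_list xs) + length s)"
    if "valid xs" "s \<in> case_prod solutions (target xs)"
      "w \<in> set (num_code (value_of xs s)) \<union> set (num_code (snd (comp xs)))" for xs s w
  proof -
    have "length w \<le> total_length (num_code (value_of xs s) @ num_code (snd (comp xs)))"
      by (rule member_le_sum_list) (use that(3) in auto)
    also have "\<dots> \<le> poly b (length (enc_list xs) + length s)"
    proof -
      have "[enc_list xs, s] \<in> ?D"
        using that(1,2) by (intro CollectI exI[of _ xs] exI[of _ s] conjI refl)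
      from b[OF this] show ?thesis by simp
    qed
    finally show ?thesis .
  qed
  then show ?thesis by blast
qed

section \<open>Construction of the advice\<close>

lemma target_size:
  assumes "valid xs" "length xs = poly T n" "\<And>x. x \<in> set xs \<Longrightarrow> length x \<le> poly p n"
    and T: "\<And>m k. m \<le> poly p n \<Longrightarrow> real k \<le> poly q (log 2 (real (poly T n)) + real m) \<Longrightarrow> 2 * poly g k + 1 \<le> poly T n"
    and "target xs = (I, k)"
  shows "2 * (length I + k) + 1 \<le> poly T n"
proof -
  obtain y k' c r where c: "comp xs = ((y, k'), c)"
    "real k' \<le> poly q (log 2 (real (length xs)) + real (Max (length ` set xs)))"
    using comp[THEN spec, of xs] assms(1) unfolding valid_def by blast
  have "Max (length ` set xs) \<le> poly p n" using assms(1,3) by (auto simp: valid_def)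
  from T[OF this] c(2) assms(2) have "2 * poly g k' + 1 \<le> poly T n" by simp
  moreover have "length I + k \<le> poly g k'" using red_size assms(5) by (simp add: target_def c)
  then have "2 * (length I + k) + 1 \<le> 2 * poly g k' + 1" by simp
  ultimately show ?thesis by (rule order_trans[rotated])
qed

lemma ex_advice:
  "\<exists>a b :: nat poly. \<forall>n. \<exists>adv. length adv \<le> poly a n \<and> good_advice adv \<and>
     (\<forall>x. length x = n \<longrightarrow> x \<notin> A \<longrightarrow> (\<exists>w. length w \<le> poly b n \<and> verifies (enc_list [x, adv]) w))"
proof -
  obtain p where p: "\<And>x. length (f x) \<le> poly p (length x)" using polytime_length[OF f_poly] by blast
  obtain T where T: "\<And>n. 1 \<le> poly T n"
    "\<And>n m k. m \<le> poly p n \<Longrightarrow> real k \<le> poly q (log 2 (real (poly T n)) + real m) \<Longrightarrow> 2 * poly g k + 1 \<le> poly T n"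
    using ex_tuple_length[of p q g] by metis
  obtain qR where qR: "\<And>S. finite S \<Longrightarrow> S \<noteq> {} \<Longrightarrow> card (S // R) \<le> poly qR (Max (length ` S))"
    using R unfolding poly_equiv_rel_def by blast
  obtain qb where qb: "\<And>xs s w. valid xs \<Longrightarrow> s \<in> case_prod solutions (target xs) \<Longrightarrow>
     w \<in> set (num_code (value_of xs s)) \<union> set (num_code (snd (comp xs))) \<Longrightarrow>
     length w \<le> poly qb (length (enc_list xs) + length s)"
    using ex_code_bound by metis
  obtain K0 where K0: "\<alpha> + 1 < 2 ^ K0" using real_arch_pow[of 2 "\<alpha> + 1"] by auto
  \<comment> \<open>Bit length of the numerals for an honest witness: the code of \<open>T\<close>
    images of length at most \<open>p\<close> has at most \<open>T * (2 * p + 1)\<close> bits, and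
    the stored solution at most \<open>T\<close>.\<close>
  define qB where "qB = pcompose qb (T * (2 * p + 1) + T)"
  \<comment> \<open>Four thresholds of \<open>2 * qB + K0\<close> bits, each coded with doubled
    length plus 1, and the doubled code of the list of entries.\<close>
  define a where "a = 16 * qB + [:8 * K0 + 5:] + 2 * (pcompose qR p * [:1, 1:] * (8 * T + 7))"
  define b where "b = 2 * (T * [:1, 2:]) + 2 * T + 2"
  have "\<exists>adv. length adv \<le> poly a n \<and> good_advice adv \<and>
     (\<forall>x. length x = n \<longrightarrow> x \<notin> A \<longrightarrow> (\<exists>w. length w \<le> poly b n \<and> verifies (enc_list [x, adv]) w))" for n
  proof -
    define t where "t = poly T n"
    \<comment> \<open>The largest \<open>m\<close> with \<open>2 * m + 1 \<le> t\<close>, so that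
      there are at most \<open>2 ^ t\<close> instances of size \<open>m\<close>.\<close>
    define m where "m = (t - 1) div 2"
    have t: "t \<ge> 1" "2 * m + 1 \<le> t" using T(1)[of n] by (auto simp: t_def m_def)
    define Z where "Z = {(I :: str, k :: nat). length I + k \<le> m}"
    have Z: "finite Z" "card Z \<le> 2 ^ t"
      using card_instances[of m] power_increasing[OF t(2), of "2 :: nat"] by (auto simp: Z_def)
    define U where "U = {x. length x = n \<and> x \<notin> A}"
    have cU: "finite U" "card U \<le> 2 ^ n"
    proof -
      have fin: "finite {x :: str. set x \<subseteq> UNIV \<and> length x = n}" by (rule finite_lists_length_eq) simp
      have sub: "U \<subseteq> {x. set x \<subseteq> UNIV \<and> length x = n}" by (auto simp: U_def)
      show "finite U" by (rule finite_subset[OF sub fin])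
      show "card U \<le> 2 ^ n" using card_mono[OF fin sub] card_lists_length_eq[of "UNIV :: bool set" n] by simp
    qed
    \<comment> \<open>Only tuples whose images share a class can be composed, so each class of
      images is covered separately.\<close>
    define W where "W C = {x \<in> U. f x \<in> C}" for C
    have valid: "valid (map f xs)" if "C \<in> (f ` U) // R" "length xs = t" "set xs \<subseteq> W C" for C xs
    proof -
      from that(1) obtain y where C: "C = R `` {y}" by (auto simp: quotient_def)
      have "(f x, f x') \<in> R" if "x \<in> set xs" "x' \<in> set xs" for x x'
      proof -
        have "(y, f x) \<in> R" "(y, f x') \<in> R" using that \<open>set xs \<subseteq> W C\<close> by (auto simp: W_def C)
        then show ?thesis using equiv_R by (metis equivE symD transD)
      qed
      moreover have "xs \<noteq> []" using that(2) t(1) by auto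
      ultimately show ?thesis by (auto simp: valid_def)
    qed
    have img_len: "length y \<le> poly p n" if "y \<in> f ` U" for y
      using that p by (auto simp: U_def)
    have inZ: "target (map f xs) \<in> Z" if "C \<in> (f ` U) // R" "length xs = t" "set xs \<subseteq> W C" for C xs
    proof -
      obtain I k where Ik: "target (map f xs) = (I, k)" by fastforce
      have "2 * (length I + k) + 1 \<le> poly T n"
        by (rule target_size[OF valid[OF that] _ _ T(2) Ik])
          (use that img_len in \<open>auto simp: t_def W_def\<close>)
      then show ?thesis by (auto simp: Ik Z_def m_def t_def)
    qed
    \<comment> \<open>A class has at most \<open>2 ^ n < 2 ^ (n + 1)\<close> preimages in
      \<open>U\<close>, hence \<open>n + 1\<close> halvings.\<close>
    have "\<exists>D \<subseteq> Z. card D \<le> n + 1 \<and>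
        (\<forall>x\<in>W C. \<exists>xs. length xs = t \<and> set xs \<subseteq> W C \<and> x \<in> set xs \<and> target (map f xs) \<in> D)"
      if "C \<in> (f ` U) // R" for C
    proof (rule covering[OF Z t(1)])
      show "finite (W C)" using cU by (simp add: W_def)
      have "card (W C) \<le> card U" using cU by (intro card_mono) (auto simp: W_def)
      then show "card (W C) < 2 ^ (n + 1)" using cU(2) less_le_trans[of "2 ^ n" "2 ^ (n + 1) :: nat"]
        by (simp add: le_less_trans)
    qed (rule inZ[OF that])
    then obtain D where D: "\<And>C. C \<in> (f ` U) // R \<Longrightarrow> D C \<subseteq> Z"
      "\<And>C. C \<in> (f ` U) // R \<Longrightarrow> card (D C) \<le> n + 1"
      "\<And>C x. C \<in> (f ` U) // R \<Longrightarrow> x \<in> W C \<Longrightarrow>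
        \<exists>xs. length xs = t \<and> set xs \<subseteq> W C \<and> x \<in> set xs \<and> target (map f xs) \<in> D C"
      by metis
    define DD where "DD = (\<Union>C\<in>(f ` U) // R. D C)"
    have DDZ: "DD \<subseteq> Z" using D(1) by (auto simp: DD_def)
    have classes: "card ((f ` U) // R) \<le> poly qR (poly p n)"
    proof (cases "U = {}")
      case False
      then have "card ((f ` U) // R) \<le> poly qR (Max (length ` f ` U))" using qR cU by simp
      also have "\<dots> \<le> poly qR (poly p n)"
        by (rule poly_nat_mono) (use False cU img_len in auto)
      finally show ?thesis .
    qed (simp add: quotient_def)
    have fq: "finite ((f ` U) // R)" using cU by (simp add: quotient_def)
    have "card DD \<le> (\<Sum>C\<in>(f ` U) // R. card (D C))" unfolding DD_def by (rule card_UN_le[OF fq])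
    also have "\<dots> \<le> card ((f ` U) // R) * (n + 1)" using D(2) by (intro sum_bounded_above[THEN order_trans]) auto
    also have "\<dots> \<le> poly qR (poly p n) * (n + 1)" by (rule mult_le_mono1[OF classes])
    finally have cDD: "card DD \<le> poly qR (poly p n) * (n + 1)" .
    have "\<forall>z. \<exists>s. s \<in> case_prod solutions z \<and> (case z of (I, k) \<Rightarrow> objective P' I k s = OPT P' I k)"
      using ex_optimal[of _ _ P'] unfolding Bex_def by auto
    from choice[OF this] obtain sol where "\<forall>z. sol z \<in> case_prod solutions z \<and> (case z of (I, k) \<Rightarrow> objective P' I k (sol z) = OPT P' I k)"
      by (elim exE)
    then have sol: "sol z \<in> case_prod solutions z" "objective P' I k (sol (I, k)) = OPT P' I k" for z I k
      by auto
    obtain Ds where Ds: "set Ds = (\<lambda>z. entry z (sol z)) ` DD" "distinct Ds"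
      using finite_distinct_list[of "(\<lambda>z. entry z (sol z)) ` DD"] finite_subset[OF DDZ Z(1)] by auto
    have "length Ds = card ((\<lambda>z. entry z (sol z)) ` DD)" using Ds by (metis distinct_card)
    also have "\<dots> \<le> card DD" by (rule card_image_le[OF finite_subset[OF DDZ Z(1)]])
    finally have lDs: "length Ds \<le> poly qR (poly p n) * (n + 1)" using cDD by linarith
    have sol_len: "length (sol z) \<le> m" if "z \<in> Z" for z
      using sol(1)[of z] that by (auto simp: Z_def solutions_def)
    have "length d \<le> 4 * t + 3" if "d \<in> set Ds" for d
    proof -
      from that Ds obtain z where z: "z \<in> Z" "d = entry z (sol z)" using DDZ by auto
      obtain I k where Ik: "z = (I, k)" by fastforce
      have "length d = 2 * (length I + k) + 2 * length (sol z) + 3" by (simp add: z(2) entry_def Ik length_enc1)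
      then show ?thesis using sol_len[OF z(1)] z(1) t(2) by (simp add: Ik Z_def)
    qed
    \<comment> \<open>The factor is \<open>2 * (4 * t + 3) + 1\<close>, the coded length of one
      entry.\<close>
    from length_enc_list_le[of Ds, OF this] have "length (enc_list Ds) \<le> length Ds * (8 * t + 7)" by (simp add: algebra_simps)
    also have "\<dots> \<le> poly qR (poly p n) * (n + 1) * (8 * t + 7)" by (rule mult_le_mono1[OF lDs])
    finally have lenc: "length (enc_list Ds) \<le> poly qR (poly p n) * (n + 1) * (8 * t + 7)" .
    \<comment> \<open>Twice the numeral length leaves room for products of two numerals;
      \<open>K0\<close> provides a fraction above \<alpha>.\<close>
    define K where "K = 2 * poly qB n + K0"
    have "(2::real) ^ K0 \<le> 2 ^ K" by (rule power_increasing) (simp_all add: K_def)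
    with K0 have "\<alpha> + 1 < 2 ^ K" by linarith
    then obtain g' h e f' where th: "length g' = K" "length h = K" "length e = K" "length f' = K"
      "sharp_thresholds \<alpha> K g' h e f'" using ex_sharp_thresholds[OF alpha] by blast
    define adv where "adv = enc_list [g', h, e, f', enc_list Ds]"
    have "length adv = 16 * poly qB n + (8 * K0 + 5) + 2 * length (enc_list Ds)"
      by (simp add: adv_def length_enc1 th K_def)
    then have "length adv \<le> poly a n" using lenc by (simp add: a_def t_def poly_pcompose algebra_simps)
    moreover have "\<exists>I k s. d = entry (I, k) s \<and> objective P' I k s = OPT P' I k" if "d \<in> set Ds" for d
    proof -
      from that Ds obtain I k where "d = entry (I, k) (sol (I, k))" by auto
      then show ?thesis using sol(2) by blast
    qed
    then have "good_advice adv"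
      using th(5) unfolding good_advice_def adv_def sharp_thresholds_def by blast
    moreover have "\<exists>w. length w \<le> poly b n \<and> verifies (enc_list [x, adv]) w" if x: "length x = n" "x \<notin> A" for x
    proof -
      let ?C = "R `` {f x}"
      have xU: "x \<in> U" using x by (simp add: U_def)
      have C: "?C \<in> (f ` U) // R" using xU by (auto intro: quotientI)
      have "x \<in> W ?C" using xU equiv_class_self[OF equiv_R] by (auto simp: W_def)
      from D(3)[OF C this] obtain xs where xs: "length xs = t" "set xs \<subseteq> W ?C" "x \<in> set xs" "target (map f xs) \<in> D ?C"
        by blast
      let ?z = "target (map f xs)" and ?w = "enc_list [enc_list xs, sol (target (map f xs))]"
      have v: "valid (map f xs)" by (rule valid[OF C xs(1,2)])
      have zZ: "?z \<in> Z" by (rule inZ[OF C xs(1,2)])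
      have zD: "entry ?z (sol ?z) \<in> set Ds" using xs(4) C Ds by (auto simp: DD_def)
      have xsU: "y \<in> U" if "y \<in> set xs" for y using xs(2) that by (auto simp: W_def)
      have img: "images ?w = map f xs" by (simp add: images_def)
      have "accepts (map f xs) (sol ?z) adv"
        unfolding adv_def
      proof (rule accepts_complete[OF v _ sol(1) zD th(5)])
        show "\<forall>y\<in>set (map f xs). y \<notin> L" using xsU by (auto simp: U_def f_iff)
        have "length (enc_list (map f xs)) \<le> t * (2 * poly p n + 1)"
          using length_enc_list_le[of "map f xs" "poly p n"] img_len xsU xs(1) by auto
        moreover have "length (sol ?z) \<le> t" using sol_len[OF zZ] t by simp
        ultimately have "length (enc_list (map f xs)) + length (sol ?z) \<le> poly (T * (2 * p + 1) + T) n"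
          by (simp add: t_def)
        from poly_nat_mono[OF this, of qb] have "poly qb (length (enc_list (map f xs)) + length (sol ?z)) \<le> poly qB n"
          by (simp only: qB_def poly_pcompose)
        then show "length w \<le> poly qB n"
          if "w \<in> set (num_code (value_of (map f xs) (sol ?z))) \<union> set (num_code (snd (comp (map f xs))))" for w
          using qb[OF v sol(1) that] by linarith
      qed (simp add: K_def)
      moreover have "\<forall>y\<in>set (decode (enc_list (map f xs))). (first (enc_list (map f xs)), y) \<in> R"
      proof -
        from v obtain y ys where "map f xs = y # ys" by (cases "map f xs") (auto simp: valid_def)
        then show ?thesis using v by (auto simp: valid_def simp del: enc_list_Cons) (auto simp: valid_def)
      qed
      ultimately have "verifies (enc_list [x, adv]) ?w"
        using xs(3) unfolding verifies_def img by simp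
      moreover have "length (enc_list xs) \<le> t * (2 * n + 1)"
        using length_enc_list_le[of xs n] xsU xs(1) by (auto simp: U_def)
      then have "length ?w \<le> poly b n" using sol_len[OF zZ] t(2)
        by (simp add: b_def length_enc1 t_def algebra_simps)
      ultimately show ?thesis by blast
    qed
    ultimately show ?thesis by blast
  qed
  then show ?thesis by blast
qed

lemma in_coNP_poly: "A \<in> per_poly coNP"
proof -
  obtain a b :: "nat poly" and adv where adv: "\<And>n. length (adv n) \<le> poly a n" "\<And>n. good_advice (adv n)"
    "\<And>x. x \<notin> A \<Longrightarrow> \<exists>w. length w \<le> poly b (length x) \<and> verifies (enc_list [x, adv (length x)]) w"
    using ex_advice by metis
  \<comment> \<open>The witness bound is applied to the whole input including the advice, so it may
    exceed \<open>poly b (length x)\<close>. Honest witnesses fit by monotonicity, and longer ones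
    do no harm because soundness holds for every length.\<close>
  let ?N = "{u. \<exists>w. length w \<le> poly b (length u) \<and> verifies u w}"
  have "polytime_on UNIV str_pair_code bool_code (\<lambda>z. z \<in> {(u, w). verifies u w})"
    by (rule ptl_polytime_on[OF ptb_verifies[unfolded ptb_def pt_def]]) (auto simp: str_pair_code_def bool_code_def)
  then have "?N \<in> NP" unfolding NP_def
    by (intro CollectI exI[of _ "{(u, w). verifies u w}"] exI[of _ b]) auto
  then have "- ?N \<in> coNP" by (simp add: coNP_def)
  moreover have "x \<in> A \<longleftrightarrow> enc_list [x, adv (length x)] \<in> - ?N" for x
  proof (cases "x \<in> A")
    case True
    then show ?thesis using verifies_sound adv(2) by auto
  next
    case False
    from adv(3)[OF this] obtain w where w: "length w \<le> poly b (length x)" "verifies (enc_list [x, adv (length x)]) w"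
      by blast
    have "poly b (length x) \<le> poly b (length (enc_list [x, adv (length x)]))"
      by (rule poly_nat_mono) (simp add: length_enc1)
    then have "enc_list [x, adv (length x)] \<in> ?N" using w order_trans by blast
    then show ?thesis using False by simp
  qed
  ultimately show ?thesis unfolding per_poly_def using adv(1) by blast
qed

end

theorem theorem7p9:
  fixes \<alpha> :: real and L :: "str set" and \<Pi> :: opt_problem
  assumes "\<alpha> \<ge> 1"
    and "NP_hard L"
    and "param_opt_problem \<Pi>" and "nice \<Pi>"
    and "gap_cross_composes \<alpha> L \<Pi>"
    and "poly_sized_approx_compression \<alpha> \<Pi>"
  shows "NP \<subseteq> per_poly coNP"
proof
  fix A assume "A \<in> NP"
  with assms(2) obtain f where f: "polytime_on UNIV str_code str_code f" "\<And>x. x \<in> A \<longleftrightarrow> f x \<in> L"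
    unfolding NP_hard_def karp_reducible_def by blast
  from assms(4) obtain val where val: "polytime_on UNIV inst_sol_code num_code val"
    "\<And>I k s. num_value (val ((I, k), s)) = objective \<Pi> I k s"
    unfolding nice_def by blast
  from assms(6) obtain g P' red lift where comp: "approx_ppt \<alpha> \<Pi> P' red lift"
    "\<And>I k I' k'. red (I, k) = (I', k') \<Longrightarrow> length I' + k' \<le> poly g k"
    unfolding poly_sized_approx_compression_def approx_compression_def by blast
  from assms(5) show "A \<in> per_poly coNP" unfolding gap_cross_composes_def
    by (elim exE conjE)
      (rule gap_compression.in_coNP_poly[OF gap_compression.intro[OF assms(1) f _ _ _ comp val]])
qed

end
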